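(* For all $\alpha\in(-\infty,0]^{(V_\infty)}$, the sequence $(M^{(n)}_\alpha)_{n\in\mathbb{N}}$ defined by $$M^{(n)}_\alpha=\exp\Big(\sum_{j\in\tilde V_n}\alpha^{(n)}_j\,e^{u^{(n)}_j}\big(1+\mathrm{i}\,s^{(n)}_j\big)\Big)$$ (with $\mathrm{i}=\sqrt{-1}$) is a $\mathbb{C}$-valued martingale under $\mu^W_\infty$ with respect to the filtration $\big(\mathcal{F}_n=\sigma(\boldsymbol{\beta}^{(n)},\boldsymbol{\theta}^{(n)})\big)_{n\in\mathbb{N}}$.
   Context: Finite-volume model. Let $\tilde G=(\tilde V,\tilde E)$ be a finite connected undirected graph without loops or parallel edges, $\delta\in\tilde V$ a distinguished vertex, $V=\tilde V\setminus\{\delta\}$, with weights $W_{ij}=W_{ji}>0$ if $i\sim j$ and $W_{ij}=0$ otherwise. Let $\Omega_V=\{(u,s)\in\mathbb{R}^{\tilde V}\times\mathbb{R}^{\tilde V}:u_\delta=s_\delta=0\}$. Let $A^W(u)\in\mathbb{R}^{\tilde V\times\tilde V}$ have entries $-W_{ij}e^{u_i+u_j}$ for $i\neq j$ and $\sum_{k\in\tilde V}W_{ik}e^{u_i+u_k}$ for $i=j$, and let $A^W_{VV}(u)$ be its restriction to $V\times V$. The probability measure $\mu^W$ on $\Omega_V$ is $$\mu^W(du\,ds)=\det A^W_{VV}(u)\prod_{(i\sim j)\in\tilde E}e^{-W_{ij}[\cosh(u_i-u_j)-1+\frac12(s_i-s_j)^2e^{u_i+u_j}]}\prod_{i\in V}\frac{e^{-u_i}}{2\pi}du_i\,ds_i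 .$$ For $i\in V$: $\beta_i^{V}(u)=\frac12\sum_{j\in\tilde V}W_{ij}e^{u_j-u_i}$, $\theta^{V}_i(u,s)=\sum_{j\in\tilde V}W_{ij}e^{u_j}(s_i-s_j)$, i.e. $\theta^V=\mathrm{diag}(e^{-u_i})_{i\in V}A^W_{VV}(u)s_V$. It is known that $u$ is a measurable function of $\beta^V$: there is a measurable $f_V^W:\mathbb{R}^V\to\mathbb{R}^{\tilde V}$ with $u=f_V^W(\beta^V(u))$ for all $u\in\mathbb{R}^{\tilde V}$ with $u_\delta=0$. Consequently $s=g_V^W(\beta^V,\theta^V)$, where $g_V^W:\mathbb{R}^V\times\mathbb{R}^V\to\mathbb{R}^{\tilde V}$ is the measurable function with $g_V^W(\beta,\theta)=s$ given by $s_\delta=0$, $s_V=A^W_{VV}(u)^{-1}\mathrm{diag}(e^{u_i})_{i\in V}\,\theta$ with $u=f_V^W(\beta)$. Infinite graph and wired approximation. $G_\infty=(V_\infty,E_\infty)$ is an infinite undirected graph with edge weights $W_{ij}=W_{ji}>0$ for $i\sim j$ and $W_{ij}=0$ otherwise. It is approximated by finite graphs $\tilde G_n=(\tilde V_n,\tilde E_n)$, $\tilde V_n=V_n\cup\{\delta_n\}$, with $V_n\subseteq V_{n+1}$ finite subsets of $V_\infty$, $\bigcup_nV_n=V_\infty$, and $\tilde E_n=E_n\cup\{(i\sim\delta_n):i\in V_n,\ \exists j\in V_\infty\setminus V_n:(i\sim j)\in E_\infty\}$, where $E_n$ is the set of edges in $E_\infty$ with both endpoints in $V_n$. Weights on $\tilde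 G_n$: $W^{(n)}_{ij}=W_{ij}$ for $i,j\in V_n$; $W^{(n)}_{i\delta_n}=W^{(n)}_{\delta_ni}=\sum_{j\in V_\infty\setminus V_n}W_{ij}$ for $i\in V_n$; $W^{(n)}_{\delta_n\delta_n}=0$. It is assumed that these sums are finite and that each $\tilde G_n$ satisfies the assumptions on finite graphs above. $\mu_n^W$ denotes the measure above for $\tilde G_n$ with distinguished vertex $\delta_n$ and weights $W^{(n)}$; $\beta^{V_n},\theta^{V_n}$ are the corresponding variables and $f^W_{V_n},g^W_{V_n}$ the corresponding functions. Infinite volume coupling. The laws of $(\beta^{V_n},\theta^{V_n})$ under $\mu^W_n$, $n\in\mathbb{N}$, are consistent, so by Kolmogorov's theorem there is a probability space $(\Omega_\infty,\mathcal{F}_\infty,\mu^W_\infty)$ with real random variables $\boldsymbol{\beta}_i,\boldsymbol{\theta}_i$, $i\in V_\infty$, such that for every $n$ the law of $(\boldsymbol{\beta}^{(n)},\boldsymbol{\theta}^{(n)})=((\boldsymbol{\beta}_i)_{i\in V_n},(\boldsymbol{\theta}_i)_{i\in V_n})$ under $\mu_\infty^W$ equals the law of $(\beta^{V_n},\theta^{V_n})$ under $\mu^W_n$. Set $u^{(n)}=f^W_{V_n}(\boldsymbol{\beta}^{(n)})$ and $s^{(n)}=g^W_{V_n}(\boldsymbol{\beta}^{(n)},\boldsymbol{\theta}^{(n)})$, both indexed by $\tilde V_n$. Parameters. $(-\infty,0]^{(V_\infty)}$ is the set of $\alpha\in(-\infty,0]^{V_\infty}$ with only finitely many nonzero entries.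 For such $\alpha$, $\alpha^{(n)}\in(-\infty,0]^{\tilde V_n}$ is given by $\alpha^{(n)}_i=\alpha_i$ for $i\in V_n$ and $\alpha^{(n)}_{\delta_n}=\sum_{j\in V_\infty\setminus V_n}\alpha_j$. *)

theory Defs
  imports "HOL-Probability.Probability"
begin

section \<open>Weighted graphs\<close>

text \<open>An edge is a set of two distinct vertices, so there are neither loops nor parallel
  edges. The weight vanishes off the edges, in particular on the diagonal.\<close>

definition weighted_graph :: "'a set \<Rightarrow> 'a set set \<Rightarrow> ('a \<Rightarrow> 'a \<Rightarrow> real) \<Rightarrow> bool" where
  "weighted_graph V E W \<longleftrightarrow>
     (\<forall>e\<in>E. e \<subseteq> V \<and> card e = 2) \<and>
     (\<forall>i\<in>V. \<forall>j\<in>V. W i j = W j i \<and> (if {i, j} \<in> E then W i j > 0 else W i j = 0))"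

definition connected_graph :: "'a set \<Rightarrow> 'a set set \<Rightarrow> bool" where
  "connected_graph V E \<longleftrightarrow> (\<forall>i\<in>V. \<forall>j\<in>V. (i, j) \<in> {(x, y). {x, y} \<in> E}\<^sup>*)"

definition finite_model_graph ::
    "'a set \<Rightarrow> 'a set set \<Rightarrow> ('a \<Rightarrow> 'a \<Rightarrow> real) \<Rightarrow> 'a \<Rightarrow> bool" where
  "finite_model_graph Vt E W \<delta> \<longleftrightarrow>
     finite Vt \<and> \<delta> \<in> Vt \<and> weighted_graph Vt E W \<and> connected_graph Vt E"

text \<open>The common value \<open>F i j = F j i\<close> of a symmetric function on the edge \<open>{i, j}\<close>.\<close>

definition edge_val :: "('a \<Rightarrow> 'a \<Rightarrow> real) \<Rightarrow> 'a set \<Rightarrow> real" where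
  "edge_val F e = (THE x. \<exists>i j. e = {i, j} \<and> x = F i j)"

lemma edge_val_doubleton:
  assumes "F i j = F j i"
  shows "edge_val F {i, j} = F i j"
  unfolding edge_val_def by (rule the_equality) (use assms in \<open>auto simp: doubleton_eq_iff\<close>)


section \<open>Matrices indexed by a finite set\<close>

text \<open>Here the index set varies with \<open>n\<close>, so the type-indexed \<open>det\<close> and \<open>matrix_inv\<close>
  of \<open>HOL-Analysis\<close> do not apply; both definitions are relativized to a carrier.\<close>

definition det_on :: "'a set \<Rightarrow> ('a \<Rightarrow> 'a \<Rightarrow> real) \<Rightarrow> real" where
  "det_on V A = (\<Sum>p | p permutes V. of_int (sign p) * (\<Prod>i\<in>V. A i (p i)))"

definition matrix_inv_on :: "'a set \<Rightarrow> ('a \<Rightarrow> 'a \<Rightarrow> real) \<Rightarrow> 'a \<Rightarrow> 'a \<Rightarrow> real" where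
  "matrix_inv_on V A = (SOME B. \<forall>i\<in>V. \<forall>j\<in>V.
     (\<Sum>k\<in>V. A i k * B k j) = (if i = j then 1 else 0) \<and>
     (\<Sum>k\<in>V. B i k * A k j) = (if i = j then 1 else 0))"


section \<open>The finite-volume model\<close>

text \<open>The points of \<open>RV V\<close> are the functions on \<open>V\<close> that are \<open>undefined\<close>
  outside \<open>V\<close>.\<close>

abbreviation RV :: "'a set \<Rightarrow> ('a \<Rightarrow> real) measure" where
  "RV V \<equiv> Pi\<^sub>M V (\<lambda>_. borel)"

definition Omega_V :: "'a set \<Rightarrow> 'a \<Rightarrow> (('a \<Rightarrow> real) \<times> ('a \<Rightarrow> real)) set" where
  "Omega_V Vt \<delta> = {(u, s). u \<in> space (RV Vt) \<and> s \<in> space (RV Vt) \<and> u \<delta> = 0 \<and> s \<delta> = 0}"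

definition A_mat :: "'a set \<Rightarrow> ('a \<Rightarrow> 'a \<Rightarrow> real) \<Rightarrow> ('a \<Rightarrow> real) \<Rightarrow> 'a \<Rightarrow> 'a \<Rightarrow> real" where
  "A_mat Vt W u i j =
     (if i = j then \<Sum>k\<in>Vt. W i k * exp (u i + u k) else - W i j * exp (u i + u j))"

definition mu_density ::
    "'a set \<Rightarrow> 'a set set \<Rightarrow> ('a \<Rightarrow> 'a \<Rightarrow> real) \<Rightarrow> 'a \<Rightarrow> ('a \<Rightarrow> real) \<Rightarrow> ('a \<Rightarrow> real) \<Rightarrow> real" where
  "mu_density Vt E W \<delta> u s =
     det_on (Vt - {\<delta>}) (A_mat Vt W u) *
     (\<Prod>e\<in>E. exp (- edge_val (\<lambda>i j. W i j *
        (cosh (u i - u j) - 1 + (s i - s j)\<^sup>2 * exp (u i + u j) / 2)) e)) *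
     (\<Prod>i\<in>Vt - {\<delta>}. exp (- u i) / (2 * pi))"

text \<open>Lebesgue measure \<open>\<Prod>\<^sub>i du\<^sub>i ds\<^sub>i\<close> over \<open>i \<in> V\<close>, carried over
  to \<open>\<Omega>\<^sub>V\<close> by setting both coordinates at \<open>\<delta>\<close> to zero.\<close>

definition lebesgue_Omega_V ::
    "'a set \<Rightarrow> 'a \<Rightarrow> (('a \<Rightarrow> real) \<times> ('a \<Rightarrow> real)) measure" where
  "lebesgue_Omega_V Vt \<delta> =
     distr (Pi\<^sub>M (Vt - {\<delta>}) (\<lambda>_. lborel) \<Otimes>\<^sub>M Pi\<^sub>M (Vt - {\<delta>}) (\<lambda>_. lborel))
       (restrict_space (RV Vt \<Otimes>\<^sub>M RV Vt) (Omega_V Vt \<delta>))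
       (\<lambda>(u, s). (u(\<delta> := 0), s(\<delta> := 0)))"

definition mu ::
    "'a set \<Rightarrow> 'a set set \<Rightarrow> ('a \<Rightarrow> 'a \<Rightarrow> real) \<Rightarrow> 'a \<Rightarrow> (('a \<Rightarrow> real) \<times> ('a \<Rightarrow> real)) measure" where
  "mu Vt E W \<delta> =
     density (lebesgue_Omega_V Vt \<delta>) (\<lambda>(u, s). ennreal (mu_density Vt E W \<delta> u s))"

definition beta_V ::
    "'a set \<Rightarrow> ('a \<Rightarrow> 'a \<Rightarrow> real) \<Rightarrow> 'a \<Rightarrow> ('a \<Rightarrow> real) \<Rightarrow> ('a \<Rightarrow> real)" where
  "beta_V Vt W \<delta> u = (\<lambda>i\<in>Vt - {\<delta>}. (\<Sum>j\<in>Vt. W i j * exp (u j - u i)) / 2)"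

definition theta_V ::
    "'a set \<Rightarrow> ('a \<Rightarrow> 'a \<Rightarrow> real) \<Rightarrow> 'a \<Rightarrow> ('a \<Rightarrow> real) \<Rightarrow> ('a \<Rightarrow> real) \<Rightarrow> ('a \<Rightarrow> real)" where
  "theta_V Vt W \<delta> u s = (\<lambda>i\<in>Vt - {\<delta>}. \<Sum>j\<in>Vt. W i j * exp (u j) * (s i - s j))"

text \<open>\<open>f\<close> is a measurable function with \<open>u = f (\<beta>\<^sup>V(u))\<close>. It is only determined
  on the range of \<open>\<beta>\<^sup>V\<close>.\<close>

definition recovers_u ::
    "'a set \<Rightarrow> ('a \<Rightarrow> 'a \<Rightarrow> real) \<Rightarrow> 'a \<Rightarrow> (('a \<Rightarrow> real) \<Rightarrow> ('a \<Rightarrow> real)) \<Rightarrow> bool" where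
  "recovers_u Vt W \<delta> f \<longleftrightarrow>
     f \<in> RV (Vt - {\<delta>}) \<rightarrow>\<^sub>M RV Vt \<and>
     (\<forall>u\<in>space (RV Vt). u \<delta> = 0 \<longrightarrow> f (beta_V Vt W \<delta> u) = u)"

definition g_V ::
    "'a set \<Rightarrow> ('a \<Rightarrow> 'a \<Rightarrow> real) \<Rightarrow> 'a \<Rightarrow> (('a \<Rightarrow> real) \<Rightarrow> ('a \<Rightarrow> real)) \<Rightarrow>
     ('a \<Rightarrow> real) \<Rightarrow> ('a \<Rightarrow> real) \<Rightarrow> ('a \<Rightarrow> real)" where
  "g_V Vt W \<delta> f \<beta> \<theta> = (\<lambda>i\<in>Vt. if i = \<delta> then 0 else
     (\<Sum>j\<in>Vt - {\<delta>}. matrix_inv_on (Vt - {\<delta>}) (A_mat Vt W (f \<beta>)) i j * (exp (f \<beta> j) * \<theta> j)))"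


section \<open>The wired approximation\<close>

definition wired_edges :: "'a set \<Rightarrow> 'a set set \<Rightarrow> 'a set \<Rightarrow> 'a \<Rightarrow> 'a set set" where
  "wired_edges Vinf Einf V \<delta> =
     {e \<in> Einf. e \<subseteq> V} \<union> {{i, \<delta>} |i. i \<in> V \<and> (\<exists>j\<in>Vinf - V. {i, j} \<in> Einf)}"

definition wired_weight ::
    "'a set \<Rightarrow> ('a \<Rightarrow> 'a \<Rightarrow> real) \<Rightarrow> 'a set \<Rightarrow> 'a \<Rightarrow> 'a \<Rightarrow> 'a \<Rightarrow> real" where
  "wired_weight Vinf W V \<delta> i j =
     (if i \<in> V \<and> j \<in> V then W i j
      else if i \<in> V \<and> j = \<delta> then \<Sum>\<^sub>\<infinity>k\<in>Vinf - V. W i k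
      else if i = \<delta> \<and> j \<in> V then \<Sum>\<^sub>\<infinity>k\<in>Vinf - V. W j k
      else 0)"

definition wired_alpha :: "'a set \<Rightarrow> ('a \<Rightarrow> real) \<Rightarrow> 'a set \<Rightarrow> 'a \<Rightarrow> 'a \<Rightarrow> real" where
  "wired_alpha Vinf \<alpha> V \<delta> j = (if j = \<delta> then \<Sum>\<^sub>\<infinity>k\<in>Vinf - V. \<alpha> k else \<alpha> j)"

text \<open>The extra vertex \<open>\<delta> n\<close> is an element of the vertex type outside \<open>Vinf\<close>.\<close>

definition wired_approximation ::
    "'a set \<Rightarrow> 'a set set \<Rightarrow> ('a \<Rightarrow> 'a \<Rightarrow> real) \<Rightarrow> (nat \<Rightarrow> 'a set) \<Rightarrow> (nat \<Rightarrow> 'a) \<Rightarrow> bool" where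
  "wired_approximation Vinf Einf W V \<delta> \<longleftrightarrow>
     (\<forall>n. finite (V n) \<and> V n \<subseteq> V (Suc n)) \<and> (\<Union>n. V n) = Vinf \<and>
     (\<forall>n. \<delta> n \<notin> Vinf) \<and>
     (\<forall>n. \<forall>i\<in>V n. (\<lambda>j. W i j) summable_on (Vinf - V n)) \<and>
     (\<forall>n. finite_model_graph (insert (\<delta> n) (V n)) (wired_edges Vinf Einf (V n) (\<delta> n))
            (wired_weight Vinf W (V n) (\<delta> n)) (\<delta> n))"


section \<open>The infinite-volume coupling\<close>

definition restrict_rv :: "'a set \<Rightarrow> ('a \<Rightarrow> 'w \<Rightarrow> real) \<Rightarrow> 'w \<Rightarrow> ('a \<Rightarrow> real)" where
  "restrict_rv V X \<omega> = (\<lambda>i\<in>V. X i \<omega>)"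

definition infinite_volume_coupling ::
    "'a set \<Rightarrow> 'a set set \<Rightarrow> ('a \<Rightarrow> 'a \<Rightarrow> real) \<Rightarrow> (nat \<Rightarrow> 'a set) \<Rightarrow> (nat \<Rightarrow> 'a) \<Rightarrow>
     'w measure \<Rightarrow> ('a \<Rightarrow> 'w \<Rightarrow> real) \<Rightarrow> ('a \<Rightarrow> 'w \<Rightarrow> real) \<Rightarrow> bool" where
  "infinite_volume_coupling Vinf Einf W V \<delta> M \<beta> \<theta> \<longleftrightarrow>
     prob_space M \<and>
     (\<forall>i\<in>Vinf. \<beta> i \<in> borel_measurable M \<and> \<theta> i \<in> borel_measurable M) \<and>
     (\<forall>n. let Vt = insert (\<delta> n) (V n); Wn = wired_weight Vinf W (V n) (\<delta> n) in
        distr M (RV (V n) \<Otimes>\<^sub>M RV (V n))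
          (\<lambda>\<omega>. (restrict_rv (V n) \<beta> \<omega>, restrict_rv (V n) \<theta> \<omega>)) =
        distr (mu Vt (wired_edges Vinf Einf (V n) (\<delta> n)) Wn (\<delta> n)) (RV (V n) \<Otimes>\<^sub>M RV (V n))
          (\<lambda>(u, s). (beta_V Vt Wn (\<delta> n) u, theta_V Vt Wn (\<delta> n) u s)))"

definition F_n ::
    "'w measure \<Rightarrow> (nat \<Rightarrow> 'a set) \<Rightarrow> ('a \<Rightarrow> 'w \<Rightarrow> real) \<Rightarrow> ('a \<Rightarrow> 'w \<Rightarrow> real) \<Rightarrow> nat \<Rightarrow> 'w measure" where
  "F_n M V \<beta> \<theta> n = vimage_algebra (space M)
     (\<lambda>\<omega>. (restrict_rv (V n) \<beta> \<omega>, restrict_rv (V n) \<theta> \<omega>)) (RV (V n) \<Otimes>\<^sub>M RV (V n))"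

definition u_n ::
    "(nat \<Rightarrow> 'a set) \<Rightarrow> (nat \<Rightarrow> ('a \<Rightarrow> real) \<Rightarrow> ('a \<Rightarrow> real)) \<Rightarrow> ('a \<Rightarrow> 'w \<Rightarrow> real) \<Rightarrow>
     nat \<Rightarrow> 'w \<Rightarrow> 'a \<Rightarrow> real" where
  "u_n V f \<beta> n \<omega> = f n (restrict_rv (V n) \<beta> \<omega>)"

definition s_n ::
    "'a set \<Rightarrow> ('a \<Rightarrow> 'a \<Rightarrow> real) \<Rightarrow> (nat \<Rightarrow> 'a set) \<Rightarrow> (nat \<Rightarrow> 'a) \<Rightarrow>
     (nat \<Rightarrow> ('a \<Rightarrow> real) \<Rightarrow> ('a \<Rightarrow> real)) \<Rightarrow> ('a \<Rightarrow> 'w \<Rightarrow> real) \<Rightarrow> ('a \<Rightarrow> 'w \<Rightarrow> real) \<Rightarrow>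
     nat \<Rightarrow> 'w \<Rightarrow> 'a \<Rightarrow> real" where
  "s_n Vinf W V \<delta> f \<beta> \<theta> n \<omega> =
     g_V (insert (\<delta> n) (V n)) (wired_weight Vinf W (V n) (\<delta> n)) (\<delta> n) (f n)
       (restrict_rv (V n) \<beta> \<omega>) (restrict_rv (V n) \<theta> \<omega>)"


section \<open>Complex-valued martingales\<close>

definition complex_cond_exp ::
    "'w measure \<Rightarrow> 'w measure \<Rightarrow> ('w \<Rightarrow> complex) \<Rightarrow> 'w \<Rightarrow> complex" where
  "complex_cond_exp M F X \<omega> =
     Complex (real_cond_exp M F (\<lambda>x. Re (X x)) \<omega>) (real_cond_exp M F (\<lambda>x. Im (X x)) \<omega>)"

definition complex_martingale ::
    "'w measure \<Rightarrow> (nat \<Rightarrow> 'w measure) \<Rightarrow> (nat \<Rightarrow> 'w \<Rightarrow> complex) \<Rightarrow> bool" where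
  "complex_martingale M F X \<longleftrightarrow>
     filtration (space M) F \<and> (\<forall>n. subalgebra M (F n)) \<and>
     (\<forall>n. X n \<in> borel_measurable (F n)) \<and>
     (\<forall>n. integrable M (X n)) \<and>
     (\<forall>m n. m \<le> n \<longrightarrow> (AE \<omega> in M. complex_cond_exp M (F m) (X n) \<omega> = X m \<omega>))"

end

theory Submission
  imports Defs
begin

text \<open>
  Fix a finite vertex set \<open>V\<close> with pinning weights \<open>\<eta>\<^sub>i = W\<^sub>i\<^sub>\<delta>\<close>, and let
  \<open>H = 2\<beta> - W\<close> be the associated Schroedinger operator on \<open>V\<close>, with Green matrix
  \<open>G = H\<^sup>-\<^sup>1\<close>. The definitions of \<open>\<beta>\<close> and \<open>\<theta>\<close> are the linear systems
  \<open>H e\<^sup>u = \<eta>\<close> and \<open>H (e\<^sup>u s) = \<theta>\<close>. Hence \<open>e\<^sup>u (1 + i s) = G (\<eta> + i \<theta>)\<close>, and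
  the observable of the theorem is the explicit function
  \<open>exp (\<alpha>\<^sub>\<delta> + \<langle>\<alpha>, G (\<eta> + i \<theta>)\<rangle>)\<close> of \<open>(\<beta>, \<theta>)\<close>. The law of \<open>(\<beta>, \<theta>)\<close> is
  explicit too (\<open>distr_mu_coords\<close>): it has the density
  \<open>\<pi>\<^sup>-\<^sup>n (det H)\<^sup>-\<^sup>1 exp (- (\<langle>1, H 1\<rangle> + \<langle>\<eta>, G \<eta>\<rangle> - 2 \<langle>\<eta>, 1\<rangle> + \<langle>\<theta>, G \<theta>\<rangle>) / 2)\<close>
  on the set where \<open>H\<close> is positive definite.

  The martingale property is what remains when one vertex \<open>c\<close> is integrated out. Block
  inversion with respect to \<open>V - {c}\<close> changes each quadratic form by a term of rank one divided
  by the last pivot \<open>p = 2\<beta>\<^sub>c - \<langle>W\<^sub>c, G W\<^sub>c\<rangle>\<close>, which is affine in \<open>\<beta>\<^sub>c\<close>;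
  here \<open>W\<^sub>c\<close> is the row of \<open>c\<close> and \<open>G\<close> belongs to \<open>V - {c}\<close>. With
  \<open>t\<close> a translate of \<open>\<theta>\<^sub>c\<close>, density times observable on \<open>V\<close> factorizes into density times
  observable on \<open>V - {c}\<close>, for the pinning \<open>\<eta> + W\<^sub>c\<close> and the parameter
  \<open>\<alpha>\<^sub>\<delta> + \<alpha>\<^sub>c\<close>, and a function of \<open>(p, t)\<close> alone. The latter integrates to one: a Gaussian
  Fourier integral in \<open>t\<close> merely shifts the coefficient \<open>h > 0\<close> of the remaining reciprocal inverse
  Gaussian weight in \<open>p\<close> to \<open>h - l\<close>, where \<open>l \<le> 0\<close> comes from \<open>\<alpha>\<close>, and these weights are
  normalized for every positive coefficient (\<open>integral_vertex\<close>). Merging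
  \<open>c\<close> into \<open>\<delta>\<close> by adding weights and parameters is exactly how the wired graph on \<open>V m\<close> arises
  from the one on \<open>V n\<close>. Integrating out \<open>V n - V m\<close> (\<open>integral_marginal\<close>) therefore gives
  \<open>E (M\<^sub>n \<phi>) = E (M\<^sub>m \<phi>)\<close> for every bounded function \<open>\<phi>\<close> of
  \<open>(\<beta>\<^sub>i, \<theta>\<^sub>i)\<close>, \<open>i \<in> V m\<close>; integrability holds because \<open>\<alpha> \<le> 0\<close> and
  \<open>G \<ge> 0\<close> entrywise give \<open>\<bar>M\<^sub>n\<bar> \<le> 1\<close>.

  The bilinear form of \<open>G\<close>, the pivots and the determinant are defined by recursion on a list that
  enumerates \<open>V\<close>, so that one vertex at a time can be added or removed. The passage from the
  fields \<open>(u, s)\<close> to \<open>(\<beta>, \<theta>)\<close> (\<open>nn_integral_coords\<close>) is an induction on the same list.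
  For fixed \<open>u\<^sub>c\<close> the other vertices see the same model with \<open>c\<close> merged into the pinning,
  \<open>\<eta> + e\<^sup>u\<^sup>c W\<^sub>c\<close>; once their \<open>u\<close> has been replaced by \<open>\<beta>\<close>, the map from
  \<open>u\<^sub>c\<close> to \<open>\<beta>\<^sub>c\<close> is a substitution in one variable.
\<close>

section \<open>Eliminating vertices from a Schroedinger operator\<close>

text \<open>The bilinear form \<open>\<langle>x, H\<^sup>-\<^sup>1 y\<rangle>\<close> of the inverse of \<open>H = 2 b - W\<close> on the vertices of a list,
computed by Gaussian elimination: adding the vertex \<open>c\<close> to \<open>V\<close> changes the inverse by the rank-one
matrix \<open>v v\<^sup>T / p\<close>, where \<open>v = (1, H\<^sup>-\<^sup>1 W\<^sub>c)\<close> and \<open>p\<close> is the Schur complement of \<open>H\<close> on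
\<open>V\<close>.\<close>

fun green :: "('a \<Rightarrow> 'a \<Rightarrow> real) \<Rightarrow> ('a \<Rightarrow> real) \<Rightarrow> 'a list \<Rightarrow> ('a \<Rightarrow> real) \<Rightarrow> ('a \<Rightarrow> real) \<Rightarrow> real" where
  "green W b [] x y = 0"
| "green W b (c # V) x y = green W b V x y +
     (x c + green W b V (W c) x) * (y c + green W b V (W c) y) / (2 * b c - green W b V (W c) (W c))"

definition pivot :: "('a \<Rightarrow> 'a \<Rightarrow> real) \<Rightarrow> ('a \<Rightarrow> real) \<Rightarrow> 'a \<Rightarrow> 'a list \<Rightarrow> real" where
  "pivot W b c V = 2 * b c - green W b V (W c) (W c)"

text \<open>Sylvester's criterion: this is positive definiteness of \<open>H\<close>.\<close>

fun pos_pivots :: "('a \<Rightarrow> 'a \<Rightarrow> real) \<Rightarrow> ('a \<Rightarrow> real) \<Rightarrow> 'a list \<Rightarrow> bool" where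
  "pos_pivots W b [] = True"
| "pos_pivots W b (c # V) = (pos_pivots W b V \<and> 0 < pivot W b c V)"

fun pivot_prod :: "('a \<Rightarrow> 'a \<Rightarrow> real) \<Rightarrow> ('a \<Rightarrow> real) \<Rightarrow> 'a list \<Rightarrow> real" where
  "pivot_prod W b [] = 1"
| "pivot_prod W b (c # V) = pivot W b c V * pivot_prod W b V"

text \<open>The operator \<open>H = 2 b - W\<close> itself, restricted to \<open>V\<close>.\<close>

definition schrod :: "('a \<Rightarrow> 'a \<Rightarrow> real) \<Rightarrow> ('a \<Rightarrow> real) \<Rightarrow> 'a set \<Rightarrow> ('a \<Rightarrow> real) \<Rightarrow> 'a \<Rightarrow> real" where
  "schrod W b V x i = 2 * b i * x i - (\<Sum>j\<in>V. W i j * x j)"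

text \<open>The vector \<open>H\<^sup>-\<^sup>1 y\<close>, read off from the bilinear form at unit vectors.\<close>

definition green_vec :: "('a \<Rightarrow> 'a \<Rightarrow> real) \<Rightarrow> ('a \<Rightarrow> real) \<Rightarrow> 'a list \<Rightarrow> ('a \<Rightarrow> real) \<Rightarrow> 'a \<Rightarrow> real" where
  "green_vec W b V y i = green W b V (\<lambda>j. of_bool (j = i)) y"

text \<open>The part of a weighted graph that the elimination sees.\<close>

definition conductances :: "('a \<Rightarrow> 'a \<Rightarrow> real) \<Rightarrow> 'a set \<Rightarrow> bool" where
  "conductances W V \<longleftrightarrow> (\<forall>i\<in>V. W i i = 0 \<and> (\<forall>j\<in>V. W i j = W j i \<and> 0 \<le> W i j))"

lemma green_Cons:
  "green W b (c # V) x y = green W b V x y +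
     (x c + green W b V (W c) x) * (y c + green W b V (W c) y) / pivot W b c V"
  by (simp add: pivot_def)

declare green.simps(2) [simp del]

lemma green_commute: "green W b V x y = green W b V y x"
  by (induction V arbitrary: x y) (simp_all add: green_Cons algebra_simps)

text \<open>The form sees its data only on the vertices of the list. This is what allows the data of a smaller
graph to be exchanged for the data of a larger one.\<close>

lemma green_cong:
  assumes "\<And>i. i \<in> set V \<Longrightarrow> b i = b' i" "\<And>i j. i \<in> set V \<Longrightarrow> j \<in> set V \<Longrightarrow> W i j = W' i j"
    and "\<And>i. i \<in> set V \<Longrightarrow> x i = x' i" "\<And>i. i \<in> set V \<Longrightarrow> y i = y' i"
  shows "green W b V x y = green W' b' V x' y'"
  using assms
proof (induction V arbitrary: x y x' y')
  case (Cons c V)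
  have *: "green W b V p q = green W' b' V p' q'"
    if "\<And>i. i \<in> set V \<Longrightarrow> p i = p' i" "\<And>i. i \<in> set V \<Longrightarrow> q i = q' i" for p q p' q'
    by (rule Cons.IH) (use Cons.prems that in auto)
  have "green W b V x y = green W' b' V x' y'" "green W b V (W c) x = green W' b' V (W' c) x'"
    "green W b V (W c) y = green W' b' V (W' c) y'"
    "green W b V (W c) (W c) = green W' b' V (W' c) (W' c)"
    by (rule *; use Cons.prems in auto)+
  then show ?case using Cons.prems by (simp add: green_Cons pivot_def)
qed simp

lemma pivot_cong:
  assumes "\<And>i. i \<in> insert c (set V) \<Longrightarrow> b i = b' i"
    "\<And>i j. i \<in> insert c (set V) \<Longrightarrow> j \<in> insert c (set V) \<Longrightarrow> W i j = W' i j"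
  shows "pivot W b c V = pivot W' b' c V"
proof -
  have "green W b V (W c) (W c) = green W' b' V (W' c) (W' c)"
    by (rule green_cong) (use assms in auto)
  then show ?thesis using assms by (simp add: pivot_def)
qed

lemma pivots_cong:
  assumes "\<And>i. i \<in> set V \<Longrightarrow> b i = b' i" "\<And>i j. i \<in> set V \<Longrightarrow> j \<in> set V \<Longrightarrow> W i j = W' i j"
  shows pos_pivots_cong: "pos_pivots W b V = pos_pivots W' b' V"
    and pivot_prod_cong: "pivot_prod W b V = pivot_prod W' b' V"
proof -
  have "pos_pivots W b V = pos_pivots W' b' V \<and> pivot_prod W b V = pivot_prod W' b' V"
    using assms
  proof (induction V)
    case (Cons c V)
    have "pivot W b c V = pivot W' b' c V" by (rule pivot_cong) (use Cons.prems in auto)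
    with Cons show ?case by simp
  qed simp
  then show "pos_pivots W b V = pos_pivots W' b' V" "pivot_prod W b V = pivot_prod W' b' V" by auto
qed

lemma green_add: "green W b V x (\<lambda>i. y i + z i) = green W b V x y + green W b V x z"
  by (induction V arbitrary: x y z) (simp_all add: green_Cons algebra_simps add_divide_distrib)

lemma green_scale: "green W b V x (\<lambda>i. r * y i) = r * green W b V x y"
  by (induction V arbitrary: x y) (simp_all add: green_Cons algebra_simps add_divide_distrib)

lemma green_add_left: "green W b V (\<lambda>i. y i + z i) x = green W b V y x + green W b V z x"
  by (simp add: green_commute[of _ _ _ _ x] green_add)

lemma green_zero: "(\<And>i. i \<in> set V \<Longrightarrow> y i = 0) \<Longrightarrow> green W b V x y = 0"
  using green_cong[of V b b W W x x y "\<lambda>i. 0 * y i"] green_scale[of W b V x 0 y] by simp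

lemma green_nonneg:
  assumes "pos_pivots W b V" "\<And>i j. i \<in> set V \<Longrightarrow> j \<in> set V \<Longrightarrow> 0 \<le> W i j"
    "\<And>i. i \<in> set V \<Longrightarrow> 0 \<le> x i" "\<And>i. i \<in> set V \<Longrightarrow> 0 \<le> y i"
  shows "0 \<le> green W b V x y"
  using assms
  by (induction V arbitrary: x y) (simp_all add: green_Cons divide_nonneg_pos)

lemma pivot_prod_pos: "pos_pivots W b V \<Longrightarrow> 0 < pivot_prod W b V"
  by (induction V) auto

lemma conductances_subset: "conductances W V \<Longrightarrow> U \<subseteq> V \<Longrightarrow> conductances W U"
  unfolding conductances_def by blast

lemma conductancesD:
  assumes "conductances W V"
  shows "i \<in> V \<Longrightarrow> W i i = 0" "i \<in> V \<Longrightarrow> j \<in> V \<Longrightarrow> W i j = W j i"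
    "i \<in> V \<Longrightarrow> j \<in> V \<Longrightarrow> 0 \<le> W i j"
  using assms unfolding conductances_def by blast+

text \<open>\<open>H\<^sup>-\<^sup>1 H = 1\<close>. On the vertices of \<open>V\<close>, the vector \<open>H y\<close> of the larger list is the one of the
smaller list minus \<open>y\<^sub>c W\<^sub>c\<close>, and the numerator \<open>(H y)\<^sub>c + \<langle>W\<^sub>c, H\<^sup>-\<^sup>1 (H y)\<rangle>\<close> of the rank-one term
collapses to the pivot times \<open>y\<^sub>c\<close>.\<close>

lemma green_schrod:
  assumes "distinct V" "conductances W (set V)" "pos_pivots W b V"
  shows "green W b V x (schrod W b (set V) y) = (\<Sum>i\<in>set V. x i * y i)"
  using assms
proof (induction V arbitrary: x y)
  case (Cons c V)
  let ?g = "green W b V"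
  have c: "c \<notin> set V" using Cons.prems by simp
  have IH: "?g x (schrod W b (set V) y) = (\<Sum>i\<in>set V. x i * y i)" for x y
    by (rule Cons.IH) (use Cons.prems conductances_subset in auto)
  have H: "schrod W b (set (c # V)) y i = schrod W b (set V) y i + (- y c) * W c i" if "i \<in> set V" for i
    using that c conductancesD(2)[OF Cons.prems(2), of i c] by (simp add: schrod_def)
  have g: "?g x (schrod W b (set (c # V)) y) = (\<Sum>i\<in>set V. x i * y i) - y c * ?g x (W c)" for x
  proof -
    have "?g x (schrod W b (set (c # V)) y) = ?g x (\<lambda>i. schrod W b (set V) y i + (- y c) * W c i)"
      by (rule green_cong) (use H in auto)
    then show ?thesis by (simp only: green_add green_scale IH)
  qed
  have 1: "schrod W b (set (c # V)) y c + ?g (W c) (schrod W b (set (c # V)) y) = pivot W b c V * y c"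
    using c conductancesD(1)[OF Cons.prems(2), of c]
    by (simp only: g) (simp add: schrod_def pivot_def algebra_simps)
  have "pivot W b c V \<noteq> 0" using Cons.prems by auto
  then have "green W b (c # V) x (schrod W b (set (c # V)) y) =
      (\<Sum>i\<in>set V. x i * y i) - y c * ?g x (W c) + (x c + ?g (W c) x) * y c"
    by (simp only: green_Cons 1) (simp only: g, simp)
  also have "\<dots> = (\<Sum>i\<in>set (c # V). x i * y i)"
    using c by (simp add: green_commute[of W b V "W c"] algebra_simps)
  finally show ?case .
qed simp

text \<open>\<open>H H\<^sup>-\<^sup>1 = 1\<close>. Back substitution: the entry of the solution at the new vertex is the quotient \<open>t\<close>
by the pivot, and the other entries solve the smaller system with right-hand side
\<open>y + t W\<^sub>c\<close>.\<close>

lemma schrod_green_vec: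
  assumes "distinct V" "conductances W (set V)" "pos_pivots W b V" "i \<in> set V"
  shows "schrod W b (set V) (green_vec W b V y) i = y i"
  using assms
proof (induction V arbitrary: y i)
  case (Cons c V)
  let ?g = "green W b V" let ?t = "(y c + ?g (W c) y) / pivot W b c V"
  have c: "c \<notin> set V" using Cons.prems by simp
  have V: "distinct V" "conductances W (set V)" "pos_pivots W b V"
    using Cons.prems conductances_subset[of W "set (c # V)" "set V"] by auto
  have p: "pivot W b c V \<noteq> 0" using Cons.prems by auto
  have IH: "schrod W b (set V) (green_vec W b V y) i = y i" if "i \<in> set V" for y i
    using Cons.IH V that by auto
  have expand: "?g x y = (\<Sum>i\<in>set V. x i * green_vec W b V y i)" for x y
  proof -
    have "?g x y = ?g x (schrod W b (set V) (green_vec W b V y))"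
      by (rule green_cong) (simp_all add: IH)
    then show ?thesis using green_schrod[OF V] by simp
  qed
  have Gc: "green_vec W b (c # V) y c = ?t"
  proof -
    have "green W b V (\<lambda>j. of_bool (j = c)) z = 0" for z
      by (subst green_commute, rule green_zero) (use c in auto)
    then show ?thesis by (simp add: green_vec_def green_Cons green_commute[of W b V "W c" "\<lambda>j. of_bool (j = c)"])
  qed
  have Gi: "green_vec W b (c # V) y i = green_vec W b V y i + green_vec W b V (W c) i * ?t" if "i \<in> set V" for i
    using c that green_commute[of W b V "W c" "\<lambda>j. of_bool (j = i)"]
    by (auto simp: green_vec_def green_Cons)
  have Hg: "schrod W b (set (c # V)) (green_vec W b (c # V) y) j =
      2 * b j * green_vec W b (c # V) y j - W j c * ?t
        - (\<Sum>k\<in>set V. W j k * (green_vec W b V y k + green_vec W b V (W c) k * ?t))" for j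
    using c Gi by (simp add: schrod_def Gc)
  have sum_G: "(\<Sum>k\<in>set V. W j k * (green_vec W b V y k + green_vec W b V (W c) k * t)) =
      (\<Sum>k\<in>set V. W j k * green_vec W b V y k) + (\<Sum>k\<in>set V. W j k * green_vec W b V (W c) k) * t" for j t
    by (simp add: sum.distrib sum_distrib_right distrib_left mult.assoc)
  show ?case
  proof (cases "i = c")
    case True
    have "(\<Sum>k\<in>set V. W c k * (green_vec W b V y k + green_vec W b V (W c) k * ?t)) = ?g (W c) y + ?g (W c) (W c) * ?t"
      unfolding expand[of "W c" y] expand[of "W c" "W c"] by (rule sum_G)
    then have "schrod W b (set (c # V)) (green_vec W b (c # V) y) c = pivot W b c V * ?t - ?g (W c) y"
      using conductancesD(1)[OF Cons.prems(2), of c]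
      by (simp only: Hg Gc) (simp add: pivot_def left_diff_distrib flip: diff_divide_distrib)
    then show ?thesis using True p by simp
  next
    case False
    with Cons.prems have i: "i \<in> set V" by simp
    have "schrod W b (set (c # V)) (green_vec W b (c # V) y) i =
       schrod W b (set V) (green_vec W b V y) i + schrod W b (set V) (green_vec W b V (W c)) i * ?t - W i c * ?t"
    proof -
      have "p * (x + z * t) - w * t - (S + S' * t) = (p * x - S) + (p * z - S') * t - w * t"
        for p x z t w S S' :: real by (simp add: algebra_simps)
      then show ?thesis unfolding Hg unfolding Gi[OF i] sum_G unfolding schrod_def .
    qed
    also have "\<dots> = y i"
      using i conductancesD(2)[OF Cons.prems(2), of i c] by (simp add: IH)
    finally show ?thesis .
  qed
qed simp

lemma green_eq_sum_green_vec:
  assumes "distinct V" "conductances W (set V)" "pos_pivots W b V"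
  shows "green W b V x y = (\<Sum>i\<in>set V. x i * green_vec W b V y i)"
proof -
  have "green W b V x y = green W b V x (schrod W b (set V) (green_vec W b V y))"
    by (rule green_cong) (simp_all add: schrod_green_vec assms)
  then show ?thesis using green_schrod[OF assms] by simp
qed

section \<open>Pinning, connectedness and positivity\<close>

text \<open>Connectedness of \<open>V\<close> to the pinning vertex, stated as a cut condition: every nonempty subset has an
edge that leaves it, either to the pinning vertex or to the rest of \<open>V\<close>. In this form it is
inherited directly when a vertex is merged into the pinning vertex.\<close>

definition linked :: "('a \<Rightarrow> 'a \<Rightarrow> real) \<Rightarrow> ('a \<Rightarrow> real) \<Rightarrow> 'a set \<Rightarrow> bool" where
  "linked W \<eta> V \<longleftrightarrow> (\<forall>i\<in>V. 0 \<le> \<eta> i) \<and>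
     (\<forall>S\<subseteq>V. S \<noteq> {} \<longrightarrow> (\<exists>i\<in>S. 0 < \<eta> i \<or> (\<exists>j\<in>V - S. 0 < W i j)))"

text \<open>Merging \<open>c\<close> into the pinning vertex. The factor \<open>r\<close> is \<open>1\<close> when \<open>c\<close> is integrated out and
\<open>e\<^sup>u\<^sup>c\<close> in the change of variables.\<close>

lemma linked_remove:
  assumes "linked W \<eta> (set (c # V))" "conductances W (set (c # V))" "0 < r" "c \<notin> set V"
  shows "linked W (\<lambda>i. \<eta> i + W c i * r) (set V)"
  unfolding linked_def
proof (intro conjI ballI allI impI)
  fix i assume "i \<in> set V"
  then show "0 \<le> \<eta> i + W c i * r"
    using assms conductancesD(3)[OF assms(2), of c i] by (auto simp: linked_def)
next
  fix S assume S: "S \<subseteq> set V" "S \<noteq> {}"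
  then obtain i where i: "i \<in> S" "0 < \<eta> i \<or> (\<exists>j\<in>set (c # V) - S. 0 < W i j)"
    using assms(1) unfolding linked_def by (meson set_subset_Cons subset_trans)
  have iV: "i \<in> set (c # V)" using S i by auto
  have sym: "W c i = W i c" "0 \<le> W c i"
    using conductancesD(2,3)[OF assms(2) _ iV, of c] by simp_all
  have "0 \<le> \<eta> i" using assms(1) iV unfolding linked_def by blast
  note sym = sym this
  show "\<exists>i\<in>S. 0 < \<eta> i + W c i * r \<or> (\<exists>j\<in>set V - S. 0 < W i j)"
  proof (cases "\<exists>j\<in>set V - S. 0 < W i j")
    case False
    then have "0 < \<eta> i \<or> 0 < W i c" using i S by auto
    then have "0 < \<eta> i + W c i * r"
      using sym \<open>0 < r\<close> by (auto simp: add_pos_nonneg add_nonneg_pos)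
    then show ?thesis using i by blast
  qed (use i in blast)
qed

text \<open>The effective pinning of \<open>c\<close>, after elimination of \<open>V\<close>, is strictly positive. It equals
\<open>\<eta>\<^sub>c + \<Sum>\<^sub>i W\<^sub>c\<^sub>i x\<^sub>i\<close> for the solution \<open>x \<ge> 0\<close> of \<open>H x = \<eta>\<close>. If it vanished, then
the set of \<open>c\<close> and all zeros of \<open>x\<close> would have no edge leaving it, by the equations
\<open>0 = \<eta>\<^sub>i + \<Sum>\<^sub>j W\<^sub>i\<^sub>j x\<^sub>j\<close> at the zeros.\<close>

lemma pinning_pos:
  assumes "distinct (c # V)" "conductances W (set (c # V))" "linked W \<eta> (set (c # V))"
    "pos_pivots W b V"
  shows "0 < \<eta> c + green W b V (W c) \<eta>"
proof (rule ccontr)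
  assume neg: "\<not> ?thesis"
  have V: "distinct V" "conductances W (set V)"
    using assms conductances_subset[of W "set (c # V)" "set V"] by auto
  have c: "c \<notin> set V" using assms by simp
  let ?x = "green_vec W b V \<eta>"
  have W: "0 \<le> W i j" if "i \<in> set (c # V)" "j \<in> set (c # V)" for i j
    using conductancesD(3)[OF assms(2) that] .
  have eta: "0 \<le> \<eta> i" if "i \<in> set (c # V)" for i
    using assms(3) that unfolding linked_def by blast
  have x: "0 \<le> ?x i" if "i \<in> set V" for i
    unfolding green_vec_def by (rule green_nonneg) (use assms W eta in auto)
  have sum: "green W b V (W c) \<eta> = (\<Sum>i\<in>set V. W c i * ?x i)"
    by (rule green_eq_sum_green_vec) (use V assms in auto)
  have nn: "0 \<le> W i j * ?x j" if "i \<in> set (c # V)" "j \<in> set V" for i j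
    using that W x by simp
  have "0 \<le> \<eta> c" "0 \<le> (\<Sum>i\<in>set V. W c i * ?x i)"
    using eta nn by (auto intro: sum_nonneg)
  with neg sum have c0: "\<eta> c = 0" "(\<Sum>i\<in>set V. W c i * ?x i) = 0" by auto
  \<comment> \<open>No edge leaves this set.\<close>
  define S where "S = insert c {i \<in> set V. ?x i = 0}"
  have "\<eta> i = 0 \<and> (\<Sum>j\<in>set V. W i j * ?x j) = 0" if i: "i \<in> S" for i
  proof (cases "i = c")
    case True then show ?thesis using c0 by simp
  next
    case False
    then have i: "i \<in> set V" "?x i = 0" using that by (auto simp: S_def)
    have "schrod W b (set V) ?x i = \<eta> i" by (rule schrod_green_vec) (use V assms i in auto)
    then have "\<eta> i + (\<Sum>j\<in>set V. W i j * ?x j) = 0" using i by (simp add: schrod_def)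
    moreover have "0 \<le> \<eta> i" "0 \<le> (\<Sum>j\<in>set V. W i j * ?x j)"
      using eta nn i by (auto intro: sum_nonneg)
    ultimately show ?thesis by simp
  qed
  note S0 = this
  have W0: "W i j = 0" if "i \<in> S" "j \<in> set (c # V) - S" for i j
  proof -
    have j: "j \<in> set V" "?x j \<noteq> 0" using that by (auto simp: S_def)
    have "i \<in> set (c # V)" using that by (auto simp: S_def)
    then have "W i j * ?x j = 0"
      using S0[OF that(1)] sum_nonneg_eq_0_iff[of "set V" "\<lambda>j. W i j * ?x j"] nn j by auto
    then show ?thesis using j by simp
  qed
  have "S \<subseteq> set (c # V)" "S \<noteq> {}" by (auto simp: S_def)
  then obtain i where "i \<in> S" "0 < \<eta> i \<or> (\<exists>j\<in>set (c # V) - S. 0 < W i j)"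
    using assms(3) unfolding linked_def by blast
  then show False using S0[of i] W0 by force
qed

definition beta_of :: "('a \<Rightarrow> 'a \<Rightarrow> real) \<Rightarrow> ('a \<Rightarrow> real) \<Rightarrow> 'a set \<Rightarrow> ('a \<Rightarrow> real) \<Rightarrow> 'a \<Rightarrow> real" where
  "beta_of W \<eta> V u = (\<lambda>i\<in>V. ((\<Sum>j\<in>V. W i j * exp (u j - u i)) + \<eta> i * exp (- u i)) / 2)"

text \<open>The defining property of \<open>\<beta>\<close>: the vector \<open>e\<^sup>u\<close> solves the Schroedinger equation with the
pinning as right-hand side.\<close>

lemma schrod_beta_of:
  assumes "i \<in> V"
  shows "schrod W (beta_of W \<eta> V u) V (\<lambda>j. exp (u j)) i = \<eta> i"
proof -
  have "2 * beta_of W \<eta> V u i * exp (u i) = (\<Sum>j\<in>V. W i j * exp (u j)) + \<eta> i"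
    using assms by (simp add: beta_of_def sum_distrib_left distrib_left exp_diff exp_minus field_simps)
  then show ?thesis by (simp add: schrod_def)
qed

text \<open>For fixed \<open>u\<^sub>c\<close>, the vertex \<open>c\<close> acts on the others as additional pinning.\<close>

lemma beta_of_remove:
  assumes "c \<notin> set V" "conductances W (set (c # V))" "i \<in> set V"
  shows "beta_of W \<eta> (set (c # V)) u i = beta_of W (\<lambda>i. \<eta> i + W c i * exp (u c)) (set V) u i"
  using assms(1,3) conductancesD(2)[OF assms(2), of i c]
  by (simp add: beta_of_def algebra_simps flip: exp_add)

lemma beta_of_cong: "(\<And>i. i \<in> V \<Longrightarrow> u i = u' i) \<Longrightarrow> beta_of W \<eta> V u = beta_of W \<eta> V u'"
  unfolding beta_of_def by (auto intro!: restrict_ext sum.cong)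

text \<open>Solving the equation \<open>H e\<^sup>u = \<eta>\<close> for its row \<open>c\<close> after elimination of the other rows
gives pivot times \<open>e\<^sup>u\<^sup>c\<close> equal to the effective pinning. For fixed \<open>\<beta>\<close> on \<open>V\<close> this makes
\<open>\<beta>\<^sub>c\<close> an explicit monotone function of \<open>u\<^sub>c\<close>.\<close>

lemma pivot_beta_of:
  assumes "distinct (c # V)" "conductances W (set (c # V))" "pos_pivots W b V"
    and b: "b = beta_of W (\<lambda>i. \<eta> i + W c i * exp (u c)) (set V) u"
  shows "2 * beta_of W \<eta> (set (c # V)) u c = green W b V (W c) (W c) + exp (- u c) * (\<eta> c + green W b V (W c) \<eta>)"
proof -
  have V: "distinct V" "conductances W (set V)" "pos_pivots W b V"
    using assms conductances_subset[of W "set (c # V)" "set V"] by auto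
  have c: "c \<notin> set V" "W c c = 0"
    using assms(1) conductancesD(1)[OF assms(2), of c] by simp_all
  have "(\<Sum>j\<in>set V. W c j * exp (u j)) = green W b V (W c) (schrod W b (set V) (\<lambda>j. exp (u j)))"
    using green_schrod[OF V] by simp
  also have "\<dots> = green W b V (W c) (\<lambda>i. \<eta> i + exp (u c) * W c i)"
    by (rule green_cong) (simp_all add: b schrod_beta_of)
  also have "\<dots> = green W b V (W c) \<eta> + exp (u c) * green W b V (W c) (W c)"
    by (simp add: green_add green_scale)
  finally have s: "(\<Sum>j\<in>set V. W c j * exp (u j)) = green W b V (W c) \<eta> + exp (u c) * green W b V (W c) (W c)" .
  have "2 * beta_of W \<eta> (set (c # V)) u c = exp (- u c) * ((\<Sum>j\<in>set V. W c j * exp (u j)) + \<eta> c)"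
    using c by (simp add: beta_of_def sum_distrib_left distrib_left exp_diff exp_minus field_simps)
  then show ?thesis unfolding s by (simp add: algebra_simps flip: exp_add)
qed

lemma pos_pivots_beta_of:
  assumes "distinct V" "conductances W (set V)" "linked W \<eta> (set V)"
  shows "pos_pivots W (beta_of W \<eta> (set V) u) V"
  using assms
proof (induction V arbitrary: \<eta>)
  case (Cons c V)
  let ?b' = "beta_of W \<eta> (set (c # V)) u"
  define b where "b = beta_of W (\<lambda>i. \<eta> i + W c i * exp (u c)) (set V) u"
  have c: "c \<notin> set V" using Cons.prems by simp
  have V: "distinct V" "conductances W (set V)"
    using Cons.prems conductances_subset[of W "set (c # V)" "set V"] by auto
  have IH: "pos_pivots W b V" unfolding b_def
    by (rule Cons.IH) (use V Cons.prems c linked_remove[of W \<eta> c V "exp (u c)"] in auto)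
  have eq: "?b' i = b i" if "i \<in> set V" for i
    unfolding b_def using beta_of_remove[OF c Cons.prems(2) that] .
  have "pos_pivots W ?b' V = pos_pivots W b V" by (rule pos_pivots_cong) (use eq in auto)
  moreover have "green W ?b' V (W c) (W c) = green W b V (W c) (W c)"
    by (rule green_cong) (use eq in auto)
  then have "pivot W ?b' c V = exp (- u c) * (\<eta> c + green W b V (W c) \<eta>)"
    unfolding pivot_def using pivot_beta_of[OF Cons.prems(1,2) IH b_def] by simp
  moreover have "0 < \<eta> c + green W b V (W c) \<eta>" by (rule pinning_pos) (use Cons.prems IH in auto)
  ultimately show ?case using IH by simp
qed simp

section \<open>Integrals on the line\<close>

text \<open>The substitution rule on compact intervals, exhausted by the intervals \<open>[-n, n]\<close>. By the
intermediate value theorem, the images of these intervals exhaust the range of \<open>g\<close>.\<close>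

lemma nn_integral_substitution_line:
  fixes f :: "real \<Rightarrow> ennreal" and g g' :: "real \<Rightarrow> real"
  assumes f[measurable]: "f \<in> borel_measurable borel"
    and deriv: "\<And>x. (g has_real_derivative g' x) (at x)"
    and cont: "continuous_on UNIV g'" and nonneg: "\<And>x. 0 \<le> g' x"
  shows "(\<integral>\<^sup>+x. f (g x) * g' x \<partial>lborel) = (\<integral>\<^sup>+y. f y * indicator (range g) y \<partial>lborel)"
proof -
  have mono: "g x \<le> g y" if "x \<le> y" for x y
    using deriv nonneg DERIV_nonneg_imp_nondecreasing[OF that] by blast
  have contg: "continuous_on A g" for A
    using deriv DERIV_isCont continuous_at_imp_continuous_on by blast
  have [measurable]: "g \<in> borel_measurable borel" "g' \<in> borel_measurable borel"
    using contg cont by (auto intro: borel_measurable_continuous_onI)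
  let ?I = "\<lambda>n::nat. {- real (Suc n)..real (Suc n)}"
  let ?J = "\<lambda>n::nat. {g (- real (Suc n))..g (real (Suc n))}"
  have step: "(\<integral>\<^sup>+x. f (g x) * g' x * indicator (?I n) x \<partial>lborel)
     = (\<integral>\<^sup>+y. f y * indicator (?J n) y \<partial>lborel)" for n
    by (rule nn_integral_substitution_aux[symmetric])
      (use deriv nonneg cont in \<open>auto intro: continuous_on_subset\<close>)
  have U: "(\<Union>n. ?I n) = UNIV"
  proof -
    have "x \<in> ?I (nat \<lceil>\<bar>x\<bar>\<rceil>)" for x :: real
      using real_nat_ceiling_ge[of "\<bar>x\<bar>"]
      by (simp only: atLeastAtMost_iff of_nat_Suc) linarith
    then show ?thesis by blast
  qed
  have R: "(\<Union>n. ?J n) = range g"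
  proof (intro equalityI subsetI)
    fix y assume "y \<in> (\<Union>n. ?J n)"
    then obtain n where "g (- real (Suc n)) \<le> y" "y \<le> g (real (Suc n))" by auto
    then have "\<exists>x\<ge>- real (Suc n). x \<le> real (Suc n) \<and> g x = y"
      by (intro IVT') (use contg in auto)
    then show "y \<in> range g" by auto
  next
    fix y assume "y \<in> range g"
    then obtain x n where "y = g x" "x \<in> ?I n" using U by blast
    then have "y \<in> ?J n" using mono[of "- real (Suc n)" x] mono[of x "real (Suc n)"] by auto
    then show "y \<in> (\<Union>n. ?J n)" by blast
  qed
  \<comment> \<open>Monotone convergence, as continuity from below of the measure with density \<open>h\<close>.\<close>
  have lim: "(\<integral>\<^sup>+x. h x * indicator (\<Union>n. A n) x \<partial>lborel) = (SUP n. \<integral>\<^sup>+x. h x * indicator (A n) x \<partial>lborel)"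
    if [measurable]: "h \<in> borel_measurable borel" "\<And>n. A n \<in> sets borel" and A: "incseq A"
    for h :: "real \<Rightarrow> ennreal" and A :: "nat \<Rightarrow> real set"
    using SUP_emeasure_incseq[of A "density lborel h"] A by (simp add: emeasure_density image_subset_iff)
  have "(\<integral>\<^sup>+x. f (g x) * g' x \<partial>lborel) = (\<integral>\<^sup>+x. f (g x) * g' x * indicator (\<Union>n. ?I n) x \<partial>lborel)"
    unfolding U by simp
  also have "\<dots> = (SUP n. \<integral>\<^sup>+x. f (g x) * g' x * indicator (?I n) x \<partial>lborel)"
    by (rule lim) (auto simp: incseq_def)
  also have "\<dots> = (SUP n. \<integral>\<^sup>+y. f y * indicator (?J n) y \<partial>lborel)" by (simp only: step)
  also have "\<dots> = (\<integral>\<^sup>+y. f y * indicator (\<Union>n. ?J n) y \<partial>lborel)"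
    by (rule lim[symmetric])
      (auto simp: incseq_def intro!: mono order.trans[OF mono, rotated] order.trans[OF _ mono])
  finally show ?thesis unfolding R .
qed

lemma nn_integral_reflect:
  fixes f :: "real \<Rightarrow> ennreal"
  assumes [measurable]: "f \<in> borel_measurable borel"
  shows "(\<integral>\<^sup>+x. f (- x) \<partial>lborel) = (\<integral>\<^sup>+x. f x \<partial>lborel)"
  using nn_integral_real_affine[of f "-1" 0] by simp

text \<open>The substitution \<open>2 b = \<kappa> + h e\<^sup>-\<^sup>u\<close>, which is the relation between \<open>\<beta>\<^sub>c\<close> and
\<open>u\<^sub>c\<close> when the parameters of the other vertices are fixed. It maps the line onto the half-line where
the pivot \<open>2 b - \<kappa>\<close> is positive.\<close>

lemma nn_integral_pivot_substitution:
  fixes f :: "real \<Rightarrow> ennreal"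
  assumes f[measurable]: "f \<in> borel_measurable borel" and h: "0 < h"
  shows "(\<integral>\<^sup>+u. f ((\<kappa> + exp (- u) * h) / 2) * ennreal (exp (- u) * h / 2) \<partial>lborel)
    = (\<integral>\<^sup>+b. f b * indicator {b. \<kappa> < 2 * b} b \<partial>lborel)"
proof -
  have R: "range (\<lambda>u. (\<kappa> + exp u * h) / 2) = {b. \<kappa> < 2 * b}"
  proof (intro equalityI subsetI)
    fix b assume "b \<in> {b. \<kappa> < 2 * b}"
    then have "b = (\<kappa> + exp (ln ((2 * b - \<kappa>) / h)) * h) / 2" using h by simp
    then show "b \<in> range (\<lambda>u. (\<kappa> + exp u * h) / 2)" by (rule range_eqI)
  qed (use h in auto)
  have "(\<integral>\<^sup>+u. f ((\<kappa> + exp (- u) * h) / 2) * ennreal (exp (- u) * h / 2) \<partial>lborel)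
    = (\<integral>\<^sup>+u. f ((\<kappa> + exp u * h) / 2) * ennreal (exp u * h / 2) \<partial>lborel)"
    by (rule nn_integral_reflect[where f = "\<lambda>u. f ((\<kappa> + exp u * h) / 2) * ennreal (exp u * h / 2)"]) simp
  also have "\<dots> = (\<integral>\<^sup>+b. f b * indicator (range (\<lambda>u. (\<kappa> + exp u * h) / 2)) b \<partial>lborel)"
    by (rule nn_integral_substitution_line)
      (use h in \<open>auto intro!: derivative_eq_intros continuous_intros\<close>)
  finally show ?thesis unfolding R .
qed

text \<open>Normalization of the reciprocal inverse Gaussian density, in the parametrization by \<open>b\<close> with
\<open>p = 2 b - \<kappa>\<close>. The substitution \<open>p = z e\<^sup>-\<^sup>u\<close> turns the exponent into
\<open>z - z cosh u = - 2 z (sinh (u / 2))\<^sup>2\<close> and leaves a factor \<open>e\<^sup>-\<^sup>u\<^sup>/\<^sup>2\<close>. Averaging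
with the reflected integral replaces this factor by \<open>cosh (u / 2)\<close>, which is the derivative needed
to substitute \<open>v = 2 (sqrt z) sinh (u / 2)\<close> and to arrive at the normal density.\<close>

lemma nn_integral_reciprocal_inverse_gaussian:
  assumes z: "0 < z"
  shows "(\<integral>\<^sup>+b. ennreal (sqrt (2 / (pi * (2 * b - \<kappa>))) * exp (z - ((2 * b - \<kappa>) + z\<^sup>2 / (2 * b - \<kappa>)) / 2))
      * indicator {b. \<kappa> < 2 * b} b \<partial>lborel) = 1" (is "?L = 1")
proof -
  let ?q = "\<lambda>u. sqrt (z / (2 * pi)) * exp (z - z * cosh u)"
  let ?f = "\<lambda>b. ennreal (sqrt (2 / (pi * (2 * b - \<kappa>))) * exp (z - ((2 * b - \<kappa>) + z\<^sup>2 / (2 * b - \<kappa>)) / 2))"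
  have cosh_measurable[measurable]: "(cosh :: real \<Rightarrow> real) \<in> borel_measurable borel"
    by (intro borel_measurable_continuous_onI continuous_intros)
  have point: "sqrt (2 / (pi * (exp (- u) * z))) * exp (z - (exp (- u) * z + z\<^sup>2 / (exp (- u) * z)) / 2) * (exp (- u) * z / 2)
      = ?q u * exp (- u / 2)" for u
  proof -
    have e: "exp (- (u / 2)) * exp (- (u / 2)) = exp (- u)" by (simp flip: exp_add)
    have "sqrt (2 / (pi * (exp (- u) * z))) * (exp (- u) * z / 2) = sqrt (z / (2 * pi)) * exp (- u / 2)"
    proof (rule power2_eq_imp_eq)
      show "(sqrt (2 / (pi * (exp (- u) * z))) * (exp (- u) * z / 2))\<^sup>2 = (sqrt (z / (2 * pi)) * exp (- u / 2))\<^sup>2"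
        using z by (simp add: power_mult_distrib power2_eq_square[of "exp (- (u / 2))"] e)
          (simp add: field_simps power2_eq_square)
    qed (use z in auto)
    moreover have "(exp (- u) * z + z\<^sup>2 / (exp (- u) * z)) / 2 = z * cosh u"
      using z by (simp add: cosh_def power2_eq_square exp_minus field_simps)
    ultimately show ?thesis by (simp add: mult_ac)
  qed
  have "?L = (\<integral>\<^sup>+u. ?f ((\<kappa> + exp (- u) * z) / 2) * ennreal (exp (- u) * z / 2) \<partial>lborel)"
    by (rule nn_integral_pivot_substitution[OF _ z, symmetric]) simp
  also have "\<dots> = (\<integral>\<^sup>+u. ennreal (?q u * exp (- u / 2)) \<partial>lborel)"
  proof (intro nn_integral_cong)
    have *: "2 * ((\<kappa> + exp (- u) * z) / 2) - \<kappa> = exp (- u) * z" for u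
      by (simp add: field_simps)
    show "?f ((\<kappa> + exp (- u) * z) / 2) * ennreal (exp (- u) * z / 2) = ennreal (?q u * exp (- u / 2))" for u
      unfolding * point[symmetric] by (rule ennreal_mult[symmetric]) (use z in auto)
  qed
  finally have L: "?L = (\<integral>\<^sup>+u. ennreal (?q u * exp (- u / 2)) \<partial>lborel)" .
  also have "\<dots> = (\<integral>\<^sup>+u. ennreal (?q u * exp (u / 2)) \<partial>lborel)"
    using nn_integral_reflect[of "\<lambda>u. ennreal (?q u * exp (u / 2))"] by simp
  finally have "?L + ?L = (\<integral>\<^sup>+u. ennreal (?q u * exp (- u / 2)) \<partial>lborel) + (\<integral>\<^sup>+u. ennreal (?q u * exp (u / 2)) \<partial>lborel)"
    using L by simp
  also have "\<dots> = (\<integral>\<^sup>+u. 2 * (ennreal (std_normal_density (2 * sqrt z * sinh (u / 2))) * ennreal (sqrt z * cosh (u / 2))) \<partial>lborel)"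
  proof (subst nn_integral_add[symmetric])
    have "?q u * exp (- u / 2) + ?q u * exp (u / 2) =
       2 * (std_normal_density (2 * sqrt z * sinh (u / 2)) * (sqrt z * cosh (u / 2)))" for u
    proof -
      have "cosh u = 1 + 2 * (sinh (u / 2))\<^sup>2"
        using cosh_double[of "u / 2"] cosh_square_eq[of "u / 2"] by simp
      then have "std_normal_density (2 * sqrt z * sinh (u / 2)) = exp (z - z * cosh u) / sqrt (2 * pi)"
        using z by (simp add: normal_density_def power_mult_distrib algebra_simps)
      then show ?thesis
        using z by (simp add: cosh_def real_sqrt_divide algebra_simps add_divide_distrib)
    qed
    then show "(\<integral>\<^sup>+u. ennreal (?q u * exp (- u / 2)) + ennreal (?q u * exp (u / 2)) \<partial>lborel) =
      (\<integral>\<^sup>+u. 2 * (ennreal (std_normal_density (2 * sqrt z * sinh (u / 2))) * ennreal (sqrt z * cosh (u / 2))) \<partial>lborel)"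
      using z by (intro nn_integral_cong) (simp flip: ennreal_plus ennreal_mult ennreal_numeral)
  qed measurable
  also have "\<dots> = 2 * (\<integral>\<^sup>+u. ennreal (std_normal_density (2 * sqrt z * sinh (u / 2))) * ennreal (sqrt z * cosh (u / 2)) \<partial>lborel)"
  proof (rule nn_integral_cmult)
    have [measurable]: "(sinh :: real \<Rightarrow> real) \<in> borel_measurable borel"
      by (intro borel_measurable_continuous_onI continuous_intros)
    show "(\<lambda>u. ennreal (std_normal_density (2 * sqrt z * sinh (u / 2))) * ennreal (sqrt z * cosh (u / 2))) \<in> borel_measurable lborel"
      by measurable
  qed
  also have "(\<integral>\<^sup>+u. ennreal (std_normal_density (2 * sqrt z * sinh (u / 2))) * ennreal (sqrt z * cosh (u / 2)) \<partial>lborel) =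
     (\<integral>\<^sup>+v. ennreal (std_normal_density v) * indicator (range (\<lambda>u. 2 * sqrt z * sinh (u / 2))) v \<partial>lborel)"
    by (rule nn_integral_substitution_line)
      (use z in \<open>auto intro!: derivative_eq_intros continuous_intros\<close>)
  also have "range (\<lambda>u. 2 * sqrt z * sinh (u / 2)) = UNIV"
  proof -
    have "v = 2 * sqrt z * sinh (2 * arsinh (v / (2 * sqrt z)) / 2)" for v using z by simp
    then show ?thesis by (metis (no_types, lifting) UNIV_eq_I rangeI)
  qed
  also have "(\<integral>\<^sup>+v. ennreal (std_normal_density v) * indicator UNIV v \<partial>lborel) = 1"
    using integral_normal_density[of 1 0] by (simp add: nn_integral_eq_integral)
  finally have "2 * ?L = 2 * 1" by (simp only: mult_2)
  then show ?thesis unfolding ennreal_mult_cancel_left by simp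
qed

text \<open>The characteristic function of the normal distribution with variance \<open>p\<close>, evaluated at
\<open>a / p\<close>.\<close>

lemma integral_gaussian_fourier:
  assumes p: "0 < p"
  shows "integrable lborel (\<lambda>t. complex_of_real (exp (- (t + \<tau>)\<^sup>2 / (2 * p)) / sqrt (2 * pi * p)) * exp (\<i> * of_real (a * (t + \<tau>) / p)))" (is "integrable _ ?F")
    and "(\<integral>t. complex_of_real (exp (- (t + \<tau>)\<^sup>2 / (2 * p)) / sqrt (2 * pi * p)) * exp (\<i> * of_real (a * (t + \<tau>) / p)) \<partial>lborel)
      = of_real (exp (- a\<^sup>2 / (2 * p)))"
proof -
  let ?r = "a / sqrt p"
  define G where "G x = complex_of_real (std_normal_density x) * exp (\<i> * of_real (?r * x))" for x
  have char: "char std_normal_distribution ?r = of_real (exp (- ?r\<^sup>2 / 2))"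
    by (simp add: char_std_normal_distribution)
  have "integrable lborel (\<lambda>x. complex_of_real (std_normal_density x))"
    by (intro integrable_of_real) simp
  then have G: "integrable lborel G"
    by (rule Bochner_Integration.integrable_bound) (auto simp: G_def[abs_def] norm_mult)
  have "(\<integral>x. G x \<partial>lborel) = char std_normal_distribution ?r"
    unfolding char_def
    by (subst integral_density) (auto simp: G_def[abs_def] scaleR_conv_of_real)
  then have I: "(\<integral>x. G x \<partial>lborel) = of_real (exp (- a\<^sup>2 / (2 * p)))"
    using p by (simp add: char power_divide)
  have eq: "?F (- \<tau> + sqrt p * x) = of_real (1 / sqrt p) * G x" for x
  proof -
    have 1: "a * (- \<tau> + sqrt p * x + \<tau>) / p = ?r * x"
      using p by (simp add: field_simps)
    have 2: "exp (- (- \<tau> + sqrt p * x + \<tau>)\<^sup>2 / (2 * p)) / sqrt (2 * pi * p) = (1 / sqrt p) * std_normal_density x"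
      using p by (simp add: normal_density_def power_mult_distrib real_sqrt_mult)
    show ?thesis unfolding 1 2 G_def by simp
  qed
  show F: "integrable lborel ?F"
    using lborel_integrable_real_affine_iff[of "sqrt p" ?F "- \<tau>"] p G by (simp only: eq) simp
  have "(\<integral>t. ?F t \<partial>lborel) = \<bar>sqrt p\<bar> *\<^sub>R (\<integral>x. ?F (- \<tau> + sqrt p * x) \<partial>lborel)"
    by (rule lborel_integral_real_affine) (use p in auto)
  also have "\<dots> = (\<integral>x. G x \<partial>lborel)"
    using p by (simp only: eq integral_mult_right_zero) (simp add: scaleR_conv_of_real)
  finally show "(\<integral>t. ?F t \<partial>lborel) = of_real (exp (- a\<^sup>2 / (2 * p)))" by (simp only: I)
qed

lemma nn_integral_gaussian:
  assumes p: "0 < p"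
  shows "(\<integral>\<^sup>+t. ennreal (exp (- (t + \<tau>)\<^sup>2 / (2 * p)) / sqrt (2 * pi * p)) \<partial>lborel) = 1"
proof -
  have "(\<integral>\<^sup>+t. ennreal (normal_density (- \<tau>) (sqrt p) t) \<partial>lborel) = 1"
    using p integral_normal_density[of "sqrt p" "- \<tau>"] by (simp add: nn_integral_eq_integral)
  then show ?thesis using p by (simp add: normal_density_def)
qed

section \<open>Adding a vertex to a product integral\<close>

abbreviation lborel_pairs :: "'a set \<Rightarrow> (('a \<Rightarrow> real) \<times> ('a \<Rightarrow> real)) measure" where
  "lborel_pairs V \<equiv> Pi\<^sub>M V (\<lambda>_. lborel) \<Otimes>\<^sub>M Pi\<^sub>M V (\<lambda>_. lborel)"

definition upd_pair :: "'a \<Rightarrow> ('a \<Rightarrow> real) \<times> ('a \<Rightarrow> real) \<Rightarrow> real \<times> real \<Rightarrow> ('a \<Rightarrow> real) \<times> ('a \<Rightarrow> real)" where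
  "upd_pair c p z = ((fst p)(c := fst z), (snd p)(c := snd z))"

lemma measurable_upd:
  assumes "X \<in> M \<rightarrow>\<^sub>M Pi\<^sub>M A (\<lambda>_. lborel)" "Y \<in> borel_measurable M"
  shows "(\<lambda>\<omega>. (X \<omega>)(c := Y \<omega>)) \<in> M \<rightarrow>\<^sub>M Pi\<^sub>M (insert c A) (\<lambda>_. lborel)"
proof -
  have "(\<lambda>\<omega>. (X \<omega>, Y \<omega>)) \<in> M \<rightarrow>\<^sub>M Pi\<^sub>M A (\<lambda>_. lborel) \<Otimes>\<^sub>M lborel"
    using assms by simp
  from measurable_compose[OF this measurable_add_dim] show ?thesis by simp
qed

lemma measurable_upd_pair[measurable (raw)]:
  assumes "X \<in> M \<rightarrow>\<^sub>M lborel_pairs A" "Y \<in> M \<rightarrow>\<^sub>M (borel :: (real \<times> real) measure)"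
  shows "(\<lambda>\<omega>. upd_pair c (X \<omega>) (Y \<omega>)) \<in> M \<rightarrow>\<^sub>M lborel_pairs (insert c A)"
proof -
  have "(\<lambda>\<omega>. fst (Y \<omega>)) \<in> borel_measurable M" "(\<lambda>\<omega>. snd (Y \<omega>)) \<in> borel_measurable M"
    using assms(2) borel_prod[where 'a=real and 'b=real] measurable_fst'[of Y M borel borel] measurable_snd'[of Y M borel borel] by simp_all
  then show ?thesis unfolding upd_pair_def
    using assms(1) by (intro measurable_Pair measurable_upd) (auto intro: measurable_fst' measurable_snd')
qed

interpretation lborel_product: product_sigma_finite "\<lambda>_::'a. lborel :: real measure" ..

lemma sigma_finite_PiM_lborel: "finite A \<Longrightarrow> sigma_finite_measure (Pi\<^sub>M A (\<lambda>_::'a. lborel :: real measure))"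
  by (rule lborel_product.sigma_finite)

lemma sigma_finite_lborel_pairs: "finite A \<Longrightarrow> sigma_finite_measure (lborel_pairs (A :: 'a set))"
  by (intro sigma_finite_pair_measure sigma_finite_PiM_lborel)

lemma nn_integral_swap:
  assumes "sigma_finite_measure M" "sigma_finite_measure N" "(\<lambda>(x, y). f x y) \<in> borel_measurable (M \<Otimes>\<^sub>M N)"
  shows "(\<integral>\<^sup>+x. \<integral>\<^sup>+y. f x y \<partial>N \<partial>M) = (\<integral>\<^sup>+y. \<integral>\<^sup>+x. f x y \<partial>M \<partial>N)"
  using pair_sigma_finite.Fubini'[OF pair_sigma_finite.intro[OF assms(1,2)] assms(3)] by simp

text \<open>Tonelli's theorem in the form used for all inductions over vertices: the two coordinates of one
vertex are integrated together, although the pairs of configurations are stored as pairs of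
functions.\<close>

lemma nn_integral_lborel_pairs_insert:
  fixes f :: "('a \<Rightarrow> real) \<times> ('a \<Rightarrow> real) \<Rightarrow> ennreal"
  assumes A: "finite A" "c \<notin> A" and f[measurable]: "f \<in> borel_measurable (lborel_pairs (insert c A))"
  shows "(\<integral>\<^sup>+p. f p \<partial>lborel_pairs (insert c A)) = (\<integral>\<^sup>+p. \<integral>\<^sup>+z. f (upd_pair c p z) \<partial>lborel \<partial>lborel_pairs A)"
proof -
  interpret P: sigma_finite_measure "Pi\<^sub>M A (\<lambda>_. lborel :: real measure)"
    by (rule sigma_finite_PiM_lborel) fact
  interpret Q: sigma_finite_measure "Pi\<^sub>M (insert c A) (\<lambda>_. lborel :: real measure)"
    by (rule sigma_finite_PiM_lborel) (use A in simp)
  let ?P = "Pi\<^sub>M A (\<lambda>_. lborel :: real measure)" and ?Q = "Pi\<^sub>M (insert c A) (\<lambda>_. lborel :: real measure)"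
  have upd1[measurable]: "(\<lambda>x. (fst x)(c := snd x)) \<in> ?P \<Otimes>\<^sub>M lborel \<rightarrow>\<^sub>M ?Q"
    by (rule measurable_upd) auto
  have sec: "(\<lambda>y. f (x, y)) \<in> borel_measurable ?Q" if "x \<in> space ?Q" for x
    using that by measurable
  have inner: "(\<integral>\<^sup>+y. f (x, y) \<partial>?Q) = (\<integral>\<^sup>+y. \<integral>\<^sup>+t. f (x, y(c := t)) \<partial>lborel \<partial>?P)" if "x \<in> space ?Q" for x
    by (rule lborel_product.product_nn_integral_insert[OF A sec[OF that]])
  have "(\<integral>\<^sup>+p. f p \<partial>lborel_pairs (insert c A)) = (\<integral>\<^sup>+x. \<integral>\<^sup>+y. f (x, y) \<partial>?Q \<partial>?Q)"
    by (rule Q.nn_integral_fst[symmetric]) fact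
  also have "\<dots> = (\<integral>\<^sup>+x. \<integral>\<^sup>+b. \<integral>\<^sup>+y. f (x(c := b), y) \<partial>?Q \<partial>lborel \<partial>?P)"
    by (rule lborel_product.product_nn_integral_insert[OF A]) measurable
  also have "\<dots> = (\<integral>\<^sup>+x. \<integral>\<^sup>+b. \<integral>\<^sup>+y. \<integral>\<^sup>+t. f (x(c := b), y(c := t)) \<partial>lborel \<partial>?P \<partial>lborel \<partial>?P)"
  proof (intro nn_integral_cong inner)
    fix x b assume "x \<in> space ?P"
    then show "x(c := b) \<in> space ?Q"
      using measurable_space[OF upd1, of "(x, b)"] by (simp add: space_pair_measure)
  qed
  also have "\<dots> = (\<integral>\<^sup>+x. \<integral>\<^sup>+y. \<integral>\<^sup>+b. \<integral>\<^sup>+t. f (x(c := b), y(c := t)) \<partial>lborel \<partial>lborel \<partial>?P \<partial>?P)"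
  proof (rule nn_integral_cong, rule nn_integral_swap)
    fix x assume x[measurable]: "x \<in> space ?P"
    have "(\<lambda>q. upd_pair c (x, snd (fst q)) (fst (fst q), snd q)) \<in> (lborel \<Otimes>\<^sub>M ?P) \<Otimes>\<^sub>M lborel \<rightarrow>\<^sub>M lborel_pairs (insert c A)"
      by (rule measurable_upd_pair) (use x in \<open>auto intro!: borel_measurable_Pair measurable_Pair\<close>)
    from measurable_compose[OF this f]
    have "(\<lambda>q. f (x(c := fst (fst q)), (snd (fst q))(c := snd q))) \<in> borel_measurable ((lborel \<Otimes>\<^sub>M ?P) \<Otimes>\<^sub>M lborel)"
      by (simp add: upd_pair_def)
    then have "(\<lambda>q. \<integral>\<^sup>+t. f (x(c := fst q), (snd q)(c := t)) \<partial>lborel) \<in> borel_measurable (lborel \<Otimes>\<^sub>M ?P)"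
      using lborel.borel_measurable_nn_integral_fst by fastforce
    then show "(\<lambda>(b, y). \<integral>\<^sup>+t. f (x(c := b), y(c := t)) \<partial>lborel) \<in> borel_measurable (lborel \<Otimes>\<^sub>M ?P)"
      by (simp add: case_prod_beta')
  qed (auto intro: P.sigma_finite_measure_axioms lborel.sigma_finite_measure_axioms)
  also have "\<dots> = (\<integral>\<^sup>+x. \<integral>\<^sup>+y. \<integral>\<^sup>+z. f (upd_pair c (x, y) z) \<partial>lborel \<partial>?P \<partial>?P)"
  proof (intro nn_integral_cong)
    fix x y assume x[measurable]: "x \<in> space ?P" "y \<in> space ?P"
    have "(\<lambda>z. upd_pair c (x, y) z) \<in> borel \<rightarrow>\<^sub>M lborel_pairs (insert c A)"
      by (rule measurable_upd_pair) (use x in \<open>auto simp: space_pair_measure\<close>)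
    from measurable_compose[OF this f]
    have m: "(\<lambda>z. f (upd_pair c (x, y) z)) \<in> borel_measurable (lborel \<Otimes>\<^sub>M lborel)"
      by (simp add: lborel_prod)
    show "(\<integral>\<^sup>+b. \<integral>\<^sup>+t. f (x(c := b), y(c := t)) \<partial>lborel \<partial>lborel) = (\<integral>\<^sup>+z. f (upd_pair c (x, y) z) \<partial>lborel)"
      using lborel.nn_integral_fst[OF m] by (simp add: upd_pair_def lborel_prod)
  qed
  also have "\<dots> = (\<integral>\<^sup>+p. \<integral>\<^sup>+z. f (upd_pair c p z) \<partial>lborel \<partial>lborel_pairs A)"
  proof (rule P.nn_integral_fst)
    have [measurable]: "(\<lambda>q. upd_pair c (fst q) (snd q)) \<in> lborel_pairs A \<Otimes>\<^sub>M lborel \<rightarrow>\<^sub>M lborel_pairs (insert c A)"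
      by (rule measurable_upd_pair) auto
    show "(\<lambda>p. \<integral>\<^sup>+z. f (upd_pair c p z) \<partial>lborel) \<in> borel_measurable (lborel_pairs A)"
      by measurable
  qed
  finally show ?thesis .
qed

lemma measurable_upd_pair_pair[measurable]:
  "(\<lambda>q. upd_pair c (fst q) (snd q)) \<in> lborel_pairs A \<Otimes>\<^sub>M lborel \<rightarrow>\<^sub>M lborel_pairs (insert c A)"
  by (rule measurable_upd_pair) auto

text \<open>The same splitting as an isomorphism of measures, from which its version for Bochner integrals
follows.\<close>

lemma distr_upd_pair:
  assumes A: "finite A" "c \<notin> A"
  shows "distr (lborel_pairs A \<Otimes>\<^sub>M lborel) (lborel_pairs (insert c A)) (\<lambda>q. upd_pair c (fst q) (snd q))
    = lborel_pairs (insert c (A :: 'a set))"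
proof (rule measure_eqI)
  fix X assume "X \<in> sets (distr (lborel_pairs A \<Otimes>\<^sub>M lborel) (lborel_pairs (insert c A)) (\<lambda>q. upd_pair c (fst q) (snd q)))"
  then have X[measurable]: "X \<in> sets (lborel_pairs (insert c A))" by simp
  have "emeasure (distr (lborel_pairs A \<Otimes>\<^sub>M lborel) (lborel_pairs (insert c A)) (\<lambda>q. upd_pair c (fst q) (snd q))) X
     = (\<integral>\<^sup>+q. indicator X (upd_pair c (fst q) (snd q)) \<partial>(lborel_pairs A \<Otimes>\<^sub>M lborel))"
    using nn_integral_distr[OF measurable_upd_pair_pair[where A = A and c = c], of "indicator X :: _ \<Rightarrow> ennreal"] by simp
  also have "\<dots> = (\<integral>\<^sup>+p. \<integral>\<^sup>+z. indicator X (upd_pair c p z) \<partial>lborel \<partial>lborel_pairs A)"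
    by (subst lborel.nn_integral_fst[symmetric]) auto
  also have "\<dots> = (\<integral>\<^sup>+p. indicator X p \<partial>lborel_pairs (insert c A))"
    by (rule nn_integral_lborel_pairs_insert[OF A, symmetric]) measurable
  finally show "emeasure (distr (lborel_pairs A \<Otimes>\<^sub>M lborel) (lborel_pairs (insert c A)) (\<lambda>q. upd_pair c (fst q) (snd q))) X
    = emeasure (lborel_pairs (insert c A)) X" by simp
qed simp

lemma integral_lborel_pairs_insert:
  fixes f :: "('a \<Rightarrow> real) \<times> ('a \<Rightarrow> real) \<Rightarrow> complex"
  assumes A: "finite A" "c \<notin> A" and f: "integrable (lborel_pairs (insert c A)) f"
  shows "(\<integral>p. f p \<partial>lborel_pairs (insert c A)) = (\<integral>p. \<integral>z. f (upd_pair c p z) \<partial>lborel \<partial>lborel_pairs A)"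
proof -
  interpret pair_sigma_finite "lborel_pairs A" "lborel :: (real \<times> real) measure"
    by (intro pair_sigma_finite.intro sigma_finite_lborel_pairs lborel.sigma_finite_measure_axioms A)
  have [measurable]: "f \<in> borel_measurable (lborel_pairs (insert c A))" using f by auto
  have "integrable (lborel_pairs A \<Otimes>\<^sub>M lborel) (\<lambda>q. f (upd_pair c (fst q) (snd q)))"
    using f by (subst (asm) distr_upd_pair[OF A, symmetric]) (simp add: integrable_distr_eq)
  then have "(\<integral>p. \<integral>z. f (upd_pair c p z) \<partial>lborel \<partial>lborel_pairs A) = (\<integral>q. f (upd_pair c (fst q) (snd q)) \<partial>(lborel_pairs A \<Otimes>\<^sub>M lborel))"
    using integral_fst' by fastforce
  also have "\<dots> = (\<integral>p. f p \<partial>lborel_pairs (insert c A))"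
    using integral_distr[OF measurable_upd_pair_pair[where A = A and c = c], of f] by (simp add: distr_upd_pair[OF A])
  finally show ?thesis ..
qed

lemma measurable_green:
  assumes "\<And>i. i \<in> set V \<Longrightarrow> (\<lambda>\<omega>. b \<omega> i) \<in> borel_measurable M"
    "\<And>i. i \<in> set V \<Longrightarrow> (\<lambda>\<omega>. x \<omega> i) \<in> borel_measurable M"
    "\<And>i. i \<in> set V \<Longrightarrow> (\<lambda>\<omega>. y \<omega> i) \<in> borel_measurable M"
  shows "(\<lambda>\<omega>. green W (b \<omega>) V (x \<omega>) (y \<omega>)) \<in> borel_measurable M"
  using assms
proof (induction V arbitrary: x y)
  case (Cons c V)
  have [measurable]: "(\<lambda>\<omega>. green W (b \<omega>) V (x \<omega>) (y \<omega>)) \<in> borel_measurable M"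
    "(\<lambda>\<omega>. green W (b \<omega>) V (W c) (x \<omega>)) \<in> borel_measurable M"
    "(\<lambda>\<omega>. green W (b \<omega>) V (W c) (y \<omega>)) \<in> borel_measurable M"
    "(\<lambda>\<omega>. green W (b \<omega>) V (W c) (W c)) \<in> borel_measurable M"
    by (rule Cons.IH; use Cons.prems in simp)+
  have [measurable]: "(\<lambda>\<omega>. b \<omega> c) \<in> borel_measurable M" "(\<lambda>\<omega>. x \<omega> c) \<in> borel_measurable M"
    "(\<lambda>\<omega>. y \<omega> c) \<in> borel_measurable M" using Cons.prems by auto
  show ?case by (simp add: green_Cons pivot_def)
qed simp

lemma measurable_pivots:
  assumes "\<And>i. i \<in> set V \<Longrightarrow> (\<lambda>\<omega>. b \<omega> i) \<in> borel_measurable M"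
  shows measurable_pivot_prod: "(\<lambda>\<omega>. pivot_prod W (b \<omega>) V) \<in> borel_measurable M"
    and pred_pos_pivots: "Measurable.pred M (\<lambda>\<omega>. pos_pivots W (b \<omega>) V)"
proof -
  have "(\<lambda>\<omega>. pivot_prod W (b \<omega>) V) \<in> borel_measurable M \<and> Measurable.pred M (\<lambda>\<omega>. pos_pivots W (b \<omega>) V)"
    using assms
  proof (induction V)
    case (Cons c V)
    have [measurable]: "(\<lambda>\<omega>. green W (b \<omega>) V (W c) (W c)) \<in> borel_measurable M"
      by (rule measurable_green) (use Cons.prems in auto)
    have [measurable]: "(\<lambda>\<omega>. b \<omega> c) \<in> borel_measurable M" using Cons.prems by auto
    have [measurable]: "(\<lambda>\<omega>. pivot_prod W (b \<omega>) V) \<in> borel_measurable M" "Measurable.pred M (\<lambda>\<omega>. pos_pivots W (b \<omega>) V)"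
      using Cons by auto
    show ?case by (simp add: pivot_def)
  qed simp
  then show "(\<lambda>\<omega>. pivot_prod W (b \<omega>) V) \<in> borel_measurable M" "Measurable.pred M (\<lambda>\<omega>. pos_pivots W (b \<omega>) V)"
    by auto
qed

section \<open>The change of variables from the fields to the parameters\<close>

text \<open>The translation by \<open>k\<close> is needed for the induction over vertices: for fixed \<open>(u\<^sub>c, s\<^sub>c)\<close>, the
vertex \<open>c\<close> contributes the constant \<open>W\<^sub>i\<^sub>c e\<^sup>u\<^sup>c s\<^sub>c\<close> to the other coordinates.\<close>

definition theta_of ::
  "('a \<Rightarrow> 'a \<Rightarrow> real) \<Rightarrow> ('a \<Rightarrow> real) \<Rightarrow> ('a \<Rightarrow> real) \<Rightarrow> 'a set \<Rightarrow> ('a \<Rightarrow> real) \<Rightarrow> ('a \<Rightarrow> real) \<Rightarrow> 'a \<Rightarrow> real" where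
  "theta_of W b k V u s = (\<lambda>i\<in>V. schrod W b V (\<lambda>j. exp (u j) * s j) i - k i)"

definition coords ::
  "('a \<Rightarrow> 'a \<Rightarrow> real) \<Rightarrow> ('a \<Rightarrow> real) \<Rightarrow> ('a \<Rightarrow> real) \<Rightarrow> 'a set \<Rightarrow> ('a \<Rightarrow> real) \<times> ('a \<Rightarrow> real) \<Rightarrow> ('a \<Rightarrow> real) \<times> ('a \<Rightarrow> real)" where
  "coords W \<eta> k V p = (beta_of W \<eta> V (fst p), theta_of W (beta_of W \<eta> V (fst p)) k V (fst p) (snd p))"

text \<open>The absolute value of the Jacobian determinant of \<open>coords\<close>. The derivative of \<open>\<beta>\<close> in \<open>u\<close>
contributes \<open>2\<^sup>-\<^sup>n det H\<close> and that of \<open>\<theta>\<close> in \<open>s\<close> contributes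
\<open>det H\<close> times the product of the \<open>e\<^sup>u\<close>.\<close>

definition jacobian :: "('a \<Rightarrow> 'a \<Rightarrow> real) \<Rightarrow> ('a \<Rightarrow> real) \<Rightarrow> 'a list \<Rightarrow> ('a \<Rightarrow> real) \<Rightarrow> real" where
  "jacobian W \<eta> V u = (pivot_prod W (beta_of W \<eta> (set V) u) V)\<^sup>2 * (\<Prod>i\<in>set V. exp (u i) / 2)"

lemma measurable_beta_of[measurable (raw)]:
  assumes "finite V" "X \<in> M \<rightarrow>\<^sub>M Pi\<^sub>M V (\<lambda>_. lborel)"
  shows "(\<lambda>\<omega>. beta_of W \<eta> V (X \<omega>)) \<in> M \<rightarrow>\<^sub>M Pi\<^sub>M V (\<lambda>_. lborel)"
proof -
  have [measurable]: "(\<lambda>\<omega>. X \<omega> i) \<in> borel_measurable M" if "i \<in> V" for i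
    using measurable_compose[OF assms(2) measurable_component_singleton[OF that]] by simp
  show ?thesis unfolding beta_of_def
    by (rule measurable_restrict) (auto intro!: borel_measurable_sum borel_measurable_times borel_measurable_divide borel_measurable_add measurable_compose[OF _ borel_measurable_exp] borel_measurable_diff borel_measurable_uminus)
qed

lemma measurable_coordinates:
  assumes "X \<in> M \<rightarrow>\<^sub>M lborel_pairs V" "i \<in> V"
  shows "(\<lambda>\<omega>. fst (X \<omega>) i) \<in> borel_measurable M" "(\<lambda>\<omega>. snd (X \<omega>) i) \<in> borel_measurable M"
  using measurable_compose[OF measurable_fst'[OF assms(1)] measurable_component_singleton[OF assms(2)]]
    measurable_compose[OF measurable_snd'[OF assms(1)] measurable_component_singleton[OF assms(2)]] by simp_all

lemma measurable_coords[measurable]: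
  assumes "finite V"
  shows "coords W \<eta> k V \<in> lborel_pairs V \<rightarrow>\<^sub>M lborel_pairs V"
proof -
  let ?S = "lborel_pairs V"
  have b: "(\<lambda>p. beta_of W \<eta> V (fst p)) \<in> ?S \<rightarrow>\<^sub>M Pi\<^sub>M V (\<lambda>_. lborel)"
    by (rule measurable_beta_of[OF assms]) simp
  have [measurable]: "(\<lambda>p. beta_of W \<eta> V (fst p) i) \<in> borel_measurable (?S)"
     "(\<lambda>p. fst p i) \<in> borel_measurable (?S)"
     "(\<lambda>p. snd p i) \<in> borel_measurable (?S)" if "i \<in> V" for i
    using measurable_compose[OF b measurable_component_singleton[OF that]]
      measurable_coordinates[OF measurable_ident that] by simp_all
  have "(\<lambda>p. theta_of W (beta_of W \<eta> V (fst p)) k V (fst p) (snd p)) \<in> ?S \<rightarrow>\<^sub>M Pi\<^sub>M V (\<lambda>_. lborel)"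
    unfolding theta_of_def schrod_def
    by (rule measurable_restrict) (auto intro!: borel_measurable_sum borel_measurable_times borel_measurable_diff measurable_compose[OF _ borel_measurable_exp])
  then show ?thesis unfolding coords_def[abs_def] using b by (rule measurable_Pair[rotated])
qed

lemma measurable_jacobian:
  "(\<lambda>p. jacobian W \<eta> V (fst p)) \<in> borel_measurable (lborel_pairs (set V))"
proof -
  let ?S = "lborel_pairs (set V)"
  have b: "(\<lambda>p. beta_of W \<eta> (set V) (fst p)) \<in> ?S \<rightarrow>\<^sub>M Pi\<^sub>M (set V) (\<lambda>_. lborel)"
    by (rule measurable_beta_of) simp_all
  have [measurable]: "(\<lambda>p. pivot_prod W (beta_of W \<eta> (set V) (fst p)) V) \<in> borel_measurable (?S)"
    by (rule measurable_pivot_prod)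
      (use measurable_compose[OF b measurable_component_singleton] in simp)
  have [measurable]: "(\<lambda>p. fst p i) \<in> borel_measurable (?S)" if "i \<in> set V" for i
    by (rule measurable_coordinates) (use that in auto)
  show ?thesis unfolding jacobian_def by measurable
qed

text \<open>The triangular structure of the change of variables. Given \<open>z = (u\<^sub>c, s\<^sub>c)\<close>, the coordinates
\<open>q\<close> on \<open>V\<close> are those of the model with \<open>c\<close> merged into pinning and translation; and
\<open>(\<beta>\<^sub>c, \<theta>\<^sub>c)\<close> depends on the other fields only through \<open>q\<close>. In these terms
\<open>\<beta>\<^sub>c\<close> is a function of \<open>u\<^sub>c\<close> alone and \<open>\<theta>\<^sub>c\<close> is affine in \<open>s\<^sub>c\<close> with slope
\<open>h\<close>, because pivot times \<open>e\<^sup>u\<^sup>c\<close> is \<open>h\<close>.\<close>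

lemma coords_insert:
  fixes k :: "'a \<Rightarrow> real"
  assumes "distinct (c # V)" "conductances W (set (c # V))" "linked W \<eta> (set (c # V))"
  defines "\<eta>' \<equiv> \<lambda>(u::real) i. \<eta> i + W c i * exp u" and "k' \<equiv> \<lambda>u s i. k i + W c i * (exp u * s)"
  assumes q: "q = coords W (\<eta>' (fst z)) (k' (fst z) (snd z)) (set V) p"
    and h: "h = \<eta> c + green W (fst q) V (W c) \<eta>"
  shows "coords W \<eta> k (set (c # V)) (upd_pair c p z) =
      upd_pair c q ((green W (fst q) V (W c) (W c) + exp (- fst z) * h) / 2,
        h * snd z - (k c + green W (fst q) V (W c) (\<lambda>i. snd q i + k i)))" (is "?C = ?R")
    and "jacobian W \<eta> (c # V) (fst (upd_pair c p z)) =
      jacobian W (\<eta>' (fst z)) V (fst p) * (exp (- fst z) * h / 2 * h)"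
    and "pos_pivots W (fst q) V" "0 < h"
proof -
  let ?u = "fst (upd_pair c p z)" and ?s = "snd (upd_pair c p z)"
  let ?b = "beta_of W \<eta> (set (c # V)) ?u"
  let ?th = "theta_of W ?b k (set (c # V)) ?u ?s"
  have c: "c \<notin> set V" using assms(1) by simp
  have V: "distinct V" "conductances W (set V)"
    using assms(1) conductances_subset[OF assms(2), of "set V"] by auto
  have uc: "?u c = fst z" "?s c = snd z" by (simp_all add: upd_pair_def)
  have uA: "?u i = fst p i" "?s i = snd p i" if "i \<in> set V" for i using c that by (auto simp: upd_pair_def)
  have q1: "fst q = beta_of W (\<eta>' (fst z)) (set V) (fst p)" by (simp add: q coords_def)
  then have q1': "fst q = beta_of W (\<lambda>i. \<eta> i + W c i * exp (?u c)) (set V) ?u"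
    unfolding uc \<eta>'_def by (simp add: uA cong: beta_of_cong)
  have link: "linked W (\<eta>' (fst z)) (set V)"
    unfolding \<eta>'_def by (rule linked_remove) (use assms c in auto)
  show pos: "pos_pivots W (fst q) V" unfolding q1 by (rule pos_pivots_beta_of[OF V link])
  show "0 < h" unfolding h by (rule pinning_pos[OF assms(1-3) pos])
  have bA: "?b i = fst q i" if "i \<in> set V" for i
    unfolding q1' by (rule beta_of_remove[OF c assms(2) that])
  have bc: "2 * ?b c = green W (fst q) V (W c) (W c) + exp (- fst z) * h"
    using pivot_beta_of[OF assms(1,2) pos q1'] unfolding uc h .
  have g: "green W ?b V x y = green W (fst q) V x y" for x y
    by (rule green_cong) (use bA in auto)
  let ?x = "\<lambda>j. exp (?u j) * ?s j"
  have thA: "?th i = snd q i" if "i \<in> set V" for i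
  proof -
    have "snd q i = 2 * fst q i * (exp (fst p i) * snd p i)
       - (\<Sum>j\<in>set V. W i j * (exp (fst p j) * snd p j)) - (k i + W c i * (exp (fst z) * snd z))"
      using that by (simp add: q coords_def theta_of_def schrod_def k'_def)
    moreover have "(\<Sum>j\<in>set V. W i j * (exp (fst p j) * snd p j)) = (\<Sum>j\<in>set V. W i j * ?x j)"
      by (rule sum.cong) (simp_all add: uA)
    moreover have "?th i
        = 2 * ?b i * (exp (?u i) * ?s i) - (W i c * (exp (?u c) * ?s c) + (\<Sum>j\<in>set V. W i j * ?x j)) - k i"
      using that c by (simp add: theta_of_def schrod_def)
    moreover have "W i c = W c i"
      by (rule conductancesD(2)[OF assms(2)]) (use that in simp_all)
    ultimately show ?thesis unfolding bA[OF that] uA[OF that] uc by simp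
  qed
  have "(\<Sum>j\<in>set V. W c j * ?x j) = green W (fst q) V (W c) (schrod W (fst q) (set V) ?x)"
    using green_schrod[OF V pos] by simp
  also have "\<dots> = green W (fst q) V (W c) (\<lambda>i. (snd q i + k i) + (exp (fst z) * snd z) * W c i)"
  proof (rule green_cong)
    fix i assume i: "i \<in> set V"
    have "(\<Sum>j\<in>set V. W i j * (exp (fst p j) * snd p j)) = (\<Sum>j\<in>set V. W i j * ?x j)"
      by (rule sum.cong) (simp_all add: uA)
    then show "schrod W (fst q) (set V) ?x i = (snd q i + k i) + (exp (fst z) * snd z) * W c i"
      using i uA[OF i] by (simp add: q coords_def theta_of_def schrod_def k'_def)
  qed auto
  also have "\<dots> = green W (fst q) V (W c) (\<lambda>i. snd q i + k i) + (exp (fst z) * snd z) * green W (fst q) V (W c) (W c)"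
    by (simp only: green_add green_scale)
  finally have sum: "(\<Sum>j\<in>set V. W c j * ?x j) = \<dots>" .
  have "?th c = 2 * ?b c * ?x c - (\<Sum>j\<in>set V. W c j * ?x j) - k c"
    using c conductancesD(1)[OF assms(2) list.set_intros(1)] by (simp add: theta_of_def schrod_def)
  also have "\<dots> = h * snd z - (k c + green W (fst q) V (W c) (\<lambda>i. snd q i + k i))"
    unfolding sum bc uc by (simp add: algebra_simps flip: exp_add)
  finally have thc: "?th c = \<dots>" .
  have ext: "fst q i = undefined" "snd q i = undefined" if "i \<notin> set V" for i
    using that by (simp_all add: q coords_def beta_of_def theta_of_def)
  have "?b i = fst ?R i" "?th i = snd ?R i" for i
  proof -
    show "?b i = fst ?R i"
    proof (cases "i = c")
      case True then show ?thesis using bc by (simp add: upd_pair_def)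
    next
      case False then show ?thesis
        using bA[of i] ext[of i] by (cases "i \<in> set V") (auto simp: upd_pair_def beta_of_def)
    qed
    show "?th i = snd ?R i"
    proof (cases "i = c")
      case True then show ?thesis using thc by (simp add: upd_pair_def)
    next
      case False then show ?thesis
        using thA[of i] ext[of i] by (cases "i \<in> set V") (auto simp: upd_pair_def theta_of_def)
    qed
  qed
  then show "?C = ?R" unfolding coords_def by (intro prod_eqI ext) auto
  have "pivot W ?b c V = exp (- fst z) * h" unfolding pivot_def g using bc by simp
  moreover have "pivot_prod W ?b V = pivot_prod W (fst q) V" by (rule pivot_prod_cong) (use bA in auto)
  moreover have "(\<Prod>i\<in>set V. exp (?u i) / 2) = (\<Prod>i\<in>set V. exp (fst p i) / 2)"
    by (rule prod.cong) (simp_all add: uA)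
  ultimately have "jacobian W \<eta> (c # V) ?u = (exp (- fst z) * h * pivot_prod W (fst q) V)\<^sup>2
       * (exp (fst z) / 2 * (\<Prod>i\<in>set V. exp (fst p i) / 2))"
    using c unfolding jacobian_def by (simp add: uc)
  also have "\<dots> = jacobian W (\<eta>' (fst z)) V (fst p) * (exp (- fst z) * h / 2 * h)"
    by (simp add: jacobian_def q1[symmetric] power2_eq_square field_simps flip: exp_add)
  finally show "jacobian W \<eta> (c # V) ?u = jacobian W (\<eta>' (fst z)) V (fst p) * (exp (- fst z) * h / 2 * h)" .
qed

lemma jacobian_nonneg: "0 \<le> jacobian W \<eta> V u"
  unfolding jacobian_def by (intro mult_nonneg_nonneg prod_nonneg) auto

text \<open>The second coordinate is substituted first, by an affine map for fixed \<open>u\<^sub>c\<close>.\<close>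

lemma nn_integral_vertex_substitution:
  fixes F :: "real \<times> real \<Rightarrow> ennreal"
  assumes F[measurable]: "F \<in> borel_measurable borel" and h: "0 < h"
  shows "(\<integral>\<^sup>+z. F ((\<kappa> + exp (- fst z) * h) / 2, h * snd z - r) * ennreal (exp (- fst z) * h / 2 * h) \<partial>lborel)
    = (\<integral>\<^sup>+z. F z * indicator {z. \<kappa> < 2 * fst z} z \<partial>lborel)"
proof -
  let ?b = "\<lambda>u. (\<kappa> + exp (- u) * h) / 2"
  have F'[measurable]: "F \<in> borel_measurable (lborel \<Otimes>\<^sub>M lborel)" "F \<in> borel_measurable (borel \<Otimes>\<^sub>M borel)"
    by (simp_all add: lborel_prod borel_prod)
  have "(\<integral>\<^sup>+z. F ((\<kappa> + exp (- fst z) * h) / 2, h * snd z - r) * ennreal (exp (- fst z) * h / 2 * h) \<partial>lborel)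
    = (\<integral>\<^sup>+u. \<integral>\<^sup>+s. F (?b u, h * s - r) * ennreal (exp (- u) * h / 2 * h) \<partial>lborel \<partial>lborel)"
    unfolding lborel_prod[symmetric] by (subst lborel.nn_integral_fst[symmetric]) auto
  also have "\<dots> = (\<integral>\<^sup>+u. (\<integral>\<^sup>+t. F (?b u, t) \<partial>lborel) * ennreal (exp (- u) * h / 2) \<partial>lborel)"
  proof (rule nn_integral_cong)
    fix u
    have "(\<integral>\<^sup>+s. F (?b u, h * s - r) * ennreal (exp (- u) * h / 2 * h) \<partial>lborel)
      = (\<integral>\<^sup>+s. (ennreal h * F (?b u, - r + h * s)) * ennreal (exp (- u) * h / 2) \<partial>lborel)"
      using h by (intro nn_integral_cong) (subst ennreal_mult, auto simp: mult_ac)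
    also have "\<dots> = (ennreal h * (\<integral>\<^sup>+s. F (?b u, - r + h * s) \<partial>lborel)) * ennreal (exp (- u) * h / 2)"
      by (simp add: nn_integral_cmult nn_integral_multc)
    also have "ennreal h * (\<integral>\<^sup>+s. F (?b u, - r + h * s) \<partial>lborel) = (\<integral>\<^sup>+t. F (?b u, t) \<partial>lborel)"
      using nn_integral_real_affine[of "\<lambda>t. F (?b u, t)" h "- r"] h by simp
    finally show "(\<integral>\<^sup>+s. F (?b u, h * s - r) * ennreal (exp (- u) * h / 2 * h) \<partial>lborel)
      = (\<integral>\<^sup>+t. F (?b u, t) \<partial>lborel) * ennreal (exp (- u) * h / 2)" .
  qed
  also have "\<dots> = (\<integral>\<^sup>+b. (\<integral>\<^sup>+t. F (b, t) \<partial>lborel) * indicator {b. \<kappa> < 2 * b} b \<partial>lborel)"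
    by (rule nn_integral_pivot_substitution[OF _ h]) measurable
  also have "\<dots> = (\<integral>\<^sup>+b. \<integral>\<^sup>+t. F (b, t) * indicator {z. \<kappa> < 2 * fst z} (b, t) \<partial>lborel \<partial>lborel)"
    by (intro nn_integral_cong) (auto split: split_indicator)
  also have "\<dots> = (\<integral>\<^sup>+z. F z * indicator {z. \<kappa> < 2 * fst z} z \<partial>lborel)"
    unfolding lborel_prod[symmetric] by (subst lborel.nn_integral_fst) auto
  finally show ?thesis .
qed

text \<open>The map from the fields to the parameters is a bijection onto the set where \<open>H\<close> is positive definite,
in the form of an integral identity. In the induction step the pair \<open>z\<close> at the new vertex \<open>c\<close> is
integrated last, so that the induction hypothesis applies with the pinning and translation that
depend on \<open>z\<close>; then the order is exchanged, and \<open>z\<close> is substituted for fixed parameters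
\<open>q\<close> of the other vertices.\<close>

theorem nn_integral_coords:
  assumes "distinct V" "conductances W (set V)" "linked W \<eta> (set V)"
    and "F \<in> borel_measurable (lborel_pairs (set V))"
  shows "(\<integral>\<^sup>+p. F (coords W \<eta> k (set V) p) * ennreal (jacobian W \<eta> V (fst p)) \<partial>lborel_pairs (set V))
    = (\<integral>\<^sup>+q. F q * indicator {q. pos_pivots W (fst q) V} q \<partial>lborel_pairs (set V))"
  using assms
proof (induction V arbitrary: \<eta> k F)
  case Nil
  have "coords W \<eta> k {} p = p" if "p \<in> space (lborel_pairs {})" for p
    using that by (auto simp: coords_def beta_of_def theta_of_def space_pair_measure space_PiM prod_eq_iff)
  then show ?case by (auto simp: jacobian_def intro!: nn_integral_cong)
next
  case (Cons c V)
  let ?L = "lborel_pairs (set V)"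
  let ?L' = "lborel_pairs (insert c (set V))"
  let ?Q = "indicator {q. pos_pivots W (fst q) (c # V)} :: _ \<Rightarrow> ennreal"
  let ?J = "\<lambda>p. F (coords W \<eta> k (set (c # V)) p) * ennreal (jacobian W \<eta> (c # V) (fst p))"
  have c: "c \<notin> set V" and dV: "distinct V" using Cons.prems(1) by simp_all
  have WV: "conductances W (set V)"
    using conductances_subset[OF Cons.prems(2), of "set V"] by auto
  interpret S: sigma_finite_measure ?L by (rule sigma_finite_lborel_pairs) simp
  have F[measurable]: "F \<in> borel_measurable (?L')" using Cons.prems(4) by simp
  define \<kappa> where "\<kappa> q = green W (fst q) V (W c) (W c)" for q :: "('a \<Rightarrow> real) \<times> ('a \<Rightarrow> real)"
  define h where "h q = \<eta> c + green W (fst q) V (W c) \<eta>" for q :: "('a \<Rightarrow> real) \<times> ('a \<Rightarrow> real)"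
  define r where "r q = k c + green W (fst q) V (W c) (\<lambda>i. snd q i + k i)" for q :: "('a \<Rightarrow> real) \<times> ('a \<Rightarrow> real)"
  have comp[measurable]: "(\<lambda>q. fst q i) \<in> borel_measurable ?L" "(\<lambda>q. snd q i) \<in> borel_measurable ?L" if "i \<in> set V" for i
    using measurable_coordinates[OF measurable_ident that] by simp_all
  have [measurable]: "\<kappa> \<in> borel_measurable ?L" "h \<in> borel_measurable ?L" "r \<in> borel_measurable ?L"
    unfolding \<kappa>_def[abs_def] h_def[abs_def] r_def[abs_def]
    by (intro borel_measurable_add measurable_green measurable_const; use comp in simp)+
  \<comment> \<open>The integrand in terms of the parameters \<open>q\<close> on \<open>V\<close> and the fields \<open>z\<close> at \<open>c\<close>.\<close>
  define G where "G z q = F (upd_pair c q ((\<kappa> q + exp (- fst z) * h q) / 2, h q * snd z - r q))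
     * ennreal (exp (- fst z) * h q / 2 * h q)" for z :: "real \<times> real" and q
  have fs[measurable]: "(fst :: real \<times> real \<Rightarrow> real) \<in> borel_measurable borel" "(snd :: real \<times> real \<Rightarrow> real) \<in> borel_measurable borel"
    by (intro borel_measurable_continuous_onI continuous_intros)+
  have G1: "(\<lambda>x. G (fst x) (snd x)) \<in> borel_measurable (lborel \<Otimes>\<^sub>M ?L)"
  proof -
    have [measurable]: "(\<lambda>x. upd_pair c (snd x) ((\<kappa> (snd x) + exp (- fst (fst x)) * h (snd x)) / 2, h (snd x) * snd (fst x) - r (snd x)))
      \<in> (lborel :: (real \<times> real) measure) \<Otimes>\<^sub>M ?L \<rightarrow>\<^sub>M ?L'"
      by (rule measurable_upd_pair) (auto intro!: borel_measurable_Pair)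
    show ?thesis unfolding G_def by measurable
  qed
  have Gz[measurable]: "G z \<in> borel_measurable ?L" for z
    using measurable_compose[OF measurable_Pair1'[of z lborel ?L] G1] by simp
  have pred[measurable]: "Measurable.pred ?L (\<lambda>q. pos_pivots W (fst q) V)"
    by (rule pred_pos_pivots) simp
  \<comment> \<open>Pinning and translation seen by the other vertices when the fields at \<open>c\<close> are \<open>z\<close>.\<close>
  let ?\<eta> = "\<lambda>(z :: real \<times> real) i. \<eta> i + W c i * exp (fst z)" and ?k = "\<lambda>(z :: real \<times> real) i. k i + W c i * (exp (fst z) * snd z)"
  let ?P = "{q. pos_pivots W (fst q) V}"
  have cm: "coords W \<eta> k (set (c # V)) \<in> ?L' \<rightarrow>\<^sub>M ?L'"
    using measurable_coords[of "set (c # V)" W \<eta> k] by simp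
  have jm: "(\<lambda>p. jacobian W \<eta> (c # V) (fst p)) \<in> borel_measurable (?L')"
    using measurable_jacobian[of W \<eta> "c # V"] by simp
  have fm: "(\<lambda>p. F (coords W \<eta> k (set (c # V)) p) * ennreal (jacobian W \<eta> (c # V) (fst p)))
     \<in> borel_measurable (?L')"
    using measurable_compose[OF cm F] jm by measurable
  have "(\<integral>\<^sup>+p. F (coords W \<eta> k (set (c # V)) p) * ennreal (jacobian W \<eta> (c # V) (fst p)) \<partial>lborel_pairs (set (c # V)))
    = (\<integral>\<^sup>+p. \<integral>\<^sup>+z. ?J (upd_pair c p z) \<partial>lborel \<partial>?L)"
    using nn_integral_lborel_pairs_insert[OF _ c fm] by simp
  also have "\<dots> = (\<integral>\<^sup>+z. \<integral>\<^sup>+p. ?J (upd_pair c p z) \<partial>?L \<partial>lborel)"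
    by (rule nn_integral_swap)
      (use measurable_compose[OF measurable_upd_pair_pair fm] in \<open>auto simp: case_prod_beta' S.sigma_finite_measure_axioms lborel.sigma_finite_measure_axioms\<close>)
  also have "\<dots> = (\<integral>\<^sup>+z. \<integral>\<^sup>+p. G z (coords W (?\<eta> z) (?k z) (set V) p) * ennreal (jacobian W (?\<eta> z) V (fst p)) \<partial>?L \<partial>lborel)"
  proof (intro nn_integral_cong)
    fix z :: "real \<times> real" and p
    let ?q = "coords W (?\<eta> z) (?k z) (set V) p"
    note ci = coords_insert[OF Cons.prems(1-3) refl h_def]
    have "coords W \<eta> k (set (c # V)) (upd_pair c p z) = upd_pair c ?q ((\<kappa> ?q + exp (- fst z) * h ?q) / 2, h ?q * snd z - r ?q)"
      unfolding \<kappa>_def r_def by (rule ci(1))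
    moreover have "jacobian W \<eta> (c # V) (fst (upd_pair c p z)) = jacobian W (?\<eta> z) V (fst p) * (exp (- fst z) * h ?q / 2 * h ?q)"
      by (rule ci(2))
    ultimately show "?J (upd_pair c p z)
       = G z ?q * ennreal (jacobian W (?\<eta> z) V (fst p))"
      unfolding G_def by (simp only: ennreal_mult' jacobian_nonneg mult_ac)
  qed
  also have "\<dots> = (\<integral>\<^sup>+z. \<integral>\<^sup>+q. G z q * indicator ?P q \<partial>?L \<partial>lborel)"
  proof (rule nn_integral_cong)
    fix z :: "real \<times> real"
    have "linked W (?\<eta> z) (set V)" by (rule linked_remove[OF Cons.prems(3,2) _ c]) simp
    then show "(\<integral>\<^sup>+p. G z (coords W (?\<eta> z) (?k z) (set V) p) * ennreal (jacobian W (?\<eta> z) V (fst p)) \<partial>?L)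
       = (\<integral>\<^sup>+q. G z q * indicator ?P q \<partial>?L)"
      by (rule Cons.IH[OF dV WV _ Gz])
  qed
  also have "\<dots> = (\<integral>\<^sup>+q. \<integral>\<^sup>+z. G z q * indicator ?P q \<partial>lborel \<partial>?L)"
  proof (rule nn_integral_swap)
    show "(\<lambda>(z, q). G z q * indicator ?P q) \<in> borel_measurable (lborel \<Otimes>\<^sub>M ?L)"
      unfolding case_prod_beta' using G1 by measurable
  qed (auto simp: S.sigma_finite_measure_axioms lborel.sigma_finite_measure_axioms)
  also have "\<dots> = (\<integral>\<^sup>+q. \<integral>\<^sup>+z. F (upd_pair c q z) * ?Q (upd_pair c q z) \<partial>lborel \<partial>?L)"
  proof (rule nn_integral_cong)
    fix q assume q: "q \<in> space ?L"
    have e: "pos_pivots W (fst (upd_pair c q z)) (c # V) \<longleftrightarrow> pos_pivots W (fst q) V \<and> \<kappa> q < 2 * fst z" for z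
    proof -
      have "pos_pivots W (fst (upd_pair c q z)) V = pos_pivots W (fst q) V"
        by (rule pos_pivots_cong) (use c in \<open>auto simp: upd_pair_def\<close>)
      moreover have "green W (fst (upd_pair c q z)) V (W c) (W c) = \<kappa> q"
        unfolding \<kappa>_def by (rule green_cong) (use c in \<open>auto simp: upd_pair_def\<close>)
      ultimately show ?thesis by (simp add: pivot_def) (simp add: upd_pair_def)
    qed
    show "(\<integral>\<^sup>+z. G z q * indicator ?P q \<partial>lborel)
       = (\<integral>\<^sup>+z. F (upd_pair c q z) * ?Q (upd_pair c q z) \<partial>lborel)"
    proof (cases "pos_pivots W (fst q) V")
      case False
      then show ?thesis using e by simp
    next
      case True
      have h: "0 < h q" unfolding h_def by (rule pinning_pos[OF Cons.prems(1-3) True])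
      have "(\<lambda>z. upd_pair c q z) \<in> borel \<rightarrow>\<^sub>M ?L'"
        by (rule measurable_upd_pair) (use q in auto)
      from measurable_compose[OF this F]
      have "(\<integral>\<^sup>+z. G z q \<partial>lborel) = (\<integral>\<^sup>+z. F (upd_pair c q z) * indicator {z. \<kappa> q < 2 * fst z} z \<partial>lborel)"
        unfolding G_def by (rule nn_integral_vertex_substitution[OF _ h])
      also have "\<dots> = (\<integral>\<^sup>+z. F (upd_pair c q z) * ?Q (upd_pair c q z) \<partial>lborel)"
        by (intro nn_integral_cong) (use True e in \<open>auto split: split_indicator\<close>)
      finally show ?thesis using True by simp
    qed
  qed
  also have "\<dots> = (\<integral>\<^sup>+q. F q * ?Q q \<partial>lborel_pairs (set (c # V)))"
  proof -
    have [measurable]: "Measurable.pred (?L') (\<lambda>q. pos_pivots W (fst q) (c # V))"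
      by (rule pred_pos_pivots) (rule measurable_coordinates(1)[OF measurable_ident_sets[OF refl]], simp)
    have "(\<lambda>q. F q * ?Q q) \<in> borel_measurable (?L')"
      by measurable
    from nn_integral_lborel_pairs_insert[OF _ c this] show ?thesis by simp
  qed
  finally show ?case .
qed

section \<open>Integrating out a vertex\<close>

text \<open>The joint density of \<open>(\<beta>, \<theta>)\<close>. Its marginal in \<open>\<beta>\<close> is the random Schroedinger operator
law of Sabot, Tarres and Zeng; given \<open>\<beta>\<close>, the variable \<open>\<theta>\<close> is centred Gaussian with
covariance matrix \<open>H\<close>.\<close>

definition pin_density :: "('a \<Rightarrow> 'a \<Rightarrow> real) \<Rightarrow> ('a \<Rightarrow> real) \<Rightarrow> 'a list \<Rightarrow> ('a \<Rightarrow> real) \<times> ('a \<Rightarrow> real) \<Rightarrow> real" where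
  "pin_density W \<eta> V q = (if pos_pivots W (fst q) V then
     exp (- (2 * (\<Sum>i\<in>set V. fst q i) - (\<Sum>i\<in>set V. \<Sum>j\<in>set V. W i j)
        + green W (fst q) V \<eta> \<eta> - 2 * (\<Sum>i\<in>set V. \<eta> i) + green W (fst q) V (snd q) (snd q)) / 2)
       / (pi ^ length V * pivot_prod W (fst q) V) else 0)"

text \<open>The observable in terms of \<open>(\<beta>, \<theta>)\<close>; \<open>a\<close> stands for the parameter at the pinning vertex.\<close>

definition exp_observable :: "('a \<Rightarrow> 'a \<Rightarrow> real) \<Rightarrow> ('a \<Rightarrow> real) \<Rightarrow> ('a \<Rightarrow> real) \<Rightarrow> real \<Rightarrow> 'a list \<Rightarrow>
    ('a \<Rightarrow> real) \<times> ('a \<Rightarrow> real) \<Rightarrow> complex" where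
  "exp_observable W \<eta> \<alpha> a V q =
     exp (of_real (a + green W (fst q) V \<alpha> \<eta>) + \<i> * of_real (green W (fst q) V \<alpha> (snd q)))"

lemma pin_density_nonneg: "0 \<le> pin_density W \<eta> V q"
  unfolding pin_density_def using pivot_prod_pos[of W "fst q" V] by auto

text \<open>The Green form is nonnegative on nonnegative vectors, so the real part of the exponent is at most
zero.\<close>

lemma exp_observable_bound:
  assumes "pos_pivots W (fst q) V" "conductances W (set V)" "linked W \<eta> (set V)"
    "\<And>i. i \<in> set V \<Longrightarrow> \<alpha> i \<le> 0" "a \<le> 0"
  shows "norm (exp_observable W \<eta> \<alpha> a V q) \<le> 1"
proof -
  have "0 \<le> green W (fst q) V (\<lambda>i. (-1) * \<alpha> i) \<eta>"
    using assms conductancesD(3)[OF assms(2)] by (intro green_nonneg) (auto simp: linked_def)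
  then have "green W (fst q) V \<alpha> \<eta> \<le> 0"
    by (simp only: green_commute[of _ _ _ _ \<eta>] green_scale)
  then show ?thesis using assms(5) by (simp add: exp_observable_def)
qed

lemma measurable_pin_density: "pin_density W \<eta> V \<in> borel_measurable (lborel_pairs (set V))"
proof -
  let ?S = "lborel_pairs (set V)"
  have c[measurable]: "(\<lambda>q. fst q i) \<in> borel_measurable (?S)"
    "(\<lambda>q. snd q i) \<in> borel_measurable (?S)" if "i \<in> set V" for i
    using measurable_coordinates[OF measurable_ident that] by simp_all
  have [measurable]: "(\<lambda>q. green W (fst q) V \<eta> \<eta>) \<in> borel_measurable (?S)"
    "(\<lambda>q. green W (fst q) V (snd q) (snd q)) \<in> borel_measurable (?S)"
    by (rule measurable_green; use c in simp)+
  have [measurable]: "(\<lambda>q. pivot_prod W (fst q) V) \<in> borel_measurable (?S)"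
     "Measurable.pred (?S) (\<lambda>q. pos_pivots W (fst q) V)"
    by (rule measurable_pivot_prod pred_pos_pivots; use c in simp)+
  show ?thesis unfolding pin_density_def[abs_def] by measurable
qed

lemma measurable_exp_observable: "exp_observable W \<eta> \<alpha> a V \<in> borel_measurable (lborel_pairs (set V))"
proof -
  let ?S = "lborel_pairs (set V)"
  have c[measurable]: "(\<lambda>q. fst q i) \<in> borel_measurable (?S)"
    "(\<lambda>q. snd q i) \<in> borel_measurable (?S)" if "i \<in> set V" for i
    using measurable_coordinates[OF measurable_ident that] by simp_all
  have [measurable]: "(\<lambda>q. green W (fst q) V \<alpha> \<eta>) \<in> borel_measurable (?S)"
    "(\<lambda>q. green W (fst q) V \<alpha> (snd q)) \<in> borel_measurable (?S)"
    by (rule measurable_green; use c in simp)+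
  show ?thesis unfolding exp_observable_def[abs_def] by measurable
qed

text \<open>The factorization behind the martingale property. All dependence on the coordinates \<open>z\<close> of \<open>c\<close>
is through the pivot \<open>p\<close> and the translated variable \<open>t\<close>. The pinning on \<open>V\<close> becomes
\<open>\<eta> + W\<^sub>c\<close> since \<open>\<langle>\<eta> + W\<^sub>c, G (\<eta> + W\<^sub>c)\<rangle>\<close> absorbs the terms
\<open>\<langle>W\<^sub>c, G W\<^sub>c\<rangle>\<close> from \<open>2 \<beta>\<^sub>c\<close> and \<open>2 \<langle>W\<^sub>c, G \<eta>\<rangle>\<close> from \<open>2 h\<close>.\<close>

lemma insert_vertex:
  assumes "distinct (c # V)" "conductances W (set (c # V))"
    and p: "p = 2 * fst z - green W (fst q) V (W c) (W c)"
    and h: "h = \<eta> c + green W (fst q) V (W c) \<eta>"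
    and t: "t = snd z + green W (fst q) V (W c) (snd q)"
  shows pin_density_insert: "pin_density W \<eta> (c # V) (upd_pair c q z) =
      (if 0 < p then pin_density W (\<lambda>i. \<eta> i + W c i) V q * (exp (h - (p + h\<^sup>2 / p + t\<^sup>2 / p) / 2) / (pi * p)) else 0)"
    and exp_observable_insert: "l = \<alpha> c + green W (fst q) V (W c) \<alpha> \<Longrightarrow>
      exp_observable W \<eta> \<alpha> a (c # V) (upd_pair c q z) = exp_observable W (\<lambda>i. \<eta> i + W c i) \<alpha> (a + \<alpha> c) V q
      * exp (of_real (- l + l * h / p) + \<i> * of_real (l * t / p))"
proof -
  let ?q = "upd_pair c q z"
  have c: "c \<notin> set V" using assms(1) by simp
  have u: "fst ?q i = fst q i" "snd ?q i = snd q i" if "i \<in> set V" for i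
    using that c by (auto simp: upd_pair_def)
  have uc: "fst ?q c = fst z" "snd ?q c = snd z" by (simp_all add: upd_pair_def)
  have g: "green W (fst ?q) V x y = green W (fst q) V x y" for x y
    by (rule green_cong) (use u in auto)
  have g2: "green W (fst q) V x (snd ?q) = green W (fst q) V x (snd q)" for x
    by (rule green_cong) (use u in auto)
  have g3: "green W (fst q) V (snd ?q) (snd ?q) = green W (fst q) V (snd q) (snd q)"
    by (rule green_cong) (use u in auto)
  have piv: "pivot W (fst ?q) c V = p" unfolding pivot_def g uc p ..
  have pos: "pos_pivots W (fst ?q) (c # V) \<longleftrightarrow> pos_pivots W (fst q) V \<and> 0 < p"
    using pos_pivots_cong[of V "fst ?q" "fst q" W W] u by (simp add: piv)
  have pp: "pivot_prod W (fst ?q) V = pivot_prod W (fst q) V"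
    by (rule pivot_prod_cong) (use u in auto)
  let ?g = "green W (fst q) V"
  show "pin_density W \<eta> (c # V) ?q =
      (if 0 < p then pin_density W (\<lambda>i. \<eta> i + W c i) V q * (exp (h - (p + h\<^sup>2 / p + t\<^sup>2 / p) / 2) / (pi * p)) else 0)"
  proof (cases "pos_pivots W (fst q) V \<and> 0 < p")
    case False then show ?thesis unfolding pin_density_def pos by auto
  next
    case True
    have s1: "(\<Sum>i\<in>set (c # V). fst ?q i) = fst z + (\<Sum>i\<in>set V. fst q i)"
      using c u uc by simp
    have "(\<Sum>i\<in>set V. W i c) = (\<Sum>i\<in>set V. W c i)"
      by (rule sum.cong) (auto intro: conductancesD(2)[OF assms(2)])
    then have s2: "(\<Sum>i\<in>set (c # V). \<Sum>j\<in>set (c # V). W i j) = 2 * (\<Sum>i\<in>set V. W c i) + (\<Sum>i\<in>set V. \<Sum>j\<in>set V. W i j)"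
      using c conductancesD(1)[OF assms(2) list.set_intros(1)] by (simp add: sum.distrib)
    have g4: "green W (fst ?q) (c # V) \<eta> \<eta> = ?g \<eta> \<eta> + h\<^sup>2 / p"
      "green W (fst ?q) (c # V) (snd ?q) (snd ?q) = ?g (snd q) (snd q) + t\<^sup>2 / p"
      by (simp_all add: green_Cons g g2[of "W c"] g3 piv h t uc power2_eq_square)
    have g5: "?g (\<lambda>i. \<eta> i + W c i) (\<lambda>i. \<eta> i + W c i) = ?g \<eta> \<eta> + 2 * ?g (W c) \<eta> + ?g (W c) (W c)"
      by (simp add: green_add green_add_left green_commute[of _ _ _ \<eta> "W c"])
    have s3: "(\<Sum>i\<in>set (c # V). \<eta> i) = \<eta> c + (\<Sum>i\<in>set V. \<eta> i)" using c by simp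
    have e: "- (2 * (fst z + S) - (2 * w + S2) + (gg + h2) - 2 * (\<eta> c + e) + (th + t2)) / 2
      = - (2 * S - S2 + (gg + 2 * ?g (W c) \<eta> + ?g (W c) (W c)) - 2 * (e + w) + th) / 2 + (h - (p + h2 + t2) / 2)"
      for S w S2 gg h2 e th t2 :: real
      unfolding p h by (simp add: field_simps)
    show ?thesis using True
      by (simp only: pin_density_def pos s1 s2 s3 g4 g5 sum.distrib e if_True exp_add pivot_prod.simps piv pp)
         (simp add: field_simps)
  qed
  assume l: "l = \<alpha> c + ?g (W c) \<alpha>"
  have "green W (fst ?q) (c # V) \<alpha> \<eta> = ?g \<alpha> \<eta> + l * h / p"
    "green W (fst ?q) (c # V) \<alpha> (snd ?q) = ?g \<alpha> (snd q) + l * t / p"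
    by (simp_all add: green_Cons g g2 piv h l t uc)
  moreover have "?g \<alpha> (\<lambda>i. \<eta> i + W c i) = ?g \<alpha> \<eta> + ?g (W c) \<alpha>"
    by (simp add: green_add green_commute[of _ _ _ \<alpha> "W c"])
  ultimately show "exp_observable W \<eta> \<alpha> a (c # V) ?q = exp_observable W (\<lambda>i. \<eta> i + W c i) \<alpha> (a + \<alpha> c) V q
      * exp (of_real (- l + l * h / p) + \<i> * of_real (l * t / p))"
    unfolding exp_observable_def mult_exp_exp by (simp add: l algebra_simps)
qed

text \<open>The function of \<open>(p, t)\<close> from the factorization is a reciprocal inverse Gaussian density in \<open>p\<close>, with
respect to \<open>d\<beta>\<^sub>c = dp / 2\<close>, times a centred Gaussian density in \<open>t\<close> of variance
\<open>p\<close>.\<close>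

lemma pivot_weight:
  assumes "0 < (p::real)"
  shows "exp (h - (p + h\<^sup>2 / p + t\<^sup>2 / p) / 2) / (pi * p)
    = (sqrt (2 / (pi * p)) * exp (h - (p + h\<^sup>2 / p) / 2)) * (exp (- t\<^sup>2 / (2 * p)) / sqrt (2 * pi * p))"
proof -
  have "sqrt (2 / (pi * p)) / sqrt (2 * pi * p) = sqrt ((1 / (pi * p))\<^sup>2)"
    unfolding real_sqrt_divide[symmetric] using assms by (simp add: field_simps power2_eq_square)
  then have "sqrt (2 / (pi * p)) / sqrt (2 * pi * p) = 1 / (pi * p)" using assms by simp
  moreover have "exp (h - (p + h\<^sup>2 / p + t\<^sup>2 / p) / 2) = exp (h - (p + h\<^sup>2 / p) / 2) * exp (- t\<^sup>2 / (2 * p))"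
    unfolding exp_add[symmetric] using assms by (simp add: field_simps)
  moreover have "E / k = (r * A) * (e / s)" if "r / s = 1 / k" "E = A * e" for E A e k r s :: real
  proof -
    have "E / k = A * e * (1 / k)" using that by simp
    also have "\<dots> = A * e * (r / s)" by (simp only: that)
    finally show ?thesis by simp
  qed
  ultimately show ?thesis by blast
qed

lemma measurable_upd_pair_section:
  assumes "q \<in> space (lborel_pairs A)"
  shows "(\<lambda>z. upd_pair c q z) \<in> lborel \<rightarrow>\<^sub>M lborel_pairs (insert c A)"
  by (rule measurable_upd_pair) (use assms in auto)

lemma nn_integral_pin_density_insert:
  assumes "distinct (c # V)" "conductances W (set (c # V))" "linked W \<eta> (set (c # V))"
    and q: "q \<in> space (lborel_pairs (set V))"
  shows "(\<integral>\<^sup>+z. ennreal (pin_density W \<eta> (c # V) (upd_pair c q z)) \<partial>lborel)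
    = ennreal (pin_density W (\<lambda>i. \<eta> i + W c i) V q)"
proof (cases "pos_pivots W (fst q) V")
  case False
  have "pin_density W \<eta> (c # V) (upd_pair c q z) = 0" for z
    using pin_density_insert[OF assms(1,2) refl refl refl, of \<eta> q z] False
    by (auto simp: pin_density_def)
  then show ?thesis using False by (simp add: pin_density_def)
next
  case True
  define \<kappa> where "\<kappa> = green W (fst q) V (W c) (W c)"
  define h where "h = \<eta> c + green W (fst q) V (W c) \<eta>"
  define \<tau> where "\<tau> = green W (fst q) V (W c) (snd q)"
  let ?D = "pin_density W (\<lambda>i. \<eta> i + W c i) V q"
  let ?w = "\<lambda>b. sqrt (2 / (pi * (2 * b - \<kappa>))) * exp (h - ((2 * b - \<kappa>) + h\<^sup>2 / (2 * b - \<kappa>)) / 2)"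
  let ?n = "\<lambda>b t. exp (- (t + \<tau>)\<^sup>2 / (2 * (2 * b - \<kappa>))) / sqrt (2 * pi * (2 * b - \<kappa>))"
  let ?f = "\<lambda>z. ennreal (pin_density W \<eta> (c # V) (upd_pair c q z))"
  have h: "0 < h" unfolding h_def by (rule pinning_pos[OF assms(1-3) True])
  have "(\<lambda>z. pin_density W \<eta> (c # V) (upd_pair c q z)) \<in> borel_measurable lborel"
    using measurable_compose[OF measurable_upd_pair_section[OF q, of c]] measurable_pin_density[of W \<eta> "c # V"] by simp
  then have m: "(\<lambda>z. ?f z) \<in> borel_measurable (lborel \<Otimes>\<^sub>M lborel)"
    by (simp add: lborel_prod)
  have "(\<integral>\<^sup>+z. ?f z \<partial>lborel)
    = (\<integral>\<^sup>+b. \<integral>\<^sup>+t. ?f (b, t) \<partial>lborel \<partial>lborel)"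
    using lborel.nn_integral_fst[OF m] by (simp add: lborel_prod)
  also have "\<dots> = (\<integral>\<^sup>+b. ennreal ?D * (ennreal (?w b) * indicator {b. \<kappa> < 2 * b} b) \<partial>lborel)"
  proof (rule nn_integral_cong)
    fix b
    show "(\<integral>\<^sup>+t. ?f (b, t) \<partial>lborel)
      = ennreal ?D * (ennreal (?w b) * indicator {b. \<kappa> < 2 * b} b)"
    proof (cases "\<kappa> < 2 * b")
      case True
      have "?f (b, t) = ennreal (?D * ?w b) * ennreal (?n b t)" for t
      proof -
        have "pin_density W \<eta> (c # V) (upd_pair c q (b, t)) = ?D * ?w b * ?n b t"
          using pin_density_insert[OF assms(1,2) refl refl refl, of \<eta> q "(b, t)"] True
            pivot_weight[of "2 * b - \<kappa>" h "t + \<tau>"] by (simp add: h_def \<kappa>_def \<tau>_def)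
        moreover have "0 \<le> ?D * ?w b" "0 \<le> ?n b t" using True by (auto simp: pin_density_nonneg)
        ultimately show ?thesis by (simp only: ennreal_mult)
      qed
      then have "(\<integral>\<^sup>+t. ?f (b, t) \<partial>lborel)
        = ennreal (?D * ?w b) * (\<integral>\<^sup>+t. ennreal (?n b t) \<partial>lborel)"
        by (simp add: nn_integral_cmult)
      also have "\<dots> = ennreal (?D * ?w b)"
        using nn_integral_gaussian[of "2 * b - \<kappa>" \<tau>] True by simp
      also have "\<dots> = ennreal ?D * ennreal (?w b)"
        by (rule ennreal_mult) (use True in \<open>auto simp: pin_density_nonneg\<close>)
      finally show ?thesis using True by simp
    next
      case False
      then show ?thesis
        using pin_density_insert[OF assms(1,2) refl refl refl, of \<eta> q] by (simp add: \<kappa>_def)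
    qed
  qed
  also have "\<dots> = ennreal ?D * (\<integral>\<^sup>+b. ennreal (?w b) * indicator {b. \<kappa> < 2 * b} b \<partial>lborel)"
    by (rule nn_integral_cmult) measurable
  also have "(\<integral>\<^sup>+b. ennreal (?w b) * indicator {b. \<kappa> < 2 * b} b \<partial>lborel) = 1"
    by (rule nn_integral_reciprocal_inverse_gaussian[OF h])
  finally show ?thesis by simp
qed

text \<open>Removing all vertices one by one shows that the density is normalized.\<close>

lemma nn_integral_pin_density:
  assumes "distinct V" "conductances W (set V)" "linked W \<eta> (set V)"
  shows "(\<integral>\<^sup>+q. ennreal (pin_density W \<eta> V q) \<partial>lborel_pairs (set V)) = 1"
  using assms
proof (induction V arbitrary: \<eta>)
  case Nil
  interpret E: prob_space "Pi\<^sub>M {} (\<lambda>_::'a. lborel :: real measure)"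
    by standard (simp add: PiM_empty)
  interpret EE: pair_prob_space "Pi\<^sub>M {} (\<lambda>_::'a. lborel :: real measure)" "Pi\<^sub>M {} (\<lambda>_::'a. lborel :: real measure)" ..
  show ?case using EE.P.emeasure_space_1 by (simp add: pin_density_def)
next
  case (Cons c V)
  have c: "c \<notin> set V" and V: "distinct V" "conductances W (set V)"
    using Cons.prems conductances_subset[OF Cons.prems(2), of "set V"] by auto
  have "linked W (\<lambda>i. \<eta> i + W c i) (set V)" using linked_remove[OF Cons.prems(3,2) _ c, of 1] by simp
  note IH = Cons.IH[OF V this]
  have "(\<lambda>q. ennreal (pin_density W \<eta> (c # V) q)) \<in> borel_measurable (lborel_pairs (insert c (set V)))"
    using measurable_pin_density[of W \<eta> "c # V"] by simp
  from nn_integral_lborel_pairs_insert[OF _ c this]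
  have "(\<integral>\<^sup>+q. ennreal (pin_density W \<eta> (c # V) q) \<partial>lborel_pairs (set (c # V)))
    = (\<integral>\<^sup>+q. \<integral>\<^sup>+z. ennreal (pin_density W \<eta> (c # V) (upd_pair c q z)) \<partial>lborel \<partial>lborel_pairs (set V))"
    by simp
  also have "\<dots> = (\<integral>\<^sup>+q. ennreal (pin_density W (\<lambda>i. \<eta> i + W c i) V q) \<partial>lborel_pairs (set V))"
    by (intro nn_integral_cong nn_integral_pin_density_insert[OF Cons.prems])
  finally show ?case by (simp only: IH)
qed

lemma integrable_pin_density:
  assumes "distinct V" "conductances W (set V)" "linked W \<eta> (set V)"
  shows "integrable (lborel_pairs (set V)) (pin_density W \<eta> V)"
  using nn_integral_pin_density[OF assms]
  by (intro integrableI_nonneg) (auto simp: pin_density_nonneg measurable_pin_density)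

lemma norm_density_observable:
  assumes "conductances W (set V)" "linked W \<eta> (set V)" "\<And>i. i \<in> set V \<Longrightarrow> \<alpha> i \<le> 0" "a \<le> 0"
  shows "norm (of_real (pin_density W \<eta> V q) * exp_observable W \<eta> \<alpha> a V q) \<le> pin_density W \<eta> V q"
proof (cases "pos_pivots W (fst q) V")
  case True
  have "norm (exp_observable W \<eta> \<alpha> a V q) \<le> 1" by (rule exp_observable_bound[OF True assms])
  then show ?thesis
    using mult_left_mono[of "norm (exp_observable W \<eta> \<alpha> a V q)" 1 "pin_density W \<eta> V q"] pin_density_nonneg[of W \<eta> V q]
    by (simp add: norm_mult)
qed (simp add: pin_density_def)

lemma integrable_density_observable:
  assumes "distinct V" "conductances W (set V)" "linked W \<eta> (set V)" "\<And>i. i \<in> set V \<Longrightarrow> \<alpha> i \<le> 0" "a \<le> 0"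
    and [measurable]: "\<phi> \<in> borel_measurable (lborel_pairs (set V))" and \<phi>: "\<And>q. norm (\<phi> q) \<le> 1"
  shows "integrable (lborel_pairs (set V)) (\<lambda>q. of_real (pin_density W \<eta> V q) * exp_observable W \<eta> \<alpha> a V q * \<phi> q)"
proof (rule Bochner_Integration.integrable_bound[OF integrable_pin_density[OF assms(1-3)]])
  have [measurable]: "pin_density W \<eta> V \<in> borel_measurable (lborel_pairs (set V))"
    "exp_observable W \<eta> \<alpha> a V \<in> borel_measurable (lborel_pairs (set V))"
    by (rule measurable_pin_density measurable_exp_observable)+
  show "(\<lambda>q. of_real (pin_density W \<eta> V q) * exp_observable W \<eta> \<alpha> a V q * \<phi> q) \<in> borel_measurable (lborel_pairs (set V))"
    by measurable
  have "norm (of_real (pin_density W \<eta> V q) * exp_observable W \<eta> \<alpha> a V q * \<phi> q) \<le> norm (pin_density W \<eta> V q)" for q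
    using mult_mono[OF norm_density_observable[OF assms(2-5)] \<phi>] pin_density_nonneg[of W \<eta> V q]
    by (simp add: norm_mult)
  then show "AE q in lborel_pairs (set V). norm (of_real (pin_density W \<eta> V q) * exp_observable W \<eta> \<alpha> a V q * \<phi> q)
     \<le> norm (pin_density W \<eta> V q)" by simp
qed

text \<open>Integrating out one vertex from density times observable. The Gaussian integral in \<open>t\<close> yields
\<open>e\<^sup>-\<^sup>l\<^sup>2\<^sup>/\<^sup>2\<^sup>p\<close>, which together with the factor \<open>e\<^sup>-\<^sup>l\<^sup>+\<^sup>l\<^sup>h\<^sup>/\<^sup>p\<close> of
the observable completes the square \<open>(h - l)\<^sup>2\<close>: the weight in \<open>p\<close> with coefficient
\<open>h\<close> becomes the one with coefficient \<open>h - l\<close>. As \<open>h > 0\<close> and \<open>l \<le> 0\<close>, this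
coefficient is positive and the integral is again one.\<close>

lemma integral_vertex:
  assumes "distinct (c # V)" "conductances W (set (c # V))" "linked W \<eta> (set (c # V))"
    and \<alpha>: "\<And>i. i \<in> set (c # V) \<Longrightarrow> \<alpha> i \<le> 0" "a \<le> 0"
    and q: "q \<in> space (lborel_pairs (set V))"
  shows "(\<integral>z. of_real (pin_density W \<eta> (c # V) (upd_pair c q z)) * exp_observable W \<eta> \<alpha> a (c # V) (upd_pair c q z) \<partial>lborel)
    = of_real (pin_density W (\<lambda>i. \<eta> i + W c i) V q) * exp_observable W (\<lambda>i. \<eta> i + W c i) \<alpha> (a + \<alpha> c) V q"
proof (cases "pos_pivots W (fst q) V")
  case False
  have "pin_density W \<eta> (c # V) (upd_pair c q z) = 0" for z
    using pin_density_insert[OF assms(1,2) refl refl refl, of \<eta> q z] False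
    by (auto simp: pin_density_def)
  then show ?thesis using False by (simp add: pin_density_def)
next
  case True
  define \<kappa> where "\<kappa> = green W (fst q) V (W c) (W c)"
  define h where "h = \<eta> c + green W (fst q) V (W c) \<eta>"
  define \<tau> where "\<tau> = green W (fst q) V (W c) (snd q)"
  define l where "l = \<alpha> c + green W (fst q) V (W c) \<alpha>"
  let ?F = "\<lambda>z. of_real (pin_density W \<eta> (c # V) (upd_pair c q z)) * exp_observable W \<eta> \<alpha> a (c # V) (upd_pair c q z)"
  let ?D = "of_real (pin_density W (\<lambda>i. \<eta> i + W c i) V q) * exp_observable W (\<lambda>i. \<eta> i + W c i) \<alpha> (a + \<alpha> c) V q"
  let ?w = "\<lambda>b. sqrt (2 / (pi * (2 * b - \<kappa>))) * exp ((h - l) - ((2 * b - \<kappa>) + (h - l)\<^sup>2 / (2 * b - \<kappa>)) / 2)"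
  let ?v = "\<lambda>b. sqrt (2 / (pi * (2 * b - \<kappa>))) * exp (h - ((2 * b - \<kappa>) + h\<^sup>2 / (2 * b - \<kappa>)) / 2) * exp (- l + l * h / (2 * b - \<kappa>))"
  let ?n = "\<lambda>b t. complex_of_real (exp (- (t + \<tau>)\<^sup>2 / (2 * (2 * b - \<kappa>))) / sqrt (2 * pi * (2 * b - \<kappa>)))
     * exp (\<i> * of_real (l * (t + \<tau>) / (2 * b - \<kappa>)))"
  have h: "0 < h" unfolding h_def by (rule pinning_pos[OF assms(1-3) True])
  have "0 \<le> green W (fst q) V (W c) (\<lambda>i. (-1) * \<alpha> i)"
    using True \<alpha> conductancesD(3)[OF assms(2)] by (intro green_nonneg) auto
  then have "green W (fst q) V (W c) \<alpha> \<le> 0" by (simp only: green_scale)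
  then have l: "l \<le> 0" using \<alpha>(1)[of c] by (simp add: l_def)
  have sec: "(\<lambda>z. upd_pair c q z) \<in> lborel \<rightarrow>\<^sub>M lborel_pairs (set (c # V))"
    using measurable_upd_pair_section[OF q, of c] by simp
  have dm: "(\<lambda>z. pin_density W \<eta> (c # V) (upd_pair c q z)) \<in> borel_measurable lborel"
    by (rule measurable_compose[OF sec measurable_pin_density])
  have em: "(\<lambda>z. exp_observable W \<eta> \<alpha> a (c # V) (upd_pair c q z)) \<in> borel_measurable lborel"
    by (rule measurable_compose[OF sec measurable_exp_observable])
  have Fm: "?F \<in> borel_measurable lborel"
    by (rule borel_measurable_times[OF measurable_compose[OF dm] em]) simp
  have di: "integrable lborel (\<lambda>z. pin_density W \<eta> (c # V) (upd_pair c q z))"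
    using nn_integral_pin_density_insert[OF assms(1-3) q] dm
    by (intro integrableI_nonneg) (auto simp: pin_density_nonneg)
  have Fi: "integrable (lborel \<Otimes>\<^sub>M lborel) ?F"
    unfolding lborel_prod using norm_density_observable[OF assms(2,3) \<alpha>] pin_density_nonneg[of W \<eta> "c # V"]
    by (intro Bochner_Integration.integrable_bound[OF di Fm]) auto
  have "(\<integral>z. ?F z \<partial>lborel) = (\<integral>b. \<integral>t. ?F (b, t) \<partial>lborel \<partial>lborel)"
    using lborel_pair.integral_fst'[OF Fi] by (simp add: lborel_prod)
  also have "\<dots> = (\<integral>b. ?D * of_real (?w b * indicator {b. \<kappa> < 2 * b} b) \<partial>lborel)"
  proof (rule Bochner_Integration.integral_cong[OF refl])
    fix b
    show "(\<integral>t. ?F (b, t) \<partial>lborel) = ?D * of_real (?w b * indicator {b. \<kappa> < 2 * b} b)"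
    proof (cases "\<kappa> < 2 * b")
      case p: True
      have "?F (b, t) = ?D * of_real (?v b) * ?n b t" for t
        using pin_density_insert[OF assms(1,2) refl refl refl, of \<eta> q "(b, t)"] p
          exp_observable_insert[OF assms(1,2) refl refl refl refl, of \<eta> \<alpha> a q "(b, t)"]
          pivot_weight[of "2 * b - \<kappa>" h "t + \<tau>"]
        by (simp add: h_def[symmetric] \<kappa>_def[symmetric] \<tau>_def[symmetric] l_def[symmetric] exp_add flip: exp_of_real)
      then have "(\<integral>t. ?F (b, t) \<partial>lborel) = ?D * of_real (?v b) * (\<integral>t. ?n b t \<partial>lborel)"
        by (simp only: integral_mult_right_zero)
      also have "(\<integral>t. ?n b t \<partial>lborel) = of_real (exp (- l\<^sup>2 / (2 * (2 * b - \<kappa>))))"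
        by (rule integral_gaussian_fourier(2)) (use p in simp)
      also have "?D * of_real (?v b) * of_real (exp (- l\<^sup>2 / (2 * (2 * b - \<kappa>)))) = ?D * of_real (?w b)"
      proof -
        have "(h - (r + h\<^sup>2 / r) / 2) + (- l + l * h / r) + (- l\<^sup>2 / (2 * r)) = (h - l) - (r + (h - l)\<^sup>2 / r) / 2" if "0 < r" for r
          using that by (simp add: field_simps power2_eq_square)
        from this[of "2 * b - \<kappa>"] p have "?v b * exp (- l\<^sup>2 / (2 * (2 * b - \<kappa>))) = ?w b"
          by (simp only: mult.assoc exp_add[symmetric])
        then show ?thesis by (simp only: mult.assoc of_real_mult[symmetric])
      qed
      finally show ?thesis using p by simp
    next
      case False
      then show ?thesis
        using pin_density_insert[OF assms(1,2) refl refl refl, of \<eta> q] by (simp add: \<kappa>_def)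
    qed
  qed
  also have "\<dots> = ?D * of_real (\<integral>b. ?w b * indicator {b. \<kappa> < 2 * b} b \<partial>lborel)"
    by (simp only: integral_mult_right_zero integral_complex_of_real)
  also have "(\<integral>b. ?w b * indicator {b. \<kappa> < 2 * b} b \<partial>lborel) = 1"
  proof -
    have "(\<integral>\<^sup>+b. ennreal (?w b * indicator {b. \<kappa> < 2 * b} b) \<partial>lborel)
       = (\<integral>\<^sup>+b. ennreal (?w b) * indicator {b. \<kappa> < 2 * b} b \<partial>lborel)"
      by (intro nn_integral_cong) (auto split: split_indicator)
    also have "\<dots> = 1" by (rule nn_integral_reciprocal_inverse_gaussian) (use h l in simp)
    finally show ?thesis
      by (subst integral_eq_nn_integral) (auto split: split_indicator)
  qed
  finally show ?thesis by simp
qed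

definition restrict_pair :: "'a set \<Rightarrow> ('a \<Rightarrow> real) \<times> ('a \<Rightarrow> real) \<Rightarrow> ('a \<Rightarrow> real) \<times> ('a \<Rightarrow> real)" where
  "restrict_pair A q = (restrict (fst q) A, restrict (snd q) A)"

lemma measurable_restrict_pair:
  assumes "A \<subseteq> V"
  shows "restrict_pair A \<in> lborel_pairs V \<rightarrow>\<^sub>M lborel_pairs A"
proof -
  have "(\<lambda>q. restrict (fst q) A) \<in> lborel_pairs V \<rightarrow>\<^sub>M Pi\<^sub>M A (\<lambda>_. lborel)"
    "(\<lambda>q. restrict (snd q) A) \<in> lborel_pairs V \<rightarrow>\<^sub>M Pi\<^sub>M A (\<lambda>_. lborel)"
    by (rule measurable_restrict, use assms measurable_coordinates[OF measurable_ident_sets[OF refl]] in auto)+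
  then show ?thesis unfolding restrict_pair_def[abs_def] by (rule measurable_Pair)
qed

lemma restrict_pair_space: "q \<in> space (lborel_pairs A) \<Longrightarrow> restrict_pair A q = q"
  by (auto simp: restrict_pair_def space_pair_measure space_PiM prod_eq_iff)

text \<open>Iteration over a set of vertices: they are merged into the pinning vertex, which collects their weights
and their parameters.\<close>

theorem integral_marginal:
  assumes "distinct (C @ A)" "conductances W (set (C @ A))" "linked W \<eta> (set (C @ A))"
    and "\<And>i. i \<in> set (C @ A) \<Longrightarrow> \<alpha> i \<le> 0" "a \<le> 0"
    and \<phi>: "\<phi> \<in> borel_measurable (lborel_pairs (set A))" "\<And>q. norm (\<phi> q) \<le> 1"
  shows "(\<integral>q. of_real (pin_density W \<eta> (C @ A) q) * exp_observable W \<eta> \<alpha> a (C @ A) q * \<phi> (restrict_pair (set A) q)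
        \<partial>lborel_pairs (set (C @ A)))
    = (\<integral>q. of_real (pin_density W (\<lambda>i. \<eta> i + (\<Sum>c\<in>set C. W c i)) A q)
        * exp_observable W (\<lambda>i. \<eta> i + (\<Sum>c\<in>set C. W c i)) \<alpha> (a + (\<Sum>c\<in>set C. \<alpha> c)) A q * \<phi> q
        \<partial>lborel_pairs (set A))"
  using assms(1-5)
proof (induction C arbitrary: \<eta> a)
  case Nil
  then show ?case by (auto simp: restrict_pair_space intro!: Bochner_Integration.integral_cong)
next
  case (Cons c C)
  let ?V = "C @ A"
  have c: "c \<notin> set ?V" "c \<notin> set C" using Cons.prems(1) by auto
  have V: "distinct (c # ?V)" "conductances W (set (c # ?V))" "linked W \<eta> (set (c # ?V))"
    "\<And>i. i \<in> set (c # ?V) \<Longrightarrow> \<alpha> i \<le> 0"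
    using Cons.prems(1-4) by auto
  let ?ph = "\<lambda>q. \<phi> (restrict_pair (set A) q)"
  let ?\<eta> = "\<lambda>i. \<eta> i + W c i"
  have IH: "(\<integral>q. of_real (pin_density W ?\<eta> ?V q) * exp_observable W ?\<eta> \<alpha> (a + \<alpha> c) ?V q * ?ph q \<partial>lborel_pairs (set ?V))
    = (\<integral>q. of_real (pin_density W (\<lambda>i. ?\<eta> i + (\<Sum>c\<in>set C. W c i)) A q)
        * exp_observable W (\<lambda>i. ?\<eta> i + (\<Sum>c\<in>set C. W c i)) \<alpha> (a + \<alpha> c + (\<Sum>c\<in>set C. \<alpha> c)) A q * \<phi> q
        \<partial>lborel_pairs (set A))"
  proof (rule Cons.IH)
    show "distinct ?V" using V(1) by simp
    show "conductances W (set ?V)" using conductances_subset[OF V(2), of "set ?V"] by auto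
    show "linked W ?\<eta> (set ?V)" using linked_remove[OF V(3,2) _ c(1), of 1] by simp
    show "\<alpha> i \<le> 0" if "i \<in> set ?V" for i using V(4) that by simp
    show "a + \<alpha> c \<le> 0" using V(4)[of c] Cons.prems(5) by simp
  qed
  let ?F = "\<lambda>q. of_real (pin_density W \<eta> (c # ?V) q) * exp_observable W \<eta> \<alpha> a (c # ?V) q * ?ph q"
  have "restrict_pair (set A) \<in> lborel_pairs (set (c # ?V)) \<rightarrow>\<^sub>M lborel_pairs (set A)"
    by (rule measurable_restrict_pair) auto
  from measurable_compose[OF this \<phi>(1)]
  have "integrable (lborel_pairs (set (c # ?V))) ?F"
    by (intro integrable_density_observable[OF V(1-3)] V(4) Cons.prems(5) \<phi>(2))
  then have Fi: "integrable (lborel_pairs (insert c (set ?V))) ?F" by simp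
  have "(\<integral>q. ?F q \<partial>lborel_pairs (set (c # ?V))) = (\<integral>q. \<integral>z. ?F (upd_pair c q z) \<partial>lborel \<partial>lborel_pairs (set ?V))"
    using integral_lborel_pairs_insert[OF _ c(1) Fi] by simp
  also have "\<dots> = (\<integral>q. of_real (pin_density W ?\<eta> ?V q) * exp_observable W ?\<eta> \<alpha> (a + \<alpha> c) ?V q * ?ph q \<partial>lborel_pairs (set ?V))"
  proof (rule Bochner_Integration.integral_cong[OF refl])
    fix q assume q: "q \<in> space (lborel_pairs (set ?V))"
    have "restrict_pair (set A) (upd_pair c q z) = restrict_pair (set A) q" for z
      using c by (auto simp: restrict_pair_def upd_pair_def restrict_def fun_eq_iff)
    then have "(\<integral>z. ?F (upd_pair c q z) \<partial>lborel) = (\<integral>z. of_real (pin_density W \<eta> (c # ?V) (upd_pair c q z)) * exp_observable W \<eta> \<alpha> a (c # ?V) (upd_pair c q z) \<partial>lborel) * ?ph q"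
      by (simp only: integral_mult_left_zero)
    then show "(\<integral>z. ?F (upd_pair c q z) \<partial>lborel) = of_real (pin_density W ?\<eta> ?V q) * exp_observable W ?\<eta> \<alpha> (a + \<alpha> c) ?V q * ?ph q"
      using integral_vertex[OF V Cons.prems(5) q] by simp
  qed
  finally show ?case using IH c(2) by (simp add: add.assoc)
qed

section \<open>Determinants and inverse matrices\<close>

lemma det_on_fun_upd:
  assumes "finite V" "c \<in> V"
  shows "det_on V (A(c := r)) = (\<Sum>p | p permutes V. of_int (sign p) * (r (p c) * (\<Prod>i\<in>V - {c}. A i (p i))))"
  unfolding det_on_def
proof (intro sum.cong refl arg_cong2[where f = "(*)"])
  fix p
  show "(\<Prod>i\<in>V. (A(c := r)) i (p i)) = r (p c) * (\<Prod>i\<in>V - {c}. A i (p i))"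
    using assms by (simp add: prod.remove)
qed

text \<open>Composition with the transposition of the two rows changes the sign of every term and permutes the
terms of the sum.\<close>

lemma det_on_identical_rows:
  assumes V: "finite V" "i \<in> V" "j \<in> V" "i \<noteq> j" and eq: "\<And>k. k \<in> V \<Longrightarrow> A i k = A j k"
  shows "det_on V A = 0"
proof -
  let ?t = "Transposition.transpose i j"
  have t: "?t permutes V" using V by (simp add: permutes_swap_id)
  have "det_on V A = (\<Sum>p | p permutes V. of_int (sign (p \<circ> ?t)) * (\<Prod>k\<in>V. A k ((p \<circ> ?t) k)))"
    unfolding det_on_def by (rule sum_permutations_compose_right[OF t])
  also have "\<dots> = (\<Sum>p | p permutes V. - (of_int (sign p) * (\<Prod>k\<in>V. A k (p k))))"
  proof (rule sum.cong[OF refl])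
    fix p assume "p \<in> {p. p permutes V}"
    then have p: "p permutes V" by simp
    have s: "sign (p \<circ> ?t) = - sign p"
      using p t V permutation_permutes[of p] permutation_permutes[of ?t]
      by (auto simp: sign_compose sign_swap_id)
    have "(\<Prod>k\<in>V. A k ((p \<circ> ?t) k)) = (\<Prod>k\<in>V. A (?t k) (p k))"
      using prod.permute[OF t, of "\<lambda>k. A k (p (?t k))"] by (simp add: o_def)
    also have "\<dots> = (\<Prod>k\<in>V. A k (p k))"
      using eq permutes_in_image[OF p] by (intro prod.cong) (auto simp: Transposition.transpose_def)
    finally show "of_int (sign (p \<circ> ?t)) * (\<Prod>k\<in>V. A k ((p \<circ> ?t) k)) = - (of_int (sign p) * (\<Prod>k\<in>V. A k (p k)))"
      by (simp add: s)
  qed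
  also have "\<dots> = - det_on V A" by (simp add: det_on_def sum_negf)
  finally show ?thesis by simp
qed

text \<open>Adding a multiple of another row adds a determinant with two identical rows, which is zero. Once the row
\<open>c\<close> is cleared outside its diagonal entry, only permutations that fix \<open>c\<close> contribute.\<close>

lemma det_on_schur:
  assumes V: "finite V" "c \<notin> V" and h: "\<And>j. j \<in> V \<Longrightarrow> A c j + (\<Sum>k\<in>V. h k * A k j) = 0"
  shows "det_on (insert c V) A = (A c c + (\<Sum>k\<in>V. h k * A k c)) * det_on V A"
proof -
  let ?U = "insert c V" let ?r = "\<lambda>j. A c j + (\<Sum>k\<in>V. h k * A k j)"
  have U: "finite ?U" "c \<in> ?U" using V by auto
  note upd = det_on_fun_upd[OF U]
  have "det_on ?U (A(c := ?r)) = det_on ?U (A(c := A c)) + (\<Sum>k\<in>V. h k * det_on ?U (A(c := A k)))"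
    unfolding upd sum_distrib_left
    by (subst sum.swap) (simp add: sum.distrib[symmetric] sum_distrib_left sum_distrib_right algebra_simps)
  also have "(\<Sum>k\<in>V. h k * det_on ?U (A(c := A k))) = 0"
  proof (intro sum.neutral ballI)
    fix k assume "k \<in> V"
    then have "det_on ?U (A(c := A k)) = 0"
      using V by (intro det_on_identical_rows[of _ c k]) auto
    then show "h k * det_on ?U (A(c := A k)) = 0" by simp
  qed
  finally have 1: "det_on ?U A = det_on ?U (A(c := ?r))" by (simp only: fun_upd_triv add_0_right)
  have "det_on ?U (A(c := ?r)) = (\<Sum>p | p permutes V. of_int (sign p) * (?r (p c) * (\<Prod>i\<in>?U - {c}. A i (p i))))"
    unfolding upd
  proof (rule sum.mono_neutral_right)
    show "finite {p. p permutes ?U}" using U by (simp add: finite_permutations)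
    show "{p. p permutes V} \<subseteq> {p. p permutes ?U}" by (auto intro: permutes_subset)
    show "\<forall>p\<in>{p. p permutes ?U} - {p. p permutes V}. of_int (sign p) * (?r (p c) * (\<Prod>i\<in>?U - {c}. A i (p i))) = 0"
    proof
      fix p assume p: "p \<in> {p. p permutes ?U} - {p. p permutes V}"
      have "p c \<noteq> c"
      proof
        assume "p c = c"
        then have "\<And>x. x \<in> ?U - V \<Longrightarrow> p x = x" by blast
        moreover have "p permutes ?U" using p by blast
        ultimately have "p permutes V" by (rule permutes_superset[rotated])
        with p show False by blast
      qed
      then have "p c \<in> V" using p permutes_in_image[of p ?U c] by blast
      then show "of_int (sign p) * (?r (p c) * (\<Prod>i\<in>?U - {c}. A i (p i))) = 0" by (simp add: h)
    qed
  qed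
  also have "\<dots> = ?r c * det_on V A"
    unfolding det_on_def sum_distrib_left
  proof (rule sum.cong[OF refl])
    fix p assume "p \<in> {p. p permutes V}"
    then have "p c = c" using V by (simp add: permutes_not_in)
    moreover have "?U - {c} = V" using V by auto
    ultimately show "of_int (sign p) * (?r (p c) * (\<Prod>i\<in>?U - {c}. A i (p i))) = ?r c * (of_int (sign p) * (\<Prod>i\<in>V. A i (p i)))"
      by simp
  qed
  finally show ?thesis using 1 by simp
qed

lemma det_on_cong: "(\<And>i j. i \<in> V \<Longrightarrow> j \<in> V \<Longrightarrow> A i j = B i j) \<Longrightarrow> det_on V A = det_on V B"
  unfolding det_on_def by (intro sum.cong refl arg_cong2[where f = "(*)"] prod.cong) (auto simp: permutes_in_image)

lemma det_on_conjugate_diagonal: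
  "det_on V (\<lambda>i j. d i * A i j * d j) = (\<Prod>i\<in>V. d i)\<^sup>2 * det_on V A"
  unfolding det_on_def sum_distrib_left
proof (rule sum.cong[OF refl])
  fix p assume "p \<in> {p. p permutes V}"
  then have "(\<Prod>i\<in>V. d (p i)) = (\<Prod>i\<in>V. d i)" using prod.permute[of p V d] by (simp add: o_def)
  then show "of_int (sign p) * (\<Prod>i\<in>V. d i * A i (p i) * d (p i)) = (\<Prod>i\<in>V. d i)\<^sup>2 * (of_int (sign p) * (\<Prod>i\<in>V. A i (p i)))"
    by (simp add: prod.distrib power2_eq_square)
qed

definition schrod_mat :: "('a \<Rightarrow> 'a \<Rightarrow> real) \<Rightarrow> ('a \<Rightarrow> real) \<Rightarrow> 'a \<Rightarrow> 'a \<Rightarrow> real" where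
  "schrod_mat W b i j = (if i = j then 2 * b i else 0) - W i j"

lemma schrod_eq_mat:
  assumes "finite V" "i \<in> V"
  shows "(\<Sum>j\<in>V. schrod_mat W b i j * x j) = schrod W b V x i"
proof -
  have "(\<Sum>j\<in>V. schrod_mat W b i j * x j) = (\<Sum>j\<in>V. (if i = j then 2 * b i * x j else 0)) - (\<Sum>j\<in>V. W i j * x j)"
    unfolding sum_subtractf[symmetric] by (rule sum.cong) (auto simp: schrod_mat_def left_diff_distrib)
  then show ?thesis using assms by (simp add: schrod_def)
qed

lemma schrod_mat_sym: "conductances W V \<Longrightarrow> i \<in> V \<Longrightarrow> j \<in> V \<Longrightarrow> schrod_mat W b i j = schrod_mat W b j i"
  using conductancesD(2)[of W V i j] by (auto simp: schrod_mat_def)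

text \<open>The row \<open>c\<close> of \<open>H\<close> is cleared by the coefficients \<open>H\<^sup>-\<^sup>1 W\<^sub>c\<close>; the diagonal entry that
remains is the pivot.\<close>

lemma det_on_schrod_mat:
  assumes "distinct V" "conductances W (set V)" "pos_pivots W b V"
  shows "det_on (set V) (schrod_mat W b) = pivot_prod W b V"
  using assms
proof (induction V)
  case Nil
  then show ?case by (simp add: det_on_def sign_id)
next
  case (Cons c V)
  have c: "c \<notin> set V" and V: "distinct V" "conductances W (set V)" "pos_pivots W b V"
    using Cons.prems conductances_subset[OF Cons.prems(2), of "set V"] by auto
  let ?h = "green_vec W b V (W c)"
  have "det_on (insert c (set V)) (schrod_mat W b) = (schrod_mat W b c c + (\<Sum>k\<in>set V. ?h k * schrod_mat W b k c)) * det_on (set V) (schrod_mat W b)"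
  proof (rule det_on_schur)
    fix j assume j: "j \<in> set V"
    have "(\<Sum>k\<in>set V. ?h k * schrod_mat W b k j) = (\<Sum>k\<in>set V. schrod_mat W b j k * ?h k)"
      using schrod_mat_sym[OF V(2) j] by (intro sum.cong) auto
    also have "\<dots> = W c j" using j V by (simp add: schrod_eq_mat schrod_green_vec)
    finally show "schrod_mat W b c j + (\<Sum>k\<in>set V. ?h k * schrod_mat W b k j) = 0"
      using c j by (auto simp: schrod_mat_def)
  qed (use c in auto)
  also have "(\<Sum>k\<in>set V. ?h k * schrod_mat W b k c) = - (\<Sum>k\<in>set V. W c k * ?h k)"
    unfolding sum_negf[symmetric]
  proof (rule sum.cong[OF refl])
    fix k assume k: "k \<in> set V"
    have "W k c = W c k" by (rule conductancesD(2)[OF Cons.prems(2)]) (use k in auto)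
    then show "?h k * schrod_mat W b k c = - (W c k * ?h k)" using c k by (auto simp: schrod_mat_def)
  qed
  also have "(\<Sum>k\<in>set V. W c k * ?h k) = green W b V (W c) (W c)"
    by (rule green_eq_sum_green_vec[OF V, symmetric])
  finally show ?case
    using Cons.IH[OF V] conductancesD(1)[OF Cons.prems(2) list.set_intros(1)]
    by (simp add: schrod_mat_def pivot_def)
qed

text \<open>A two-sided inverse is unique on the carrier, so the choice in the definition agrees there with any
explicit formula for an inverse.\<close>

lemma matrix_inv_on_eq:
  assumes V: "finite V"
    and R: "\<And>i j. i \<in> V \<Longrightarrow> j \<in> V \<Longrightarrow> (\<Sum>k\<in>V. A i k * B k j) = (if i = j then 1 else 0)"
    and L: "\<And>i j. i \<in> V \<Longrightarrow> j \<in> V \<Longrightarrow> (\<Sum>k\<in>V. B i k * A k j) = (if i = j then 1 else 0)"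
    and ij: "i \<in> V" "j \<in> V"
  shows "matrix_inv_on V A i j = B i j"
proof -
  let ?P = "\<lambda>B. \<forall>i\<in>V. \<forall>j\<in>V. (\<Sum>k\<in>V. A i k * B k j) = (if i = j then 1 else 0) \<and>
     (\<Sum>k\<in>V. B i k * A k j) = (if i = j then 1 else 0)"
  define C where "C = matrix_inv_on V A"
  have "\<exists>B. ?P B" using R L by (intro exI[of _ B]) simp
  from someI_ex[OF this] have C: "?P C" unfolding C_def matrix_inv_on_def .
  have "C i j = (\<Sum>k\<in>V. C i k * (if k = j then 1 else 0))" using V ij by (simp add: if_distrib cong: if_cong)
  also have "\<dots> = (\<Sum>k\<in>V. C i k * (\<Sum>l\<in>V. A k l * B l j))" using R ij by (intro sum.cong) auto
  also have "\<dots> = (\<Sum>l\<in>V. (\<Sum>k\<in>V. C i k * A k l) * B l j)"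
    unfolding sum_distrib_left sum_distrib_right by (subst sum.swap) (simp add: mult_ac)
  also have "\<dots> = (\<Sum>l\<in>V. (if i = l then 1 else 0) * B l j)" using C ij by (intro sum.cong) auto
  also have "\<dots> = (\<Sum>l\<in>V. if i = l then B l j else 0)" by (intro sum.cong) auto
  also have "\<dots> = B i j" using V ij by simp
  finally show ?thesis by (simp add: C_def)
qed

text \<open>\<open>A\<close> is \<open>H\<close> conjugated by the diagonal matrix of \<open>e\<^sup>u\<close>. A value \<open>u\<^sub>\<delta> \<noteq> 0\<close>, which can
occur outside the range of \<open>\<beta>\<close>, only rescales the pinning.\<close>

lemma A_mat_eq:
  assumes d: "\<delta> \<notin> V" "finite V" and W: "conductances W V" and ij: "i \<in> V" "j \<in> V"
  shows "A_mat (insert \<delta> V) W u i j = exp (u i) * schrod_mat W (beta_of W (\<lambda>i. W i \<delta> * exp (u \<delta>)) V u) i j * exp (u j)"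
proof (cases "i = j")
  case True
  then show ?thesis
    using d ij conductancesD(1)[OF W ij(1)]
    by (simp add: A_mat_def schrod_mat_def beta_of_def sum_distrib_left sum_distrib_right exp_add exp_diff exp_minus field_simps)
next
  case False
  then show ?thesis by (simp add: A_mat_def schrod_mat_def exp_add)
qed

lemma matrix_inv_on_A_mat:
  assumes d: "\<delta> \<notin> set V" "distinct V" and W: "conductances W (set V)"
    and link: "linked W (\<lambda>i. W i \<delta>) (set V)" and ij: "i \<in> set V" "j \<in> set V"
    and b: "b = beta_of W (\<lambda>i. W i \<delta> * exp (u \<delta>)) (set V) u"
  shows "matrix_inv_on (set V) (A_mat (insert \<delta> (set V)) W u) i j
    = exp (- u i) * green W b V (\<lambda>k. of_bool (k = i)) (\<lambda>k. of_bool (k = j)) * exp (- u j)"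
proof -
  let ?A = "A_mat (insert \<delta> (set V)) W u"
  define B where "B i j = exp (- u i) * green W b V (\<lambda>k. of_bool (k = i)) (\<lambda>k. of_bool (k = j)) * exp (- u j)" for i j
  have "linked W (\<lambda>i. W i \<delta> * exp (u \<delta>)) (set V)"
    using link unfolding linked_def by (simp add: zero_less_mult_iff)
  then have pos: "pos_pivots W b V" unfolding b by (rule pos_pivots_beta_of[OF d(2) W])
  have A: "?A i j = exp (u i) * schrod_mat W b i j * exp (u j)" if "i \<in> set V" "j \<in> set V" for i j
    unfolding b by (rule A_mat_eq[OF d(1) _ W that]) simp
  have R: "(\<Sum>k\<in>set V. ?A i k * B k j) = (if i = j then 1 else 0)" if ij: "i \<in> set V" "j \<in> set V" for i j
  proof -
    have "(\<Sum>k\<in>set V. ?A i k * B k j) = (\<Sum>k\<in>set V. exp (u i) * (schrod_mat W b i k * green_vec W b V (\<lambda>k. of_bool (k = j)) k) * exp (- u j))"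
      using ij by (intro sum.cong) (simp_all add: A B_def green_vec_def exp_minus field_simps)
    also have "\<dots> = exp (u i) * schrod W b (set V) (green_vec W b V (\<lambda>k. of_bool (k = j))) i * exp (- u j)"
      using ij by (simp only: sum_distrib_left[symmetric] sum_distrib_right[symmetric] schrod_eq_mat finite_set)
    also have "\<dots> = (if i = j then 1 else 0)"
      using ij by (simp add: schrod_green_vec[OF d(2) W pos] exp_minus)
    finally show ?thesis .
  qed
  have sym: "?A i j = ?A j i" "B i j = B j i" if "i \<in> set V" "j \<in> set V" for i j
    using that schrod_mat_sym[OF W that] by (simp_all add: A B_def green_commute[of _ _ _ "\<lambda>k. of_bool (k = i)"] mult_ac)
  have L: "(\<Sum>k\<in>set V. B i k * ?A k j) = (if i = j then 1 else 0)" if ij: "i \<in> set V" "j \<in> set V" for i j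
  proof -
    have "(\<Sum>k\<in>set V. B i k * ?A k j) = (\<Sum>k\<in>set V. ?A j k * B k i)"
    proof (rule sum.cong[OF refl])
      fix k assume "k \<in> set V"
      then show "B i k * ?A k j = ?A j k * B k i" using sym(1)[of k j] sym(2)[of i k] ij by simp
    qed
    then show ?thesis using R[OF ij(2,1)] by auto
  qed
  show ?thesis using matrix_inv_on_eq[OF _ R L ij] by (simp add: B_def)
qed

text \<open>\<open>e\<^sup>u s = H\<^sup>-\<^sup>1 \<theta>\<close>, for arbitrary arguments of \<open>g\<close>; the operator \<open>H\<close> here belongs to
\<open>u = f \<beta>\<close> and may differ from \<open>2 \<beta> - W\<close> when \<open>\<beta>\<close> is outside the range.\<close>

lemma g_V_eq:
  assumes d: "\<delta> \<notin> set V" "distinct V" and W: "conductances W (set V)"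
    and link: "linked W (\<lambda>i. W i \<delta>) (set V)" and i: "i \<in> set V"
    and b: "b = beta_of W (\<lambda>i. W i \<delta> * exp (f \<beta> \<delta>)) (set V) (f \<beta>)"
  shows "exp (f \<beta> i) * g_V (insert \<delta> (set V)) W \<delta> f \<beta> \<theta> i = green_vec W b V \<theta> i"
proof -
  have "linked W (\<lambda>i. W i \<delta> * exp (f \<beta> \<delta>)) (set V)"
    using link unfolding linked_def by (simp add: zero_less_mult_iff)
  then have pos: "pos_pivots W b V" unfolding b by (rule pos_pivots_beta_of[OF d(2) W])
  have V: "insert \<delta> (set V) - {\<delta>} = set V" using d by auto
  have "g_V (insert \<delta> (set V)) W \<delta> f \<beta> \<theta> i =
    (\<Sum>j\<in>set V. matrix_inv_on (set V) (A_mat (insert \<delta> (set V)) W (f \<beta>)) i j * (exp (f \<beta> j) * \<theta> j))"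
    using i d by (auto simp: g_V_def V)
  also have "\<dots> = (\<Sum>j\<in>set V. exp (- f \<beta> i) * (\<theta> j * green_vec W b V (\<lambda>k. of_bool (k = i)) j))"
  proof (rule sum.cong[OF refl])
    fix j assume j: "j \<in> set V"
    show "matrix_inv_on (set V) (A_mat (insert \<delta> (set V)) W (f \<beta>)) i j * (exp (f \<beta> j) * \<theta> j)
      = exp (- f \<beta> i) * (\<theta> j * green_vec W b V (\<lambda>k. of_bool (k = i)) j)"
      unfolding matrix_inv_on_A_mat[OF d W link i j b] green_vec_def
      by (simp add: green_commute[of _ _ _ "\<lambda>k. of_bool (k = i)"] exp_minus field_simps)
  qed
  also have "\<dots> = exp (- f \<beta> i) * green W b V \<theta> (\<lambda>k. of_bool (k = i))"
    unfolding green_eq_sum_green_vec[OF d(2) W pos] by (simp add: sum_distrib_left)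
  finally show ?thesis
    by (simp add: green_vec_def green_commute[of _ _ _ \<theta>] flip: exp_add mult.assoc)
qed

section \<open>The law of the parameters in finite volume\<close>

text \<open>Each edge corresponds to two ordered pairs of vertices.\<close>

lemma sum_edge_val:
  fixes F :: "'a \<Rightarrow> 'a \<Rightarrow> real"
  assumes V: "finite V" and E: "\<And>e. e \<in> E \<Longrightarrow> e \<subseteq> V \<and> card e = 2"
    and sym: "\<And>i j. i \<in> V \<Longrightarrow> j \<in> V \<Longrightarrow> F i j = F j i"
    and off: "\<And>i j. i \<in> V \<Longrightarrow> j \<in> V \<Longrightarrow> {i, j} \<notin> E \<Longrightarrow> F i j = 0"
  shows "(\<Sum>e\<in>E. edge_val F e) = (\<Sum>i\<in>V. \<Sum>j\<in>V. F i j) / 2"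
proof -
  let ?P = "{p \<in> V \<times> V. {fst p, snd p} \<in> E}"
  have finE: "finite E" using E V by (intro finite_subset[of E "Pow V"]) auto
  have "(\<Sum>i\<in>V. \<Sum>j\<in>V. F i j) = (\<Sum>p\<in>V \<times> V. F (fst p) (snd p))"
    by (simp add: sum.cartesian_product case_prod_beta')
  also have "\<dots> = (\<Sum>p\<in>?P. F (fst p) (snd p))"
  proof (rule sum.mono_neutral_right)
    show "\<forall>p\<in>V \<times> V - ?P. F (fst p) (snd p) = 0"
    proof
      fix p assume "p \<in> V \<times> V - ?P"
      then show "F (fst p) (snd p) = 0" by (intro off) auto
    qed
  qed (use V in auto)
  also have "\<dots> = (\<Sum>e\<in>E. \<Sum>p | p \<in> ?P \<and> {fst p, snd p} = e. F (fst p) (snd p))"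
    by (rule sum.group[symmetric]) (use V finE in auto)
  also have "\<dots> = (\<Sum>e\<in>E. 2 * edge_val F e)"
  proof (rule sum.cong[OF refl])
    fix e assume e: "e \<in> E"
    then obtain i j where ij: "e = {i, j}" "i \<noteq> j" using E[of e] by (meson card_2_iff)
    have V2: "i \<in> V" "j \<in> V" using E[OF e] ij by auto
    have "{p. p \<in> ?P \<and> {fst p, snd p} = e} = {(i, j), (j, i)}"
      using ij V2 e by (auto simp: doubleton_eq_iff insert_commute)
    then have "(\<Sum>p | p \<in> ?P \<and> {fst p, snd p} = e. F (fst p) (snd p)) = F i j + F j i"
      using ij by simp
    then show "(\<Sum>p | p \<in> ?P \<and> {fst p, snd p} = e. F (fst p) (snd p)) = 2 * edge_val F e"
      using sym[OF V2] edge_val_doubleton[of F i j] ij by simp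
  qed
  finally show ?thesis by (simp flip: sum_distrib_left)
qed

text \<open>The exponent of \<open>\<mu>\<close> in terms of \<open>\<beta>\<close> and \<open>H\<close>. By symmetry of \<open>W\<close>, the sum of the
\<open>W\<^sub>i\<^sub>j cosh (u\<^sub>i - u\<^sub>j)\<close> is the sum of the \<open>W\<^sub>i\<^sub>j e\<^sup>u\<^sup>j\<^sup>-\<^sup>u\<^sup>i\<close>, which
make up \<open>2 \<beta>\<^sub>i\<close>; and the quadratic form in \<open>s\<close> is \<open>\<langle>x, H x\<rangle>\<close> for \<open>x = e\<^sup>u s\<close>.\<close>

lemma energy_identity:
  fixes u s :: "'a \<Rightarrow> real"
  assumes V: "finite V" "\<delta> \<notin> V" and W: "conductances W (insert \<delta> V)" and 0: "u \<delta> = 0" "s \<delta> = 0"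
    and b: "b = beta_of W (\<lambda>i. W i \<delta>) V u"
  defines "x \<equiv> \<lambda>i. exp (u i) * s i"
  shows "(\<Sum>i\<in>insert \<delta> V. \<Sum>j\<in>insert \<delta> V. W i j * (cosh (u i - u j) - 1 + (s i - s j)\<^sup>2 * exp (u i + u j) / 2))
    = 2 * (\<Sum>i\<in>V. b i) - (\<Sum>i\<in>V. \<Sum>j\<in>V. W i j) + (\<Sum>i\<in>V. W i \<delta> * exp (u i)) - 2 * (\<Sum>i\<in>V. W i \<delta>)
      + (\<Sum>i\<in>V. schrod W b V x i * x i)"
proof -
  let ?F = "\<lambda>i j. W i j * (cosh (u i - u j) - 1 + (s i - s j)\<^sup>2 * exp (u i + u j) / 2)"
  let ?C = "\<Sum>i\<in>V. \<Sum>j\<in>V. W i j * exp (u j - u i)"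
  let ?S = "\<Sum>i\<in>V. \<Sum>j\<in>V. W i j * (exp (u i + u j) * (s i * s i))"
  let ?X = "\<Sum>i\<in>V. \<Sum>j\<in>V. W i j * (exp (u i + u j) * (s i * s j))"
  let ?D = "\<Sum>i\<in>V. \<Sum>j\<in>V. W i j"
  let ?E = "\<Sum>i\<in>V. W i \<delta> * (exp (u i) * (s i * s i))"
  let ?A = "\<Sum>i\<in>V. W i \<delta> * exp (u i)"
  let ?B = "\<Sum>i\<in>V. W i \<delta> * exp (- u i)"
  let ?G = "\<Sum>i\<in>insert \<delta> V. \<Sum>j\<in>insert \<delta> V. ?F i j"
  have Wsym: "W i j = W j i" if "i \<in> V" "j \<in> V" for i j using conductancesD(2)[OF W] that by blast
  have flip: "(\<Sum>i\<in>V. \<Sum>j\<in>V. W i j * f i j) = (\<Sum>i\<in>V. \<Sum>j\<in>V. W i j * f j i)" for f :: "'a \<Rightarrow> 'a \<Rightarrow> real"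
    by (subst sum.swap) (intro sum.cong refl arg_cong2[where f = "(*)"] Wsym)
  have d0: "W \<delta> \<delta> = 0" using conductancesD(1)[OF W] by blast
  have Wd: "W \<delta> i = W i \<delta>" if "i \<in> V" for i using conductancesD(2)[OF W] that by blast
  have F\<delta>: "?F \<delta> i = ?F i \<delta>" if "i \<in> V" for i
    using Wd[OF that] by (simp add: 0 cosh_minus power2_commute[of "s i"])
  have "?G = (\<Sum>i\<in>V. \<Sum>j\<in>V. ?F i j) + 2 * (\<Sum>i\<in>V. ?F i \<delta>)"
  proof -
    have "(\<Sum>j\<in>V. ?F \<delta> j) = (\<Sum>j\<in>V. ?F j \<delta>)" by (rule sum.cong) (use F\<delta> in auto)
    then show ?thesis using V d0 by (simp add: sum.distrib)
  qed
  also have "(\<Sum>i\<in>V. \<Sum>j\<in>V. ?F i j) = ?C - ?D + (?S - ?X)"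
  proof -
    have "?F i j = (W i j * exp (u j - u i)) / 2 + (W i j * exp (u i - u j)) / 2 - W i j
      + (W i j * (exp (u i + u j) * (s i * s i))) / 2 + (W i j * (exp (u j + u i) * (s j * s j))) / 2
      - W i j * (exp (u i + u j) * (s i * s j))" for i j
      by (simp add: cosh_def power2_eq_square field_simps)
    then have "(\<Sum>i\<in>V. \<Sum>j\<in>V. ?F i j) = ?C / 2 + (\<Sum>i\<in>V. \<Sum>j\<in>V. W i j * exp (u i - u j)) / 2 - ?D
      + ?S / 2 + (\<Sum>i\<in>V. \<Sum>j\<in>V. W i j * (exp (u j + u i) * (s j * s j))) / 2 - ?X"
      by (simp only: sum.distrib sum_subtractf sum_divide_distrib)
    moreover have "(\<Sum>i\<in>V. \<Sum>j\<in>V. W i j * exp (u i - u j)) = ?C" by (rule flip)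
    moreover have "(\<Sum>i\<in>V. \<Sum>j\<in>V. W i j * (exp (u j + u i) * (s j * s j))) = ?S" by (rule flip)
    ultimately show ?thesis by simp
  qed
  also have "2 * (\<Sum>i\<in>V. ?F i \<delta>) = ?B + ?A - 2 * (\<Sum>i\<in>V. W i \<delta>)
      + ?E"
    unfolding sum_distrib_left sum.distrib[symmetric] sum_subtractf[symmetric]
    by (rule sum.cong) (simp_all add: 0 cosh_def power2_eq_square field_simps)
  finally have L: "?G = ?C - ?D + (?S - ?X)
    + (?B + ?A - 2 * (\<Sum>i\<in>V. W i \<delta>)
      + ?E)" .
  have B: "2 * (\<Sum>i\<in>V. b i) = ?C + ?B"
    unfolding b sum_distrib_left sum.distrib[symmetric] by (rule sum.cong) (simp_all add: beta_of_def)
  have "schrod W b V x i * x i = (\<Sum>j\<in>V. W i j * (exp (u i + u j) * (s i * s i))) - (\<Sum>j\<in>V. W i j * (exp (u i + u j) * (s i * s j)))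
      + W i \<delta> * (exp (u i) * (s i * s i))" if "i \<in> V" for i
  proof -
    have "2 * b i * x i * x i = (\<Sum>j\<in>V. W i j * (exp (u i + u j) * (s i * s i))) + W i \<delta> * (exp (u i) * (s i * s i))"
      using that by (simp add: b beta_of_def x_def sum_distrib_left sum_distrib_right distrib_left distrib_right exp_diff exp_add exp_minus field_simps)
    then show ?thesis
      by (simp add: schrod_def left_diff_distrib sum_distrib_right) (simp add: x_def exp_add mult_ac)
  qed
  then have "(\<Sum>i\<in>V. schrod W b V x i * x i) = ?S - ?X + ?E"
    by (simp add: sum.distrib sum_subtractf)
  with L B show ?thesis by simp
qed

lemma weighted_graph_conductances:
  assumes "weighted_graph V E W"
  shows "conductances W V"
proof -
  have "{i} \<notin> E" for i using assms by (force simp: weighted_graph_def)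
  then have "W i i = 0" if "i \<in> V" for i
    using assms that unfolding weighted_graph_def by (metis insert_absorb2)
  moreover have "W i j = W j i \<and> 0 \<le> W i j" if "i \<in> V" "j \<in> V" for i j
  proof -
    have "W i j = W j i \<and> (if {i, j} \<in> E then W i j > 0 else W i j = 0)"
      using assms that unfolding weighted_graph_def by blast
    then show ?thesis by (auto split: if_splits)
  qed
  ultimately show ?thesis unfolding conductances_def by blast
qed

text \<open>A path from a vertex of \<open>S\<close> to \<open>\<delta>\<close> has to leave \<open>S\<close>.\<close>

lemma connected_graph_linked:
  assumes g: "weighted_graph (insert \<delta> V) E W" and con: "connected_graph (insert \<delta> V) E" and d: "\<delta> \<notin> V"
  shows "linked W (\<lambda>i. W i \<delta>) V"
  unfolding linked_def
proof (intro conjI ballI allI impI)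
  fix i assume "i \<in> V"
  then show "0 \<le> W i \<delta>" using conductancesD(3)[OF weighted_graph_conductances[OF g], of i \<delta>] by simp
next
  fix S assume S: "S \<subseteq> V" "S \<noteq> {}"
  then obtain i where i: "i \<in> S" by blast
  have "(i, \<delta>) \<in> {(x, y). {x, y} \<in> E}\<^sup>*" using con i S by (auto simp: connected_graph_def)
  then have "\<delta> \<in> S \<or> (\<exists>x y. x \<in> S \<and> y \<notin> S \<and> {x, y} \<in> E)"
  proof (induction rule: rtrancl_induct)
    case base then show ?case using i by blast
  next
    case (step y z) then show ?case by blast
  qed
  then obtain x y where xy: "x \<in> S" "y \<notin> S" "{x, y} \<in> E" using d S by blast
  then have V: "x \<in> insert \<delta> V" "y \<in> insert \<delta> V" using g unfolding weighted_graph_def by blast+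
  then have "0 < W x y" using g xy unfolding weighted_graph_def by (meson if_P)
  then show "\<exists>i\<in>S. 0 < W i \<delta> \<or> (\<exists>j\<in>V - S. 0 < W i j)" using xy V by blast
qed

text \<open>Three identities are combined: \<open>det A = (\<Prod>\<^sub>i e\<^sup>u\<^sup>i)\<^sup>2 det H\<close>, the energy identity, and the
expression of its quadratic forms through \<open>H e\<^sup>u = \<eta>\<close> and \<open>H (e\<^sup>u s) = \<theta>\<close>.\<close>

lemma mu_density_eq:
  assumes d: "\<delta> \<notin> set V" "distinct V" and g: "weighted_graph (insert \<delta> (set V)) E W"
    and link: "linked W (\<lambda>i. W i \<delta>) (set V)"
    and 0: "fst x \<delta> = 0" "snd x \<delta> = 0"
  shows "mu_density (insert \<delta> (set V)) E W \<delta> (fst x) (snd x)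
    = pin_density W (\<lambda>i. W i \<delta>) V (coords W (\<lambda>i. W i \<delta>) (\<lambda>_. 0) (set V) x) * jacobian W (\<lambda>i. W i \<delta>) V (fst x)"
proof -
  let ?u = "fst x" and ?s = "snd x" and ?\<eta> = "\<lambda>i. W i \<delta>"
  define b where "b = beta_of W ?\<eta> (set V) ?u"
  define y where "y = (\<lambda>i. exp (?u i) * ?s i)"
  have Wc: "conductances W (insert \<delta> (set V))" by (rule weighted_graph_conductances[OF g])
  have W: "conductances W (set V)" by (rule conductances_subset[OF Wc]) auto
  have pos: "pos_pivots W b V" unfolding b_def by (rule pos_pivots_beta_of[OF d(2) W link])
  have V: "insert \<delta> (set V) - {\<delta>} = set V" using d by auto
  let ?q = "coords W ?\<eta> (\<lambda>_. 0) (set V) x"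
  have q1: "fst ?q = b" by (simp add: coords_def b_def)
  have q2: "snd ?q i = schrod W b (set V) y i" if "i \<in> set V" for i
    using that by (simp add: coords_def b_def theta_of_def y_def)
  let ?F = "\<lambda>i j. W i j * (cosh (?u i - ?u j) - 1 + (?s i - ?s j)\<^sup>2 * exp (?u i + ?u j) / 2)"
  have Fsym: "?F i j = ?F j i" if "i \<in> insert \<delta> (set V)" "j \<in> insert \<delta> (set V)" for i j
  proof -
    have "cosh (?u i - ?u j) = cosh (?u j - ?u i)" by (metis cosh_minus minus_diff_eq)
    then show ?thesis using conductancesD(2)[OF Wc that] by (simp add: power2_commute[of "?s i"] add.commute)
  qed
  have "(\<Prod>e\<in>E. exp (- edge_val ?F e)) = exp (- (\<Sum>e\<in>E. edge_val ?F e))"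
    using g finite_subset[of E "Pow (insert \<delta> (set V))"]
    by (simp add: exp_sum sum_negf[symmetric] weighted_graph_def subset_iff del: sum_negf)
  also have "(\<Sum>e\<in>E. edge_val ?F e) = (\<Sum>i\<in>insert \<delta> (set V). \<Sum>j\<in>insert \<delta> (set V). ?F i j) / 2"
    by (rule sum_edge_val) (use g Fsym in \<open>auto simp: weighted_graph_def\<close>)
  also have "(\<Sum>i\<in>insert \<delta> (set V). \<Sum>j\<in>insert \<delta> (set V). ?F i j) =
     2 * (\<Sum>i\<in>set V. b i) - (\<Sum>i\<in>set V. \<Sum>j\<in>set V. W i j) + (\<Sum>i\<in>set V. W i \<delta> * exp (?u i)) - 2 * (\<Sum>i\<in>set V. W i \<delta>)
      + (\<Sum>i\<in>set V. schrod W b (set V) y i * y i)"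
    unfolding y_def by (rule energy_identity) (use d Wc 0 b_def in auto)
  also have "(\<Sum>i\<in>set V. W i \<delta> * exp (?u i)) = green W b V ?\<eta> ?\<eta>"
  proof -
    have "green W b V ?\<eta> ?\<eta> = green W b V ?\<eta> (schrod W b (set V) (\<lambda>j. exp (?u j)))"
      by (rule green_cong) (simp_all add: b_def schrod_beta_of)
    then show ?thesis using green_schrod[OF d(2) W pos] by simp
  qed
  also have "(\<Sum>i\<in>set V. schrod W b (set V) y i * y i) = green W b V (snd ?q) (snd ?q)"
  proof -
    have "green W b V (snd ?q) (snd ?q) = green W b V (schrod W b (set V) y) (schrod W b (set V) y)"
      by (rule green_cong) (simp_all add: q2)
    then show ?thesis using green_schrod[OF d(2) W pos] by simp
  qed
  finally have E: "(\<Prod>e\<in>E. exp (- edge_val ?F e)) = exp (- (2 * (\<Sum>i\<in>set V. b i) - (\<Sum>i\<in>set V. \<Sum>j\<in>set V. W i j)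
        + green W b V ?\<eta> ?\<eta> - 2 * (\<Sum>i\<in>set V. W i \<delta>) + green W b V (snd ?q) (snd ?q)) / 2)" (is "_ = ?E")
    by (simp only: minus_divide_left)
  let ?P = "\<Prod>i\<in>set V. exp (?u i)"
  have "det_on (set V) (A_mat (insert \<delta> (set V)) W ?u) = det_on (set V) (\<lambda>i j. exp (?u i) * schrod_mat W b i j * exp (?u j))"
    by (rule det_on_cong) (use A_mat_eq[OF d(1) _ W] 0 in \<open>auto simp: b_def\<close>)
  also have "\<dots> = ?P\<^sup>2 * pivot_prod W b V"
    unfolding det_on_conjugate_diagonal det_on_schrod_mat[OF d(2) W pos] ..
  finally have D: "det_on (set V) (A_mat (insert \<delta> (set V)) W ?u) = ?P\<^sup>2 * pivot_prod W b V" .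
  have P0: "?P \<noteq> 0" by simp
  have R: "(\<Prod>i\<in>set V. exp (- ?u i) / (2 * pi)) = 1 / (?P * 2 ^ length V * pi ^ length V)"
  proof -
    have "(\<Prod>i\<in>set V. exp (- ?u i)) = inverse ?P"
      unfolding prod_inversef[symmetric] by (simp add: exp_minus)
    then show ?thesis
      unfolding prod_dividef using distinct_card[OF d(2)]
      by (simp add: power_mult_distrib divide_inverse)
  qed
  have J: "jacobian W ?\<eta> V ?u = (pivot_prod W b V)\<^sup>2 * (?P / 2 ^ length V)"
    using distinct_card[OF d(2)] by (simp add: jacobian_def b_def prod_dividef)
  have "pivot_prod W b V \<noteq> 0" using pivot_prod_pos[OF pos] by simp
  then have "(?P\<^sup>2 * p) * e * (1 / (?P * m * k)) = e / (k * p) * (p\<^sup>2 * (?P / m))"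
    if "p = pivot_prod W b V" for p e m k :: real
    using P0 that by (simp add: power2_eq_square mult_ac)
  from this[OF refl] show ?thesis
    unfolding mu_density_def V D E R J pin_density_def q1 using pos by (simp only: if_True)
qed

lemma sets_lborel_pairs: "sets (lborel_pairs V) = sets (RV V \<Otimes>\<^sub>M RV V)"
  by (intro sets_pair_measure_cong sets_PiM_cong) auto

lemma coords_restrict_pair: "coords W \<eta> k V (restrict_pair V x) = coords W \<eta> k V x"
proof -
  have 1: "beta_of W \<eta> V (restrict (fst x) V) = beta_of W \<eta> V (fst x)"
    by (rule beta_of_cong) simp
  have "theta_of W b k V (restrict (fst x) V) (restrict (snd x) V) = theta_of W b k V (fst x) (snd x)" for b
    by (auto simp: theta_of_def schrod_def intro!: restrict_ext sum.cong)
  then show ?thesis by (simp add: coords_def restrict_pair_def 1)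
qed

lemma jacobian_restrict_pair: "jacobian W \<eta> V (fst (restrict_pair (set V) x)) = jacobian W \<eta> V (fst x)"
proof -
  have "beta_of W \<eta> (set V) (restrict (fst x) (set V)) = beta_of W \<eta> (set V) (fst x)"
    by (rule beta_of_cong) simp
  then show ?thesis by (simp add: jacobian_def restrict_pair_def)
qed

lemma beta_theta_eq_coords:
  assumes "\<delta> \<notin> V" "finite V" "u \<delta> = 0" "s \<delta> = 0" "conductances W V"
  shows "(beta_V (insert \<delta> V) W \<delta> u, theta_V (insert \<delta> V) W \<delta> u s) = coords W (\<lambda>i. W i \<delta>) (\<lambda>_. 0) V (u, s)"
proof -
  have V: "insert \<delta> V - {\<delta>} = V" using assms by auto
  have b: "beta_V (insert \<delta> V) W \<delta> u = beta_of W (\<lambda>i. W i \<delta>) V u"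
    using assms by (auto simp: beta_V_def beta_of_def V intro!: restrict_ext)
  have "theta_V (insert \<delta> V) W \<delta> u s = theta_of W (beta_of W (\<lambda>i. W i \<delta>) V u) (\<lambda>_. 0) V u s"
    unfolding theta_V_def theta_of_def V
  proof (rule restrict_ext)
    fix i assume i: "i \<in> V"
    have "2 * beta_of W (\<lambda>i. W i \<delta>) V u i * (exp (u i) * s i) = (\<Sum>j\<in>V. W i j * exp (u j) * s i) + W i \<delta> * s i"
      using i by (simp add: beta_of_def sum_distrib_left sum_distrib_right distrib_left distrib_right exp_diff exp_minus field_simps)
    then show "(\<Sum>j\<in>insert \<delta> V. W i j * exp (u j) * (s i - s j)) =
        schrod W (beta_of W (\<lambda>i. W i \<delta>) V u) V (\<lambda>j. exp (u j) * s j) i - 0"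
      using assms by (simp add: schrod_def right_diff_distrib sum_subtractf mult.assoc)
  qed
  then show ?thesis by (simp add: coords_def b)
qed

text \<open>The law of \<open>(\<beta>, \<theta>)\<close>: since the density of \<open>\<mu>\<close> is the Jacobian times a function of the
parameters, the change of variables applies.\<close>

lemma distr_mu_coords:
  assumes d: "\<delta> \<notin> set V" "distinct V" and g: "weighted_graph (insert \<delta> (set V)) E W"
    and link: "linked W (\<lambda>i. W i \<delta>) (set V)"
  defines "T \<equiv> \<lambda>(u, s). (beta_V (insert \<delta> (set V)) W \<delta> u, theta_V (insert \<delta> (set V)) W \<delta> u s)"
  shows "T \<in> mu (insert \<delta> (set V)) E W \<delta> \<rightarrow>\<^sub>M RV (set V) \<Otimes>\<^sub>M RV (set V)" (is ?M)
    and "distr (mu (insert \<delta> (set V)) E W \<delta>) (RV (set V) \<Otimes>\<^sub>M RV (set V)) T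
      = density (lborel_pairs (set V)) (\<lambda>q. ennreal (pin_density W (\<lambda>i. W i \<delta>) V q))" (is ?D)
    and "space (mu (insert \<delta> (set V)) E W \<delta>) \<subseteq> Omega_V (insert \<delta> (set V)) \<delta>" (is ?S)
proof -
  let ?V = "set V" and ?Vt = "insert \<delta> (set V)" and ?\<eta> = "\<lambda>i. W i \<delta>"
  let ?N = "RV ?V \<Otimes>\<^sub>M RV ?V" and ?L = "lborel_pairs ?V"
  let ?O = "Omega_V ?Vt \<delta>" and ?R = "restrict_space (RV ?Vt \<Otimes>\<^sub>M RV ?Vt) (Omega_V ?Vt \<delta>)"
  let ?c = "coords W ?\<eta> (\<lambda>_. 0) ?V"
  let ?mu = "mu (insert \<delta> (set V)) E W \<delta>"
  let ?pd = "\<lambda>q. ennreal (pin_density W (\<lambda>i. W i \<delta>) V q)"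
  let ?m = "\<lambda>x. case x of (u, s) \<Rightarrow> ennreal (mu_density (insert \<delta> (set V)) E W \<delta> u s)"
  have V: "?Vt - {\<delta>} = ?V" using d by auto
  have W: "conductances W ?V" by (rule conductances_subset[OF weighted_graph_conductances[OF g]]) auto
  have O: "fst x \<delta> = 0" "snd x \<delta> = 0" if "x \<in> ?O" for x using that by (auto simp: Omega_V_def)
  have T: "T x = ?c x" if "fst x \<delta> = 0" "snd x \<delta> = 0" for x
    using beta_theta_eq_coords[of \<delta> ?V "fst x" "snd x" W] that d W by (simp add: T_def case_prod_beta')
  have spR: "space ?R = ?O"
    by (auto simp: space_restrict_space space_pair_measure Omega_V_def)
  have sp: "space (?mu) = ?O" by (simp add: mu_def lebesgue_Omega_V_def spR)
  then show ?S by simp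
  have setsmu: "sets (?mu) = sets ?R" by (simp add: mu_def lebesgue_Omega_V_def)
  define e where "e = (\<lambda>(u, s). (u(\<delta> := 0 :: real), s(\<delta> := 0 :: real)))"
  have r[measurable]: "restrict_pair ?V \<in> ?R \<rightarrow>\<^sub>M ?L"
  proof -
    have "restrict_pair ?V \<in> lborel_pairs ?Vt \<rightarrow>\<^sub>M ?L" by (rule measurable_restrict_pair) auto
    then have "restrict_pair ?V \<in> RV ?Vt \<Otimes>\<^sub>M RV ?Vt \<rightarrow>\<^sub>M ?L"
      by (simp cong: measurable_cong_sets add: sets_lborel_pairs[symmetric])
    then show ?thesis by (rule measurable_restrict_space1)
  qed
  have c: "?c \<in> ?L \<rightarrow>\<^sub>M ?L" by (rule measurable_coords) simp
  have cT: "(\<lambda>x. ?c (restrict_pair ?V x)) \<in> ?R \<rightarrow>\<^sub>M ?L" using measurable_compose[OF r c] .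
  have TL: "T \<in> ?R \<rightarrow>\<^sub>M ?L"
    using cT by (rule measurable_cong[THEN iffD1, rotated]) (use spR in \<open>auto simp: coords_restrict_pair T O\<close>)
  then have TR: "T \<in> ?R \<rightarrow>\<^sub>M ?N" by (simp cong: measurable_cong_sets add: sets_lborel_pairs)
  show Tm: ?M using TR by (simp cong: measurable_cong_sets add: setsmu)
  have dens: "(\<lambda>(u, s). ennreal (mu_density ?Vt E W \<delta> u s)) \<in> borel_measurable ?R"
  proof -
    have j: "(\<lambda>p. jacobian W ?\<eta> V (fst p)) \<in> borel_measurable ?L" by (rule measurable_jacobian)
    have "(\<lambda>x. ennreal (pin_density W ?\<eta> V (?c (restrict_pair ?V x)) * jacobian W ?\<eta> V (fst (restrict_pair ?V x)))) \<in> borel_measurable ?R"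
      using measurable_compose[OF cT measurable_pin_density[of W ?\<eta> V]] measurable_compose[OF r j] by measurable
    then show ?thesis
      by (rule measurable_cong[THEN iffD1, rotated])
        (use spR in \<open>auto simp: coords_restrict_pair jacobian_restrict_pair case_prod_beta' mu_density_eq[OF d g link O]\<close>)
  qed
  have eL: "e \<in> ?L \<rightarrow>\<^sub>M ?R"
  proof (rule measurable_restrict_space2)
    show "e \<in> space ?L \<rightarrow> ?O"
      by (auto simp: e_def Omega_V_def space_pair_measure space_PiM PiE_def extensional_def)
    have "e \<in> ?L \<rightarrow>\<^sub>M lborel_pairs ?Vt"
      unfolding e_def case_prod_beta' by (intro measurable_Pair measurable_upd) auto
    then show "e \<in> ?L \<rightarrow>\<^sub>M RV ?Vt \<Otimes>\<^sub>M RV ?Vt"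
      by (simp cong: measurable_cong_sets add: sets_lborel_pairs[symmetric])
  qed
  have leb: "lebesgue_Omega_V ?Vt \<delta> = distr ?L ?R e"
    unfolding lebesgue_Omega_V_def V e_def ..
  have ec: "?c (e p) = ?c p" "jacobian W ?\<eta> V (fst (e p)) = jacobian W ?\<eta> V (fst p)" for p
  proof -
    have "restrict_pair ?V (e p) = restrict_pair ?V p"
      using d by (auto simp: restrict_pair_def e_def case_prod_beta' restrict_def fun_eq_iff)
    then show "?c (e p) = ?c p" "jacobian W ?\<eta> V (fst (e p)) = jacobian W ?\<eta> V (fst p)"
      using coords_restrict_pair[of W ?\<eta> "\<lambda>_. 0" ?V] jacobian_restrict_pair[of W ?\<eta> V] by metis+
  qed
  show ?D
  proof (rule measure_eqI)
    show "sets (distr (?mu) ?N T) = sets (density ?L (\<lambda>q. ?pd q))"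
      by (simp add: sets_lborel_pairs)
    fix X assume "X \<in> sets (distr (?mu) ?N T)"
    then have X: "X \<in> sets ?N" and X'[measurable]: "X \<in> sets ?L" by (simp_all add: sets_lborel_pairs)
    have iX: "(indicator X :: _ \<Rightarrow> ennreal) \<in> borel_measurable ?L" by measurable
    have pd[measurable]: "pin_density W ?\<eta> V \<in> borel_measurable ?L" by (rule measurable_pin_density)
    have "emeasure (distr (?mu) ?N T) X = (\<integral>\<^sup>+y. indicator X y \<partial>distr (?mu) ?N T)"
      using X by simp
    also have "\<dots> = (\<integral>\<^sup>+x. indicator X (T x) \<partial>?mu)"
      by (rule nn_integral_distr[OF Tm]) (use X in simp)
    also have "\<dots> = (\<integral>\<^sup>+x. ?m x * indicator X (T x) \<partial>distr ?L ?R e)"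
      unfolding mu_def leb using dens measurable_compose[OF TL iX]
      by (intro nn_integral_density) simp_all
    also have "\<dots> = (\<integral>\<^sup>+p. ?m (e p) * indicator X (T (e p)) \<partial>?L)"
      using dens measurable_compose[OF TL iX] by (intro nn_integral_distr eL borel_measurable_times_ennreal) simp_all
    also have "\<dots> = (\<integral>\<^sup>+p. (ennreal (pin_density W ?\<eta> V (?c p)) * indicator X (?c p)) * ennreal (jacobian W ?\<eta> V (fst p)) \<partial>?L)"
    proof (rule nn_integral_cong)
      fix p
      have z: "fst (e p) \<delta> = 0" "snd (e p) \<delta> = 0" by (auto simp: e_def case_prod_beta')
      show "?m (e p) * indicator X (T (e p))
        = (ennreal (pin_density W ?\<eta> V (?c p)) * indicator X (?c p)) * ennreal (jacobian W ?\<eta> V (fst p))"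
        using mu_density_eq[OF d g link z]
        by (simp add: T[OF z] ec case_prod_beta' ennreal_mult pin_density_nonneg jacobian_nonneg mult_ac)
    qed
    also have "\<dots> = (\<integral>\<^sup>+q. (?pd q * indicator X q) * indicator {q. pos_pivots W (fst q) V} q \<partial>?L)"
      by (rule nn_integral_coords[OF d(2) W link]) measurable
    also have "\<dots> = (\<integral>\<^sup>+q. ?pd q * indicator X q \<partial>?L)"
      by (intro nn_integral_cong) (auto simp: pin_density_def split: split_indicator)
    also have "\<dots> = emeasure (density ?L (\<lambda>q. ?pd q)) X"
      by (rule emeasure_density[symmetric]) auto
    finally show "emeasure (distr (?mu) ?N T) X = emeasure (density ?L (\<lambda>q. ?pd q)) X" .
  qed
qed

text \<open>The observable of the theorem as a function of \<open>(\<beta>, \<theta>)\<close>, through \<open>f\<close> and \<open>g\<close>.\<close>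

definition field_observable :: "'a set \<Rightarrow> ('a \<Rightarrow> 'a \<Rightarrow> real) \<Rightarrow> 'a \<Rightarrow> (('a \<Rightarrow> real) \<Rightarrow> 'a \<Rightarrow> real) \<Rightarrow> ('a \<Rightarrow> real) \<Rightarrow>
   ('a \<Rightarrow> real) \<times> ('a \<Rightarrow> real) \<Rightarrow> complex" where
  "field_observable Vt W \<delta> f \<alpha> q = exp (\<Sum>j\<in>Vt. of_real (\<alpha> j * exp (f (fst q) j)) * (1 + \<i> * of_real (g_V Vt W \<delta> f (fst q) (snd q) j)))"

lemma field_observable_eq:
  assumes d: "\<delta> \<notin> set V" "distinct V" and W: "conductances W (set V)" and link: "linked W (\<lambda>i. W i \<delta>) (set V)"
    and b: "b = beta_of W (\<lambda>i. W i \<delta> * exp (f (fst q) \<delta>)) (set V) (f (fst q))"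
  shows "field_observable (insert \<delta> (set V)) W \<delta> f \<alpha> q =
    exp (of_real (\<alpha> \<delta> * exp (f (fst q) \<delta>) + (\<Sum>j\<in>set V. \<alpha> j * exp (f (fst q) j)))
      + \<i> * of_real (\<Sum>j\<in>set V. \<alpha> j * green_vec W b V (snd q) j))"
proof -
  let ?g = "g_V (insert \<delta> (set V)) W \<delta> f (fst q) (snd q)"
  have g0: "?g \<delta> = 0" by (simp add: g_V_def)
  have "(\<Sum>j\<in>set V. of_real (\<alpha> j * exp (f (fst q) j)) * (1 + \<i> * of_real (?g j)))
    = (\<Sum>j\<in>set V. complex_of_real (\<alpha> j * exp (f (fst q) j)) + \<i> * of_real (\<alpha> j * green_vec W b V (snd q) j))"
  proof (rule sum.cong[OF refl])
    fix j assume j: "j \<in> set V"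
    show "of_real (\<alpha> j * exp (f (fst q) j)) * (1 + \<i> * of_real (?g j))
      = complex_of_real (\<alpha> j * exp (f (fst q) j)) + \<i> * of_real (\<alpha> j * green_vec W b V (snd q) j)"
      unfolding g_V_eq[where f = f and \<beta> = "fst q", OF d W link j b, symmetric] by (simp add: distrib_left mult_ac)
  qed
  then show ?thesis
    using d by (simp add: field_observable_def g0 sum.distrib sum_distrib_left add_ac)
qed

text \<open>Here \<open>f\<close> is known only to be measurable, and its values off the range of \<open>\<beta>\<close> are arbitrary.
The expression by the Green form holds everywhere, and it is rational in measurable quantities.\<close>

lemma measurable_field_observable:
  assumes d: "\<delta> \<notin> set V" "distinct V" and W: "conductances W (set V)" and link: "linked W (\<lambda>i. W i \<delta>) (set V)"
    and f: "f \<in> RV (set V) \<rightarrow>\<^sub>M RV (insert \<delta> (set V))"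
  shows "field_observable (insert \<delta> (set V)) W \<delta> f \<alpha> \<in> borel_measurable (RV (set V) \<Otimes>\<^sub>M RV (set V))"
proof -
  let ?N = "RV (set V) \<Otimes>\<^sub>M RV (set V)"
  have fm[measurable]: "(\<lambda>q. f (fst q) i) \<in> borel_measurable ?N" if "i \<in> insert \<delta> (set V)" for i
    using measurable_compose[OF measurable_compose[OF measurable_fst f] measurable_component_singleton[OF that]] .
  let ?b = "\<lambda>q. beta_of W (\<lambda>i. W i \<delta> * exp (f (fst q) \<delta>)) (set V) (f (fst q))"
  have bm: "(\<lambda>q. ?b q i) \<in> borel_measurable ?N" if "i \<in> set V" for i
    using that by (simp add: beta_of_def)
  have sm: "(\<lambda>q. snd q i) \<in> borel_measurable ?N" if "i \<in> set V" for i
    using measurable_compose[OF measurable_snd measurable_component_singleton[OF that]] .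
  have [measurable]: "(\<lambda>q. green_vec W (?b q) V (snd q) i) \<in> borel_measurable ?N" for i
    unfolding green_vec_def by (rule measurable_green) (use bm sm in auto)
  show ?thesis
    unfolding field_observable_eq[where f = f, OF d W link refl, abs_def] by measurable
qed

lemma field_observable_coords:
  assumes d: "\<delta> \<notin> set V" "distinct V" and W: "conductances W (set V)" and link: "linked W (\<lambda>i. W i \<delta>) (set V)"
    and f: "f (fst q) = u" and q: "q = coords W (\<lambda>i. W i \<delta>) (\<lambda>_. 0) (set V) (u, s)" and 0: "u \<delta> = 0"
  shows "field_observable (insert \<delta> (set V)) W \<delta> f \<alpha> q = exp_observable W (\<lambda>i. W i \<delta>) \<alpha> (\<alpha> \<delta>) V q"
proof -
  have q1: "fst q = beta_of W (\<lambda>i. W i \<delta>) (set V) u" by (simp add: q coords_def)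
  have pos: "pos_pivots W (fst q) V" unfolding q1 by (rule pos_pivots_beta_of[OF d(2) W link])
  have b: "fst q = beta_of W (\<lambda>i. W i \<delta> * exp (f (fst q) \<delta>)) (set V) (f (fst q))"
    by (simp add: f 0 q1[symmetric])
  have "green W (fst q) V \<alpha> (\<lambda>i. W i \<delta>) = green W (fst q) V \<alpha> (schrod W (fst q) (set V) (\<lambda>j. exp (u j)))"
    by (rule green_cong) (simp_all add: q1 schrod_beta_of)
  also have "\<dots> = (\<Sum>j\<in>set V. \<alpha> j * exp (u j))" by (rule green_schrod[OF d(2) W pos])
  finally have 1: "green W (fst q) V \<alpha> (\<lambda>i. W i \<delta>) = \<dots>" .
  show ?thesis
    unfolding field_observable_eq[where f = f and q = q, OF d W link b] exp_observable_def green_eq_sum_green_vec[OF d(2) W pos, of \<alpha> "snd q"]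
    by (simp add: f 0 1)
qed

section \<open>The martingale\<close>

lemma pin_density_cong:
  assumes "\<And>i j. i \<in> set V \<Longrightarrow> j \<in> set V \<Longrightarrow> W i j = W' i j" "\<And>i. i \<in> set V \<Longrightarrow> \<eta> i = \<eta>' i"
  shows "pin_density W \<eta> V q = pin_density W' \<eta>' V q"
proof -
  have "(\<Sum>i\<in>set V. \<Sum>j\<in>set V. W i j) = (\<Sum>i\<in>set V. \<Sum>j\<in>set V. W' i j)" "(\<Sum>i\<in>set V. \<eta> i) = (\<Sum>i\<in>set V. \<eta>' i)"
    using assms by (auto intro!: sum.cong)
  moreover have "green W (fst q) V \<eta> \<eta> = green W' (fst q) V \<eta>' \<eta>'"
    "green W (fst q) V (snd q) (snd q) = green W' (fst q) V (snd q) (snd q)"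
    by (rule green_cong; use assms in auto)+
  moreover have "pos_pivots W (fst q) V = pos_pivots W' (fst q) V"
    "pivot_prod W (fst q) V = pivot_prod W' (fst q) V"
    by (rule pos_pivots_cong pivot_prod_cong; use assms in auto)+
  ultimately show ?thesis by (simp add: pin_density_def)
qed

lemma exp_observable_cong:
  assumes "\<And>i j. i \<in> set V \<Longrightarrow> j \<in> set V \<Longrightarrow> W i j = W' i j" "\<And>i. i \<in> set V \<Longrightarrow> \<eta> i = \<eta>' i"
    "\<And>i. i \<in> set V \<Longrightarrow> \<alpha> i = \<alpha>' i"
  shows "exp_observable W \<eta> \<alpha> a V q = exp_observable W' \<eta>' \<alpha>' a V q"
proof -
  have "green W (fst q) V \<alpha> \<eta> = green W' (fst q) V \<alpha>' \<eta>'" "green W (fst q) V \<alpha> (snd q) = green W' (fst q) V \<alpha>' (snd q)"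
    by (rule green_cong; use assms in auto)+
  then show ?thesis by (simp add: exp_observable_def)
qed

text \<open>The parameters lie almost surely in the range of the fields, where \<open>f\<close> recovers \<open>u\<close>.\<close>

lemma AE_field_observable:
  assumes d: "\<delta> \<notin> set V" "distinct V" and g: "weighted_graph (insert \<delta> (set V)) E W"
    and link: "linked W (\<lambda>i. W i \<delta>) (set V)" and f: "recovers_u (insert \<delta> (set V)) W \<delta> f"
  shows "AE q in density (lborel_pairs (set V)) (\<lambda>q. ennreal (pin_density W (\<lambda>i. W i \<delta>) V q)).
    field_observable (insert \<delta> (set V)) W \<delta> f \<alpha> q = exp_observable W (\<lambda>i. W i \<delta>) \<alpha> (\<alpha> \<delta>) V q"
proof -
  let ?U = "insert \<delta> (set V)"
  let ?K = "exp_observable W (\<lambda>i. W i \<delta>) \<alpha> (\<alpha> \<delta>) V"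
  let ?Z = "field_observable (insert \<delta> (set V)) W \<delta> f \<alpha>"
  let ?N = "RV (set V) \<Otimes>\<^sub>M RV (set V)"
  have V: "?U - {\<delta>} = set V" using d by auto
  have W: "conductances W (set V)" by (rule conductances_subset[OF weighted_graph_conductances[OF g]]) auto
  have fu: "f (beta_V (?U) W \<delta> u) = u" if "u \<in> space (RV (?U))" "u \<delta> = 0" for u
    using f that unfolding recovers_u_def V by auto
  have fm: "f \<in> RV (set V) \<rightarrow>\<^sub>M RV (?U)" using f unfolding recovers_u_def V by auto
  have [measurable]: "?Z \<in> borel_measurable ?N"
    by (rule measurable_field_observable[OF d W link fm])
  have [measurable]: "?K \<in> borel_measurable ?N"
    using measurable_exp_observable[of W "\<lambda>i. W i \<delta>" \<alpha> "\<alpha> \<delta>" V] by (simp cong: measurable_cong_sets add: sets_lborel_pairs)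
  let ?T = "\<lambda>(u, s). (beta_V (?U) W \<delta> u, theta_V (?U) W \<delta> u s)"
  show ?thesis
    unfolding distr_mu_coords(2)[OF d g link, symmetric]
  proof (subst AE_distr_iff[OF distr_mu_coords(1)[OF d g link]])
    show "{q \<in> space ?N. ?Z q = ?K q} \<in> sets ?N"
      by measurable
    show "AE x in mu (?U) E W \<delta>.
      ?Z (?T x)
      = ?K (?T x)"
    proof (rule AE_I2)
      fix x assume "x \<in> space (mu (?U) E W \<delta>)"
      then have "x \<in> Omega_V (?U) \<delta>" using distr_mu_coords(3)[OF d g link] by blast
      then obtain u s where x: "x = (u, s)" "u \<in> space (RV (?U))" "u \<delta> = 0" "s \<delta> = 0"
        by (auto simp: Omega_V_def)
      have q: "(beta_V (?U) W \<delta> u, theta_V (?U) W \<delta> u s) = coords W (\<lambda>i. W i \<delta>) (\<lambda>_. 0) (set V) (u, s)"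
        by (rule beta_theta_eq_coords) (use d x W in auto)
      have "f (fst (beta_V (?U) W \<delta> u, theta_V (?U) W \<delta> u s)) = u"
        using fu[OF x(2,3)] by simp
      from field_observable_coords[where f = f and q = "(beta_V (?U) W \<delta> u, theta_V (?U) W \<delta> u s)", OF d W link this q x(3)]
      show "?Z (?T x)
      = ?K (?T x)"
        by (simp add: x)
    qed
  qed
qed

text \<open>The finite-volume content of the martingale property: expectations against functions of the parameters
on \<open>A\<close>, with the vertices of \<open>C\<close> integrated out.\<close>

lemma field_observable_law:
  assumes d: "\<delta> \<notin> set (C @ A)" "distinct (C @ A)" and g: "weighted_graph (insert \<delta> (set (C @ A))) E W"
    and link: "linked W (\<lambda>i. W i \<delta>) (set (C @ A))" and f: "recovers_u (insert \<delta> (set (C @ A))) W \<delta> f"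
    and \<alpha>: "\<And>i. i \<in> insert \<delta> (set (C @ A)) \<Longrightarrow> \<alpha> i \<le> 0"
    and \<phi>: "\<phi> \<in> borel_measurable (lborel_pairs (set A))" "\<And>q. norm (\<phi> q) \<le> 1"
  defines "P \<equiv> density (lborel_pairs (set (C @ A))) (\<lambda>q. ennreal (pin_density W (\<lambda>i. W i \<delta>) (C @ A) q))"
    and "Z \<equiv> field_observable (insert \<delta> (set (C @ A))) W \<delta> f \<alpha>"
  shows "integrable P (\<lambda>q. Z q * \<phi> (restrict_pair (set A) q))"
    and "(\<integral>q. Z q * \<phi> (restrict_pair (set A) q) \<partial>P) =
     (\<integral>q. of_real (pin_density W (\<lambda>i. W i \<delta> + (\<Sum>c\<in>set C. W c i)) A q)
        * exp_observable W (\<lambda>i. W i \<delta> + (\<Sum>c\<in>set C. W c i)) \<alpha> (\<alpha> \<delta> + (\<Sum>c\<in>set C. \<alpha> c)) A q * \<phi> q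
        \<partial>lborel_pairs (set A))"
proof -
  let ?V = "C @ A" and ?\<eta> = "\<lambda>i. W i \<delta>"
  let ?e = "\<lambda>i. W i \<delta> + (\<Sum>c\<in>set C. W c i)"
  let ?ph = "\<lambda>q. \<phi> (restrict_pair (set A) q)"
  let ?L = "lborel_pairs (set ?V)"
  let ?Y = "exp_observable W ?\<eta> \<alpha> (\<alpha> \<delta>) ?V"
  let ?D = "pin_density W ?\<eta> ?V"
  have W: "conductances W (set ?V)" by (rule conductances_subset[OF weighted_graph_conductances[OF g]]) auto
  have V: "insert \<delta> (set ?V) - {\<delta>} = set ?V" using d by auto
  have fm: "f \<in> RV (set ?V) \<rightarrow>\<^sub>M RV (insert \<delta> (set ?V))" using f unfolding recovers_u_def V by auto
  have \<alpha>V: "\<And>i. i \<in> set ?V \<Longrightarrow> \<alpha> i \<le> 0" "\<alpha> \<delta> \<le> 0" using \<alpha> by auto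
  have "restrict_pair (set A) \<in> ?L \<rightarrow>\<^sub>M lborel_pairs (set A)" by (rule measurable_restrict_pair) auto
  from measurable_compose[OF this \<phi>(1)] have \<phi>m: "(\<lambda>q. ?ph q) \<in> borel_measurable ?L" .
  have Dm: "?D \<in> borel_measurable ?L" by (rule measurable_pin_density)
  have Ym: "?Y \<in> borel_measurable ?L" by (rule measurable_exp_observable)
  have Zm: "Z \<in> borel_measurable ?L"
    using measurable_field_observable[OF d W link fm, of \<alpha>]
    by (simp cong: measurable_cong_sets add: sets_lborel_pairs Z_def)
  have Y\<phi>m: "(\<lambda>q. ?Y q * ?ph q) \<in> borel_measurable ?L"
    by (rule borel_measurable_times[OF Ym \<phi>m])
  have Z\<phi>m: "(\<lambda>q. Z q * ?ph q) \<in> borel_measurable ?L"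
    by (rule borel_measurable_times[OF Zm \<phi>m])
  have AE: "AE q in P. Z q * ?ph q = ?Y q * ?ph q"
    using AE_field_observable[OF d g link f, of \<alpha>] unfolding P_def Z_def by eventually_elim simp
  have I: "integrable ?L (\<lambda>q. of_real (?D q) * ?Y q * ?ph q)"
    by (rule integrable_density_observable[OF d(2) W link \<alpha>V \<phi>m \<phi>(2)])
  have D0: "AE q in ?L. 0 \<le> ?D q" by (simp add: pin_density_nonneg)
  have "integrable P (\<lambda>q. ?Y q * ?ph q)"
    unfolding P_def using I Dm Y\<phi>m D0 by (subst integrable_density) (auto simp: scaleR_conv_of_real mult.assoc)
  then show "integrable P (\<lambda>q. Z q * ?ph q)"
    using AE Z\<phi>m Y\<phi>m by (subst integrable_cong_AE[OF _ _ AE]) (simp_all add: P_def)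
  have "(\<integral>q. Z q * ?ph q \<partial>P) = (\<integral>q. ?Y q * ?ph q \<partial>P)"
    by (rule integral_cong_AE[OF _ _ AE]) (use Z\<phi>m Y\<phi>m in \<open>simp_all add: P_def\<close>)
  also have "\<dots> = (\<integral>q. of_real (?D q) * ?Y q * ?ph q \<partial>?L)"
    unfolding P_def using Dm Y\<phi>m D0 by (subst integral_density) (auto simp: scaleR_conv_of_real mult.assoc)
  also have "\<dots> = (\<integral>q. of_real (pin_density W ?e A q)
        * exp_observable W ?e \<alpha> (\<alpha> \<delta> + (\<Sum>c\<in>set C. \<alpha> c)) A q * \<phi> q
        \<partial>lborel_pairs (set A))"
    by (rule integral_marginal[OF d(2) W link \<alpha>V \<phi>])
  finally show "(\<integral>q. Z q * ?ph q \<partial>P) = \<dots>" .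
qed

text \<open>The real characterization of conditional expectations, applied to the real and the imaginary part.\<close>

lemma complex_cond_exp_eqI:
  fixes X Y :: "'w \<Rightarrow> complex"
  assumes M: "finite_measure M" and sub: "subalgebra M F"
    and X: "integrable M X" and Y: "integrable M Y" and YF: "Y \<in> borel_measurable F"
    and eq: "\<And>S. S \<in> sets F \<Longrightarrow> (\<integral>\<omega>. X \<omega> * indicator S \<omega> \<partial>M) = (\<integral>\<omega>. Y \<omega> * indicator S \<omega> \<partial>M)"
  shows "AE \<omega> in M. complex_cond_exp M F X \<omega> = Y \<omega>"
proof -
  interpret finite_measure_subalgebra M F
    by (intro finite_measure_subalgebra.intro finite_measure_subalgebra_axioms.intro M sub)
  have part: "AE \<omega> in M. real_cond_exp M F (\<lambda>\<omega>. L (X \<omega>)) \<omega> = L (Y \<omega>)"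
    if L: "bounded_linear L" for L :: "complex \<Rightarrow> real"
  proof (rule real_cond_exp_charact)
    fix S assume S: "S \<in> sets F"
    then have SM: "S \<in> sets M" using sub unfolding subalgebra_def by blast
    have LS: "(\<integral>\<omega>\<in>S. L (U \<omega>) \<partial>M) = L (\<integral>\<omega>. U \<omega> * indicator S \<omega> \<partial>M)" if U: "integrable M U" for U
    proof -
      have "integrable M (\<lambda>\<omega>. indicator S \<omega> *\<^sub>R U \<omega>)" by (rule integrable_mult_indicator[OF SM U])
      moreover have e: "indicator S \<omega> *\<^sub>R U \<omega> = U \<omega> * indicator S \<omega>" for \<omega> by (simp add: indicator_def)
      ultimately have "integrable M (\<lambda>\<omega>. U \<omega> * indicator S \<omega>)" by simp
      from integral_bounded_linear[OF L this]
      have "(\<integral>\<omega>. L (U \<omega> * indicator S \<omega>) \<partial>M) = L (\<integral>\<omega>. U \<omega> * indicator S \<omega> \<partial>M)" .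
      moreover have "indicator S \<omega> *\<^sub>R L (U \<omega>) = L (U \<omega> * indicator S \<omega>)" for \<omega>
        using linear_0[OF bounded_linear.linear[OF L]] by (simp add: indicator_def)
      ultimately show ?thesis unfolding set_lebesgue_integral_def by simp
    qed
    show "(\<integral>\<omega>\<in>S. L (X \<omega>) \<partial>M) = (\<integral>\<omega>\<in>S. L (Y \<omega>) \<partial>M)"
      using eq[OF S] LS[OF X] LS[OF Y] by simp
  next
    show "integrable M (\<lambda>\<omega>. L (X \<omega>))" "integrable M (\<lambda>\<omega>. L (Y \<omega>))"
      using integrable_bounded_linear[OF L] X Y by auto
    show "(\<lambda>\<omega>. L (Y \<omega>)) \<in> borel_measurable F"
      by (rule measurable_compose[OF YF borel_measurable_continuous_onI[OF linear_continuous_on[OF L]]])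
  qed
  show ?thesis
    using part[OF bounded_linear_Re] part[OF bounded_linear_Im]
    by eventually_elim (simp add: complex_cond_exp_def complex_eq_iff)
qed

theorem theorem1p3:
  fixes Vinf :: "'a set" and Einf :: "'a set set" and W :: "'a \<Rightarrow> 'a \<Rightarrow> real"
    and V :: "nat \<Rightarrow> 'a set" and \<delta> :: "nat \<Rightarrow> 'a"
    and M :: "'w measure" and \<beta> \<theta> :: "'a \<Rightarrow> 'w \<Rightarrow> real"
    and f :: "nat \<Rightarrow> ('a \<Rightarrow> real) \<Rightarrow> ('a \<Rightarrow> real)"
    and \<alpha> :: "'a \<Rightarrow> real"
  assumes "infinite Vinf"
    and "weighted_graph Vinf Einf W"
    and "wired_approximation Vinf Einf W V \<delta>"
    and "infinite_volume_coupling Vinf Einf W V \<delta> M \<beta> \<theta>"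
    and "\<And>n. recovers_u (insert (\<delta> n) (V n)) (wired_weight Vinf W (V n) (\<delta> n)) (\<delta> n) (f n)"
    and "\<And>i. i \<in> Vinf \<Longrightarrow> \<alpha> i \<le> 0"
    and "finite {i \<in> Vinf. \<alpha> i \<noteq> 0}"
  shows "complex_martingale M (F_n M V \<beta> \<theta>)
    (\<lambda>n \<omega>. exp (\<Sum>j\<in>insert (\<delta> n) (V n).
        of_real (wired_alpha Vinf \<alpha> (V n) (\<delta> n) j * exp (u_n V f \<beta> n \<omega> j))
        * (1 + \<i> * of_real (s_n Vinf W V \<delta> f \<beta> \<theta> n \<omega> j))))"
proof -
  define Wn where "Wn n = wired_weight Vinf W (V n) (\<delta> n)" for n
  define \<alpha>n where "\<alpha>n n = wired_alpha Vinf \<alpha> (V n) (\<delta> n)" for n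
  define En where "En n = wired_edges Vinf Einf (V n) (\<delta> n)" for n
  define \<pi> where "\<pi> n \<omega> = (restrict_rv (V n) \<beta> \<omega>, restrict_rv (V n) \<theta> \<omega>)" for n \<omega>
  define Z where "Z n = field_observable (insert (\<delta> n) (V n)) (Wn n) (\<delta> n) (f n) (\<alpha>n n)" for n
  define N where "N n = (RV (V n) \<Otimes>\<^sub>M RV (V n) :: (('a \<Rightarrow> real) \<times> ('a \<Rightarrow> real)) measure)" for n
  define X where "X n \<omega> = Z n (\<pi> n \<omega>)" for n \<omega>
  note wired = assms(3)[unfolded wired_approximation_def]
  have finV: "finite (V n)" and VSuc: "V n \<subseteq> V (Suc n)" and Vinf: "V n \<subseteq> Vinf" and \<delta>: "\<delta> n \<notin> Vinf" for n
    using wired by blast+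
  have \<delta>V: "\<delta> n \<notin> V n" for n using Vinf \<delta> by blast
  have Vmono: "V m \<subseteq> V n" if "m \<le> n" for m n using lift_Suc_mono_le[of V, OF VSuc that] .
  have Wsum: "(\<lambda>j. W i j) summable_on (Vinf - V n)" if "i \<in> V n" for i n using wired that by blast
  have Wsym: "W i j = W j i" if "i \<in> Vinf" "j \<in> Vinf" for i j
    using assms(2) that unfolding weighted_graph_def by blast
  have graph: "finite_model_graph (insert (\<delta> n) (V n)) (En n) (Wn n) (\<delta> n)" for n
    using wired unfolding En_def Wn_def by blast
  have wg: "weighted_graph (insert (\<delta> n) (V n)) (En n) (Wn n)" for n
    using graph[of n] unfolding finite_model_graph_def by blast
  have link: "linked (Wn n) (\<lambda>i. Wn n i (\<delta> n)) (V n)" for n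
    using graph[of n] \<delta>V[of n] unfolding finite_model_graph_def by (blast intro: connected_graph_linked)
  have cond: "conductances (Wn n) (V n)" for n
    by (rule conductances_subset[OF weighted_graph_conductances[OF wg]]) auto
  have rec: "recovers_u (insert (\<delta> n) (V n)) (Wn n) (\<delta> n) (f n)" for n
    using assms(5) unfolding Wn_def .
  have \<alpha>n0: "\<alpha>n n i \<le> 0" if "i \<in> insert (\<delta> n) (V n)" for n i
  proof (cases "i = \<delta> n")
    case True
    have "0 \<le> (\<Sum>\<^sub>\<infinity>k\<in>Vinf - V n. - \<alpha> k)" by (rule infsum_nonneg) (use assms(6) in auto)
    then show ?thesis using True by (simp add: \<alpha>n_def wired_alpha_def infsum_uminus)
  next
    case False
    then show ?thesis using that assms(6) Vinf by (auto simp: \<alpha>n_def wired_alpha_def)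
  qed
  have \<beta>m: "\<beta> i \<in> borel_measurable M" and \<theta>m: "\<theta> i \<in> borel_measurable M" if "i \<in> Vinf" for i
    using assms(4) that unfolding infinite_volume_coupling_def by blast+
  have P: "prob_space M" using assms(4) unfolding infinite_volume_coupling_def by blast
  interpret prob_space M by (rule P)
  have \<pi>m: "\<pi> n \<in> M \<rightarrow>\<^sub>M N n" for n
    unfolding \<pi>_def[abs_def] restrict_rv_def N_def using \<beta>m \<theta>m Vinf[of n]
    by (intro measurable_Pair measurable_restrict) auto
  have law: "distr M (N n) (\<pi> n) = density (lborel_pairs (set vs)) (\<lambda>q. ennreal (pin_density (Wn n) (\<lambda>i. Wn n i (\<delta> n)) vs q))"
    if vs: "set vs = V n" "distinct vs" for vs n
  proof -
    have "distr M (N n) (\<pi> n) = distr (mu (insert (\<delta> n) (V n)) (En n) (Wn n) (\<delta> n)) (N n)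
          (\<lambda>(u, s). (beta_V (insert (\<delta> n) (V n)) (Wn n) (\<delta> n) u, theta_V (insert (\<delta> n) (V n)) (Wn n) (\<delta> n) u s))"
      using assms(4) unfolding infinite_volume_coupling_def Let_def Wn_def En_def N_def \<pi>_def[abs_def] by blast
    also have "\<dots> = density (lborel_pairs (set vs)) (\<lambda>q. ennreal (pin_density (Wn n) (\<lambda>i. Wn n i (\<delta> n)) vs q))"
      unfolding N_def vs(1)[symmetric]
      by (rule distr_mu_coords(2)) (use \<delta>V[of n] vs wg[of n] link[of n] in simp_all)
    finally show ?thesis .
  qed
  have Zm: "Z n \<in> borel_measurable (N n)" for n
  proof -
    obtain vs where vs: "set vs = V n" "distinct vs" using finite_distinct_list[OF finV] by blast
    have "f n \<in> RV (V n) \<rightarrow>\<^sub>M RV (insert (\<delta> n) (V n))"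
      using rec[of n] \<delta>V[of n] unfolding recovers_u_def by simp
    then show ?thesis
      using measurable_field_observable[of "\<delta> n" vs "Wn n" "f n" "\<alpha>n n"] vs \<delta>V[of n] cond[of n] link[of n]
      by (simp add: Z_def N_def)
  qed
  \<comment> \<open>The elimination needs an enumeration of each \<open>V m\<close>; the vertices of \<open>V n\<close> that are
    to be integrated out come before it in the list.\<close>
  obtain vl where vl: "\<And>n. set (vl n) = V n" "\<And>n. distinct (vl n)"
    using finite_distinct_list[OF finV] by metis
  \<comment> \<open>The common value of all expectations \<open>E (X n (\<phi> \<circ> \<pi> m))\<close>, \<open>n \<ge> m\<close>.\<close>
  define R where "R m \<phi> = (\<integral>q. of_real (pin_density (Wn m) (\<lambda>i. Wn m i (\<delta> m)) (vl m) q)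
        * exp_observable (Wn m) (\<lambda>i. Wn m i (\<delta> m)) (\<alpha>n m) (\<alpha>n m (\<delta> m)) (vl m) q * \<phi> q
        \<partial>lborel_pairs (V m))" for m and \<phi> :: "('a \<Rightarrow> real) \<times> ('a \<Rightarrow> real) \<Rightarrow> complex"
  have main: "integrable M (\<lambda>\<omega>. X n \<omega> * \<phi> (\<pi> m \<omega>))" "(\<integral>\<omega>. X n \<omega> * \<phi> (\<pi> m \<omega>) \<partial>M) = R m \<phi>"
    if mn: "m \<le> n" and \<phi>: "\<phi> \<in> borel_measurable (N m)" "\<And>q. norm (\<phi> q) \<le> 1" for m n \<phi>
  proof -
    obtain C where C: "set C = V n - V m" "distinct C" using finite_distinct_list[of "V n - V m"] finV[of n] by auto
    let ?A = "vl m"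
    have CA: "set (C @ ?A) = V n" "distinct (C @ ?A)" using C vl Vmono[OF mn] by auto
  let ?e = "\<lambda>i. Wn n i (\<delta> n) + (\<Sum>c\<in>set C. Wn n c i)"
  let ?em = "\<lambda>i. Wn m i (\<delta> m)"
    let ?P = "density (lborel_pairs (set (C @ ?A))) (\<lambda>q. ennreal (pin_density (Wn n) (\<lambda>i. Wn n i (\<delta> n)) (C @ ?A) q))"
    have lawn: "distr M (N n) (\<pi> n) = ?P" by (rule law[OF CA])
    have \<phi>m: "\<phi> \<in> borel_measurable (lborel_pairs (set ?A))"
      using \<phi>(1) unfolding N_def vl by (simp cong: measurable_cong_sets add: sets_lborel_pairs)
    have hyps: "\<delta> n \<notin> set (C @ ?A)" "distinct (C @ ?A)" "weighted_graph (insert (\<delta> n) (set (C @ ?A))) (En n) (Wn n)"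
      "linked (Wn n) (\<lambda>i. Wn n i (\<delta> n)) (set (C @ ?A))" "recovers_u (insert (\<delta> n) (set (C @ ?A))) (Wn n) (\<delta> n) (f n)"
      "\<And>i. i \<in> insert (\<delta> n) (set (C @ ?A)) \<Longrightarrow> \<alpha>n n i \<le> 0"
      unfolding CA(1) using \<delta>V wg link rec \<alpha>n0 CA(2) by blast+
    note fin = field_observable_law[where \<alpha> = "\<alpha>n n", OF hyps \<phi>m \<phi>(2), unfolded CA(1) vl, folded Z_def]
    let ?h = "\<lambda>q. Z n q * \<phi> (restrict_pair (V m) q)"
    have r: "restrict_pair (V m) (\<pi> n \<omega>) = \<pi> m \<omega>" for \<omega>
      using Vmono[OF mn] by (auto simp: \<pi>_def restrict_pair_def restrict_rv_def restrict_def fun_eq_iff)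
    have "restrict_pair (V m) \<in> N n \<rightarrow>\<^sub>M N m"
      using measurable_restrict_pair[OF Vmono[OF mn]] unfolding N_def by (simp cong: measurable_cong_sets add: sets_lborel_pairs)
    from measurable_compose[OF this \<phi>(1)] have hm: "?h \<in> borel_measurable (N n)"
      using Zm by (rule borel_measurable_times[rotated])
    have int: "integrable (distr M (N n) (\<pi> n)) ?h" using fin(1) unfolding lawn CA(1) .
    then show "integrable M (\<lambda>\<omega>. X n \<omega> * \<phi> (\<pi> m \<omega>))"
      using integrable_distr_eq[OF \<pi>m hm] by (simp add: r X_def)
    have "(\<integral>\<omega>. X n \<omega> * \<phi> (\<pi> m \<omega>) \<partial>M) = (\<integral>q. ?h q \<partial>distr M (N n) (\<pi> n))"
      using integral_distr[OF \<pi>m hm] by (simp add: r X_def)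
    also have "\<dots> = (\<integral>q. of_real (pin_density (Wn n) ?e ?A q)
        * exp_observable (Wn n) ?e (\<alpha>n n) (\<alpha>n n (\<delta> n) + (\<Sum>c\<in>set C. \<alpha>n n c)) ?A q * \<phi> q
        \<partial>lborel_pairs (V m))"
      using fin(2) unfolding lawn CA(1) .
    also have "\<dots> = R m \<phi>"
    proof -
      \<comment> \<open>Passing from \<open>V n\<close> to \<open>V m\<close>: the wired weights and the wired parameter on \<open>V m\<close>
        are those on \<open>V n\<close> with the contributions of \<open>C = V n - V m\<close> added.\<close>
      have split: "Vinf - V m = (Vinf - V n) \<union> set C" "(Vinf - V n) \<inter> set C = {}"
        using C(1) Vmono[OF mn] Vinf[of n] by auto
      have Weq: "Wn n i j = Wn m i j" if "i \<in> set ?A" "j \<in> set ?A" for i j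
        using that Vmono[OF mn] by (auto simp: Wn_def wired_weight_def vl)
      have \<eta>eq: "Wn n i (\<delta> n) + (\<Sum>c\<in>set C. Wn n c i) = Wn m i (\<delta> m)" if i: "i \<in> set ?A" for i
      proof -
        have iV: "i \<in> V m" "i \<in> V n" "i \<in> Vinf" using i Vmono[OF mn] Vinf by (auto simp: vl)
        have "(\<Sum>c\<in>set C. Wn n c i) = (\<Sum>c\<in>set C. W i c)"
          using iV C(1) Vinf[of n] by (intro sum.cong) (auto simp: Wn_def wired_weight_def Wsym)
        moreover have "(\<Sum>\<^sub>\<infinity>k\<in>Vinf - V m. W i k) = (\<Sum>\<^sub>\<infinity>k\<in>Vinf - V n. W i k) + (\<Sum>\<^sub>\<infinity>k\<in>set C. W i k)"
          unfolding split(1) by (rule infsum_Un_disjoint) (use Wsum[OF iV(2)] split(2) in auto)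
        ultimately show ?thesis using iV \<delta>V by (simp add: Wn_def wired_weight_def)
      qed
      have \<alpha>eq: "\<alpha>n n i = \<alpha>n m i" if i: "i \<in> set ?A" for i
      proof -
        have "i \<noteq> \<delta> n" "i \<noteq> \<delta> m" using i \<delta> Vinf[of m] by (auto simp: vl)
        then show ?thesis by (simp add: \<alpha>n_def wired_alpha_def)
      qed
      have aeq: "\<alpha>n n (\<delta> n) + (\<Sum>c\<in>set C. \<alpha>n n c) = \<alpha>n m (\<delta> m)"
      proof -
        have "(\<Sum>c\<in>set C. \<alpha>n n c) = (\<Sum>c\<in>set C. \<alpha> c)"
          using C(1) \<delta>V[of n] by (intro sum.cong) (auto simp: \<alpha>n_def wired_alpha_def)
        moreover have "finite {k \<in> Vinf - V n. \<alpha> k \<noteq> 0}" by (rule finite_subset[OF _ assms(7)]) auto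
        then have "(\<Sum>\<^sub>\<infinity>k\<in>Vinf - V m. \<alpha> k) = (\<Sum>\<^sub>\<infinity>k\<in>Vinf - V n. \<alpha> k) + (\<Sum>\<^sub>\<infinity>k\<in>set C. \<alpha> k)"
          unfolding split(1)
          by (intro infsum_Un_disjoint finite_nonzero_values_imp_summable_on split(2)) auto
        ultimately show ?thesis by (simp add: \<alpha>n_def wired_alpha_def)
      qed
      have "pin_density (Wn n) ?e ?A = pin_density (Wn m) ?em ?A"
        by (rule ext, rule pin_density_cong[OF Weq \<eta>eq])
      moreover have "exp_observable (Wn n) ?e (\<alpha>n n) (\<alpha>n m (\<delta> m)) ?A
        = exp_observable (Wn m) ?em (\<alpha>n m) (\<alpha>n m (\<delta> m)) ?A"
        by (rule ext, rule exp_observable_cong[OF Weq \<eta>eq \<alpha>eq])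
      ultimately show ?thesis unfolding R_def aeq by simp
    qed
    finally show "(\<integral>\<omega>. X n \<omega> * \<phi> (\<pi> m \<omega>) \<partial>M) = R m \<phi>" .
  qed
  have intX: "integrable M (X n)" for n using main(1)[of n n "\<lambda>_. 1"] by simp
  have F: "F_n M V \<beta> \<theta> n = vimage_algebra (space M) (\<pi> n) (N n)" for n
    by (simp add: F_n_def \<pi>_def[abs_def] N_def)
  have \<pi>sp: "\<pi> n \<in> space M \<rightarrow> space (N n)" for n using \<pi>m by (auto dest: measurable_space)
  have setsF: "sets (F_n M V \<beta> \<theta> n) = {\<pi> n -` B \<inter> space M | B. B \<in> sets (N n)}" for n
    unfolding F by (rule sets_vimage_algebra2[OF \<pi>sp])
  have spF: "space (F_n M V \<beta> \<theta> n) = space M" for n by (simp add: F)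
  have sub: "subalgebra M (F_n M V \<beta> \<theta> n)" for n
    unfolding subalgebra_def spF setsF using measurable_sets[OF \<pi>m] by auto
  have Fmono: "sets (F_n M V \<beta> \<theta> m) \<subseteq> sets (F_n M V \<beta> \<theta> n)" if mn: "m \<le> n" for m n
  proof
    fix S assume "S \<in> sets (F_n M V \<beta> \<theta> m)"
    then obtain B where B: "S = \<pi> m -` B \<inter> space M" "B \<in> sets (N m)" unfolding setsF by blast
    have rm: "restrict_pair (V m) \<in> N n \<rightarrow>\<^sub>M N m"
      using measurable_restrict_pair[OF Vmono[OF mn]] unfolding N_def by (simp cong: measurable_cong_sets add: sets_lborel_pairs)
    have r: "restrict_pair (V m) (\<pi> n \<omega>) = \<pi> m \<omega>" for \<omega>
      using Vmono[OF mn] by (auto simp: \<pi>_def restrict_pair_def restrict_rv_def restrict_def fun_eq_iff)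
    have "S = \<pi> n -` (restrict_pair (V m) -` B \<inter> space (N n)) \<inter> space M"
    proof (rule set_eqI)
      fix \<omega>
      have "\<pi> n \<omega> \<in> space (N n)" if "\<omega> \<in> space M" using \<pi>sp[of n] that by blast
      then show "\<omega> \<in> S \<longleftrightarrow> \<omega> \<in> \<pi> n -` (restrict_pair (V m) -` B \<inter> space (N n)) \<inter> space M"
        unfolding B by (simp add: r) blast
    qed
    then show "S \<in> sets (F_n M V \<beta> \<theta> n)" unfolding setsF using measurable_sets[OF rm B(2)] by blast
  qed
  have XF: "X n \<in> borel_measurable (F_n M V \<beta> \<theta> n)" for n
  proof -
    have "\<pi> n \<in> F_n M V \<beta> \<theta> n \<rightarrow>\<^sub>M N n" unfolding F by (rule measurable_vimage_algebra1[OF \<pi>sp])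
    from measurable_compose[OF this Zm] show ?thesis unfolding X_def[abs_def] .
  qed
  have mart: "AE \<omega> in M. complex_cond_exp M (F_n M V \<beta> \<theta> m) (X n) \<omega> = X m \<omega>" if mn: "m \<le> n" for m n
  proof (rule complex_cond_exp_eqI[OF finite_measure_axioms sub intX intX XF])
    fix S assume "S \<in> sets (F_n M V \<beta> \<theta> m)"
    then obtain B where B: "S = \<pi> m -` B \<inter> space M" "B \<in> sets (N m)" unfolding setsF by blast
    let ?\<phi> = "indicator B :: _ \<Rightarrow> complex"
    have \<phi>: "?\<phi> \<in> borel_measurable (N m)" using B(2) by simp
    have \<phi>1: "norm (?\<phi> q) \<le> 1" for q by (simp add: indicator_def)
    have "(\<integral>\<omega>. X k \<omega> * indicator S \<omega> \<partial>M) = R m ?\<phi>" if "m \<le> k" for k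
    proof -
      have "(\<integral>\<omega>. X k \<omega> * indicator S \<omega> \<partial>M) = (\<integral>\<omega>. X k \<omega> * ?\<phi> (\<pi> m \<omega>) \<partial>M)"
        by (rule Bochner_Integration.integral_cong) (simp_all add: B(1) indicator_def)
      then show ?thesis using main(2)[OF that \<phi> \<phi>1] by simp
    qed
    from this[OF mn] this[OF order_refl]
    show "(\<integral>\<omega>. X n \<omega> * indicator S \<omega> \<partial>M) = (\<integral>\<omega>. X m \<omega> * indicator S \<omega> \<partial>M)" by simp
  qed
  have "complex_martingale M (F_n M V \<beta> \<theta>) X"
    unfolding complex_martingale_def filtration_def using Fmono spF sub XF intX mart by blast
  then show ?thesis
    by (simp add: X_def[abs_def] Z_def field_observable_def \<pi>_def u_n_def s_n_def Wn_def \<alpha>n_def)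
qed

end
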